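(* Let $h\ge 1$, and let $G=T\cup C\in\mathcal{G}_h$ with $G\ne N_{e_2}$. Then $\chi'_{st}(G)=5$.
   Context: All graphs are finite and simple. For $k\ge 1$ let $[k]=\{1,2,\dots,k\}$. A star $k$-edge coloring of a graph $G$ is a proper edge-coloring $c:E(G)\to[k]$ such that no path of length four (four edges) and no cycle of length four in $G$ is bi-colored (i.e. uses only two colors) under $c$. The star chromatic index $\chi'_{st}(G)$ is the smallest integer $k$ such that $G$ admits a star $k$-edge coloring. A Halin graph $G=T\cup C$ is a planar graph that consists of a plane embedding of a tree $T$ that has no vertices of degree two, together with a cycle $C$ connecting all the leaves of $T$ such that $C$ is the boundary of the exterior face. The tree $T$ is called the characteristic tree. If every non-leaf vertex of $T$ has degree exactly $3$ in $T$, then $G$ is called a cubic Halin graph. A caterpillar is a tree such that the removal of all its leaves results in a path (the spine). For $h\ge 1$, $\mathcal{G}_h$ is the set of all cubic Halin graphs whose characteristic trees are caterpillars with $h+2$ leaves; in particular $\mathcal{G}_1=\{K_4\}$. For $h\ge 2$ and $G=T\cup C_{h+2}\in\mathcal{G}_h$, denote the spine of $T$ by $P_h=v_1v_2\cdots v_h$; let $u_0,u_1$ be the neighbors of $v_1$ on $C_{h+2}$, let $u_h,u_{h+1}$ be the neighbors of $v_h$ on $C_{h+2}$, and for $2\le i\le h-1$ let $u_i$ be the neighbor of $v_i$ on $C_{h+2}$; the edges $u_iv_i$ ($2\le i\le h-1$) are called leaf-edges. In the plane drawing of $G$, each leaf-edge lies on either the left or the right side of the spine. If all leaf-edges lie on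 the same side of $P_h$, then $G$ is called a necklace graph and is denoted by $N_{e_h}$; thus, up to labeling, its outer cycle is $u_0u_1u_2\cdots u_hu_{h+1}u_0$. Also $N_{e_1}=K_4$. In particular $N_{e_2}$ is the graph with vertices $v_1,v_2,u_0,u_1,u_2,u_3$ and edges $v_1v_2$, $v_1u_0$, $v_1u_1$, $v_2u_2$, $v_2u_3$, $u_0u_1$, $u_1u_2$, $u_2u_3$, $u_3u_0$ (the triangular prism). Equality of graphs is understood up to isomorphism. *)

theory Defs
  imports "HOL-Analysis.Analysis"
begin

section \<open>Finite simple graphs\<close>

text \<open>A graph is a pair of its vertex set and its set of edges, an edge being the two-element set
  of its ends.\<close>

type_synonym 'a sgraph = "'a set \<times> 'a set set"

abbreviation verts :: "'a sgraph \<Rightarrow> 'a set" where "verts \<equiv> fst"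
abbreviation edges :: "'a sgraph \<Rightarrow> 'a set set" where "edges \<equiv> snd"

definition fin_simple_graph :: "'a sgraph \<Rightarrow> bool" where
  "fin_simple_graph G \<longleftrightarrow> finite (verts G) \<and> (\<forall>e\<in>edges G. e \<subseteq> verts G \<and> card e = 2)"

definition graph_union :: "'a sgraph \<Rightarrow> 'a sgraph \<Rightarrow> 'a sgraph" where
  "graph_union G H = (verts G \<union> verts H, edges G \<union> edges H)"

definition remove_verts :: "'a sgraph \<Rightarrow> 'a set \<Rightarrow> 'a sgraph" where
  "remove_verts G S = (verts G - S, {e \<in> edges G. e \<inter> S = {}})"

definition subgraph :: "'a sgraph \<Rightarrow> 'a sgraph \<Rightarrow> bool" where
  "subgraph H G \<longleftrightarrow> verts H \<subseteq> verts G \<and> edges H \<subseteq> edges G"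

definition graph_iso :: "'a sgraph \<Rightarrow> 'b sgraph \<Rightarrow> bool" where
  "graph_iso G H \<longleftrightarrow> (\<exists>f. bij_betw f (verts G) (verts H) \<and> edges H = (\<lambda>e. f ` e) ` edges G)"

definition vdegree :: "'a sgraph \<Rightarrow> 'a \<Rightarrow> nat" where
  "vdegree G v = card {e \<in> edges G. v \<in> e}"

definition walk_edges :: "'a list \<Rightarrow> 'a set set" where
  "walk_edges p = {{p ! i, p ! Suc i} | i. Suc i < length p}"

text \<open>The path visiting the vertices \<open>p\<close> in order has \<open>length p - 1\<close> edges; the cycle visiting the
  vertices \<open>p\<close> in order has \<open>length p\<close> edges.\<close>

definition path_graph :: "'a list \<Rightarrow> 'a sgraph" where
  "path_graph p = (set p, walk_edges p)"

definition cycle_graph :: "'a list \<Rightarrow> 'a sgraph" where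
  "cycle_graph p = (set p, walk_edges (p @ [hd p]))"

definition is_path :: "'a sgraph \<Rightarrow> bool" where
  "is_path H \<longleftrightarrow> (\<exists>p. p \<noteq> [] \<and> distinct p \<and> H = path_graph p)"

definition is_cycle :: "'a sgraph \<Rightarrow> bool" where
  "is_cycle H \<longleftrightarrow> (\<exists>p. 3 \<le> length p \<and> distinct p \<and> H = cycle_graph p)"

definition connected_graph :: "'a sgraph \<Rightarrow> bool" where
  "connected_graph G \<longleftrightarrow> verts G \<noteq> {} \<and>
     (\<forall>u\<in>verts G. \<forall>v\<in>verts G. \<exists>p. p \<noteq> [] \<and> distinct p \<and> hd p = u \<and> last p = v \<and>
        subgraph (path_graph p) G)"

definition is_tree :: "'a sgraph \<Rightarrow> bool" where
  "is_tree T \<longleftrightarrow> fin_simple_graph T \<and> connected_graph T \<and> \<not> (\<exists>H. is_cycle H \<and> subgraph H T)"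

definition leaves :: "'a sgraph \<Rightarrow> 'a set" where
  "leaves T = {v \<in> verts T. vdegree T v = 1}"

definition caterpillar :: "'a sgraph \<Rightarrow> bool" where
  "caterpillar T \<longleftrightarrow> is_tree T \<and> is_path (remove_verts T (leaves T))"


section \<open>Star edge colorings\<close>

definition proper_edge_coloring :: "'a sgraph \<Rightarrow> nat \<Rightarrow> ('a set \<Rightarrow> nat) \<Rightarrow> bool" where
  "proper_edge_coloring G k c \<longleftrightarrow> c ` edges G \<subseteq> {1..k} \<and>
     (\<forall>e\<in>edges G. \<forall>f\<in>edges G. e \<noteq> f \<and> e \<inter> f \<noteq> {} \<longrightarrow> c e \<noteq> c f)"

definition bicolored :: "('a set \<Rightarrow> nat) \<Rightarrow> 'a sgraph \<Rightarrow> bool" where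
  "bicolored c H \<longleftrightarrow> card (c ` edges H) = 2"

definition star_edge_coloring :: "'a sgraph \<Rightarrow> nat \<Rightarrow> ('a set \<Rightarrow> nat) \<Rightarrow> bool" where
  "star_edge_coloring G k c \<longleftrightarrow> proper_edge_coloring G k c \<and>
     (\<forall>H. subgraph H G \<and> (is_path H \<or> is_cycle H) \<and> card (edges H) = 4 \<longrightarrow> \<not> bicolored c H)"

definition star_chromatic_index :: "'a sgraph \<Rightarrow> nat" where
  "star_chromatic_index G = (LEAST k. 1 \<le> k \<and> (\<exists>c. star_edge_coloring G k c))"


section \<open>Halin graphs\<close>

text \<open>A drawing places each vertex at a point of the plane and represents each edge by an arc joining
  the points of its ends. Arcs meet vertices and each other only in common ends.\<close>

definition plane_drawing ::
  "'a sgraph \<Rightarrow> ('a \<Rightarrow> complex) \<Rightarrow> ('a set \<Rightarrow> real \<Rightarrow> complex) \<Rightarrow> bool" where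
  "plane_drawing G pos crv \<longleftrightarrow>
     inj_on pos (verts G) \<and>
     (\<forall>e\<in>edges G. arc (crv e) \<and> {pathstart (crv e), pathfinish (crv e)} = pos ` e \<and>
        path_image (crv e) \<inter> pos ` verts G = pos ` e) \<and>
     (\<forall>e\<in>edges G. \<forall>f\<in>edges G. e \<noteq> f \<longrightarrow>
        path_image (crv e) \<inter> path_image (crv f) = pos ` (e \<inter> f))"

definition drawn_set ::
  "'a sgraph \<Rightarrow> ('a \<Rightarrow> complex) \<Rightarrow> ('a set \<Rightarrow> real \<Rightarrow> complex) \<Rightarrow> complex set" where
  "drawn_set G pos crv = pos ` verts G \<union> (\<Union>e\<in>edges G. path_image (crv e))"

text \<open>\<open>halin T C\<close> says that \<open>graph_union T C\<close> is a Halin graph with characteristic tree \<open>T\<close> and outer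
  cycle \<open>C\<close>. The exterior face of a drawing is the library's \<open>outside\<close> of the drawn set, the
  unbounded component of its complement.\<close>

definition halin :: "'a sgraph \<Rightarrow> 'a sgraph \<Rightarrow> bool" where
  "halin T C \<longleftrightarrow>
     is_tree T \<and> (\<forall>v\<in>verts T. vdegree T v \<noteq> 2) \<and>
     is_cycle C \<and> verts C = leaves T \<and>
     (\<exists>pos crv. plane_drawing (graph_union T C) pos crv \<and>
        frontier (outside (drawn_set (graph_union T C) pos crv)) = drawn_set C pos crv)"

definition cubic_halin :: "'a sgraph \<Rightarrow> 'a sgraph \<Rightarrow> bool" where
  "cubic_halin T C \<longleftrightarrow> halin T C \<and> (\<forall>v \<in> verts T - leaves T. vdegree T v = 3)"

text \<open>\<open>caterpillar_halin h T C\<close> says that \<open>graph_union T C\<close>, with this decomposition, belongs to the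
  family \<open>\<G>\<^sub>h\<close>.\<close>

definition caterpillar_halin :: "nat \<Rightarrow> 'a sgraph \<Rightarrow> 'a sgraph \<Rightarrow> bool" where
  "caterpillar_halin h T C \<longleftrightarrow> cubic_halin T C \<and> caterpillar T \<and> card (leaves T) = h + 2"


section \<open>Necklace graphs\<close>

datatype necklace_vertex = SpineV nat | OuterV nat

text \<open>\<open>necklace h\<close> is \<open>N\<^bsub>e\<^sub>h\<^esub>\<close>, with \<open>SpineV i\<close> for \<open>v\<^sub>i\<close> (\<open>1 \<le> i \<le> h\<close>) and \<open>OuterV i\<close> for \<open>u\<^sub>i\<close>
  (\<open>0 \<le> i \<le> h + 1\<close>).\<close>

definition necklace :: "nat \<Rightarrow> necklace_vertex sgraph" where
  "necklace h =
     (SpineV ` {1..h} \<union> OuterV ` {0..h+1},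
      {{SpineV i, SpineV (i+1)} | i. 1 \<le> i \<and> i < h} \<union>
      {{SpineV i, OuterV i} | i. 1 \<le> i \<and> i \<le> h} \<union>
      {{SpineV 1, OuterV 0}, {SpineV h, OuterV (h+1)}} \<union>
      {{OuterV i, OuterV (i+1)} | i. i \<le> h} \<union>
      {{OuterV (h+1), OuterV 0}})"

end

theory Submission
  imports Defs
begin

text \<open>
  Lower bound. The first spine vertex and two leaves at it form a triangle. Going around a triangle
  with four colors, either some pendant edge repeats the color of the opposite side or all pendant
  edges have the fourth color; in both cases too few colors remain at the outer end of a pendant edge
  (\<open>no_star_4_edge_coloring_triangle\<close>).

  Structure. The drawing is used through one consequence of the Jordan curve theorem: two disjoint
  tree paths cannot join interlacing pairs of leaves (\<open>tree_paths_do_not_cross\<close>). Hence the leaves at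
  an initial part of the spine form an arc of the outer cycle, and only three edges leave this part
  of the graph: the next spine edge and two edges of the outer cycle (\<open>cut_exists\<close>). The next leaf is
  the end of one of these two edges (\<open>next_leaf_on_cut\<close>). So the graph arises from a triangle by
  repeatedly adding a spine vertex and a leaf, where the leaf subdivides one of the two dangling outer
  edges, and it is closed by a second triangle.

  Upper bound. An alternating walk of four edges that crosses one of the three dangling edges sees
  little of the part already colored: the color of the dangling edge, the colors next to it, and
  which of these are followed by the color of the dangling edge once more. There are finitely many
  such states up to renaming colors, and colors can be chosen step by step so that one stays in a list
  of seven of them (\<open>ready\<close>), whatever the sides of the leaves are. From each state in the list the
  last leaf and the final triangle can be added (\<open>ready_close\<close>). This needs at least one leaf
  between the two triangles, that is, three spine vertices. With two spine vertices the graph is the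
  triangular prism, with one it is \<open>K\<^sub>4\<close>.
\<close>

section \<open>Edges of paths and cycles\<close>

lemma walk_edges_Nil [simp]: "walk_edges [] = {}"
  and walk_edges_single [simp]: "walk_edges [x] = {}"
  by (auto simp: walk_edges_def)

lemma walk_edges_Cons [simp]: "walk_edges (x # y # p) = insert {x, y} (walk_edges (y # p))"
proof -
  have "{i. Suc i < length (x # y # p)} = insert 0 (Suc ` {i. Suc i < length (y # p)})"
    by (auto simp: image_iff) (metis not0_implies_Suc Suc_less_eq)
  moreover have "walk_edges r = (\<lambda>i. {r ! i, r ! Suc i}) ` {i. Suc i < length r}" for r :: "'a list"
    by (auto simp: walk_edges_def)
  ultimately show ?thesis
    by (simp add: image_image)
qed

lemma walk_edges_append:
  "walk_edges (p @ x # r) = walk_edges (p @ [x]) \<union> walk_edges (x # r)"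
proof (induction p)
  case Nil
  then show ?case by simp
next
  case (Cons a p)
  then show ?case by (cases p) auto
qed

lemma walk_edges_rev [simp]: "walk_edges (rev p) = walk_edges p"
proof (induction p)
  case Nil
  then show ?case by simp
next
  case (Cons a p)
  then show ?case
    by (cases p) (auto simp: walk_edges_append[of _ _ "[_]"] insert_commute)
qed

lemma Union_walk_edges: "\<Union>(walk_edges p) \<subseteq> set p"
  by (auto simp: walk_edges_def)

lemma Union_walk_edges_eq: "2 \<le> length p \<Longrightarrow> \<Union>(walk_edges p) = set p"
proof (induction p)
  case (Cons a p)
  then show ?case
    by (cases p; cases "tl p") auto
qed simp

text \<open>The edge that closes a path of at least three vertices to a cycle is new.\<close>
lemma first_edge_not_last:
  assumes "distinct (a # P @ [b])" "P \<noteq> []"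
  shows "{a, b} \<notin> walk_edges (a # P @ [b])"
proof -
  obtain y Q where P: "P = y # Q" using assms(2) by (cases P) auto
  have "a \<notin> \<Union>(walk_edges (y # Q @ [b]))"
    using Union_walk_edges[of "y # Q @ [b]"] assms(1) P by auto
  then show ?thesis using assms(1) by (auto simp: P doubleton_eq_iff)
qed

lemma cycle_graph_rotate1: "cycle_graph (rotate1 q) = cycle_graph q"
proof (cases q)
  case (Cons x r)
  show ?thesis
  proof (cases r)
    case (Cons y s)
    have "walk_edges ((y # s) @ [x, y]) = walk_edges ((y # s) @ [x]) \<union> {{x, y}}"
      using walk_edges_append[of "y # s" x "[y]"] by simp
    then show ?thesis
      by (auto simp: cycle_graph_def Cons \<open>q = x # r\<close>)
  qed (simp add: Cons)
qed simp

lemma cycle_graph_rotate: "cycle_graph (rotate n q) = cycle_graph q"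
  by (induction n) (simp_all add: cycle_graph_rotate1)

section \<open>Disjoint paths inside the outer cycle of a drawing\<close>

abbreviation edges_image :: "('a set \<Rightarrow> real \<Rightarrow> complex) \<Rightarrow> 'a set set \<Rightarrow> complex set" where
  "edges_image crv A \<equiv> (\<Union>e\<in>A. path_image (crv e))"

lemma edges_image_Int:
  assumes "plane_drawing G pos crv" "A \<subseteq> edges G" "B \<subseteq> edges G" "A \<inter> B = {}"
  shows "edges_image crv A \<inter> edges_image crv B = (\<Union>e\<in>A. \<Union>f\<in>B. pos ` (e \<inter> f))"
proof -
  have "path_image (crv e) \<inter> path_image (crv f) = pos ` (e \<inter> f)" if "e \<in> A" "f \<in> B" for e f
  proof -
    have "e \<in> edges G" "f \<in> edges G" "e \<noteq> f" using assms that by auto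
    then show ?thesis using assms(1) unfolding plane_drawing_def by blast
  qed
  then show ?thesis by (simp add: Int_UN_distrib2)
qed

lemma edges_image_Int_subset:
  assumes "plane_drawing G pos crv" "A \<subseteq> edges G" "B \<subseteq> edges G" "A \<inter> B = {}"
  shows "edges_image crv A \<inter> edges_image crv B \<subseteq> pos ` (\<Union>A \<inter> \<Union>B)"
proof
  fix z
  assume "z \<in> edges_image crv A \<inter> edges_image crv B"
  then obtain e f where "e \<in> A" "f \<in> B" "z \<in> pos ` (e \<inter> f)"
    unfolding edges_image_Int[OF assms] by blast
  then show "z \<in> pos ` (\<Union>A \<inter> \<Union>B)"
    by blast
qed

text \<open>Consecutive edges of a path share one vertex and other edges of it share none, so the drawn edges
  can be joined one after the other into a single arc.\<close>
lemma arc_of_walk: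
  assumes G: "plane_drawing G pos crv" "fin_simple_graph G"
    and "distinct p" "2 \<le> length p" "walk_edges p \<subseteq> edges G"
  shows "\<exists>g. arc g \<and> pathstart g = pos (hd p) \<and> pathfinish g = pos (last p) \<and>
    path_image g = edges_image crv (walk_edges p)"
  using assms(3-)
proof (induction p)
  case (Cons x p)
  then obtain y r where p: "p = y # r"
    by (cases p) auto
  have xy: "{x, y} \<in> edges G" "x \<noteq> y"
    using Cons.prems by (auto simp: p)
  have c: "arc (crv {x, y})" "{pathstart (crv {x, y}), pathfinish (crv {x, y})} = {pos x, pos y}"
    using G(1) xy unfolding plane_drawing_def by auto
  \<comment> \<open>the drawing does not fix the direction in which the arc of an edge runs\<close>
  obtain g1 where g1: "arc g1" "pathstart g1 = pos x" "pathfinish g1 = pos y"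
    "path_image g1 = path_image (crv {x, y})"
  proof (cases "pathstart (crv {x, y}) = pos x")
    case True
    then show ?thesis using c that[of "crv {x, y}"] by (auto simp: doubleton_eq_iff)
  next
    case False
    then show ?thesis using c that[of "reversepath (crv {x, y})"]
      by (auto simp: doubleton_eq_iff arc_reversepath)
  qed
  show ?case
  proof (cases r)
    case Nil
    then show ?thesis using g1 p by auto
  next
    case (Cons z s)
    then obtain g2 where g2: "arc g2" "pathstart g2 = pos y" "pathfinish g2 = pos (last p)"
      "path_image g2 = edges_image crv (walk_edges p)"
      using Cons.IH Cons.prems p by auto
    have "path_image g1 \<inter> path_image g2 = edges_image crv {{x, y}} \<inter> edges_image crv (walk_edges p)"
      using g1 g2 by simp
    also have "\<dots> \<subseteq> pos ` (\<Union>{{x, y}} \<inter> \<Union>(walk_edges p))"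
    proof (rule edges_image_Int_subset[OF G(1)])
      show "{{x, y}} \<inter> walk_edges p = {}"
        using Union_walk_edges[of p] Cons.prems by (auto simp: p)
    qed (use Cons.prems p in auto)
    also have "\<dots> \<subseteq> {pos y}"
      using Union_walk_edges[of p] Cons.prems by (auto simp: p)
    finally have "arc (g1 +++ g2)"
      using g1 g2 by (intro arc_join) auto
    moreover have "path_image (g1 +++ g2) = edges_image crv (walk_edges (x # p))"
      using g1 g2 by (simp add: path_image_join p)
    moreover have "pathstart (g1 +++ g2) = pos (hd (x # p))"
      "pathfinish (g1 +++ g2) = pos (last (x # p))"
      using g1 g2 p by simp_all
    ultimately show ?thesis by blast
  qed
qed simp

text \<open>The outside of \<open>\<Gamma>\<close> is connected and meets the outside of \<open>D\<close>. It cannot contain other points,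
  since it would then meet the frontier \<open>\<Gamma>\<close>. So the two outsides agree, and nothing of \<open>D\<close> lies
  outside \<open>\<Gamma>\<close>.\<close>
lemma subset_outer_boundary_Un_inside:
  fixes D :: "complex set"
  assumes "compact D" "compact \<Gamma>" "\<Gamma> \<subseteq> D" "frontier (outside D) = \<Gamma>"
  shows "D \<subseteq> \<Gamma> \<union> inside \<Gamma>"
proof -
  have sub: "outside D \<subseteq> outside \<Gamma>" using assms(3) by (rule outside_mono)
  have ne: "outside D \<noteq> {}"
    using assms(1) by (simp add: compact_imp_bounded outside_bounded_nonempty)
  have "outside \<Gamma> \<subseteq> outside D"
  proof (rule ccontr)
    assume "\<not> outside \<Gamma> \<subseteq> outside D"
    then have "outside \<Gamma> \<inter> frontier (outside D) \<noteq> {}"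
      using sub ne assms(2)
      by (intro connected_Int_frontier connected_outside) (auto simp: compact_imp_bounded)
    then show False using assms(4) outside_no_overlap[of \<Gamma>] by auto
  qed
  then show ?thesis
    using outside_no_overlap[of D] inside_Un_outside[of \<Gamma>] by blast
qed

text \<open>The chord \<open>g\<close> splits the inside of the Jordan curve \<open>c1 \<union> c2\<close> into the insides of \<open>c1 \<union> g\<close> and
  \<open>c2 \<union> g\<close>. The closures of these two parts have only points of \<open>g\<close> in common, so they would
  disconnect a set \<open>B\<close> that avoids \<open>g\<close> and reaches both arcs.\<close>
lemma no_crossing_chords:
  fixes c1 c2 g :: "real \<Rightarrow> complex"
  assumes "arc c1" "pathstart c1 = a" "pathfinish c1 = b"
    and "arc c2" "pathstart c2 = a" "pathfinish c2 = b"
    and "arc g" "pathstart g = a" "pathfinish g = b" "a \<noteq> b"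
    and "path_image c1 \<inter> path_image c2 = {a, b}"
    and "path_image c1 \<inter> path_image g = {a, b}"
    and "path_image c2 \<inter> path_image g = {a, b}"
    and in_g: "path_image g \<subseteq> {a, b} \<union> inside (path_image c1 \<union> path_image c2)"
    and B: "connected B" "B \<inter> path_image g = {}"
      "B \<subseteq> path_image c1 \<union> path_image c2 \<union> inside (path_image c1 \<union> path_image c2)"
      "B \<inter> path_image c1 \<noteq> {}" "B \<inter> path_image c2 \<noteq> {}"
  shows False
proof -
  define \<Gamma> where "\<Gamma> = path_image c1 \<union> path_image c2"
  have ne: "path_image g \<inter> inside \<Gamma> \<noteq> {}"
  proof -
    have "path_image g \<noteq> {a, b}"
    proof
      assume *: "path_image g = {a, b}"
      have "infinite (path_image g)"
        using assms(7) by (simp add: arc_def infinite_Icc path_image_def finite_image_iff)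
      then show False using * by simp
    qed
    then show ?thesis
      using in_g assms(8,9) pathstart_in_path_image[of g] pathfinish_in_path_image[of g]
      unfolding \<Gamma>_def by blast
  qed
  obtain dis: "inside (path_image c1 \<union> path_image g) \<inter> inside (path_image c2 \<union> path_image g) = {}"
    and un: "inside (path_image c1 \<union> path_image g) \<union> inside (path_image c2 \<union> path_image g) \<union>
      (path_image g - {a, b}) = inside \<Gamma>"
    using split_inside_simple_closed_curve[of c1 a b c2 g] assms ne
    by (metis \<Gamma>_def arc_imp_simple_path)
  define A1 where "A1 = path_image c1 \<union> path_image g \<union> inside (path_image c1 \<union> path_image g)"
  define A2 where "A2 = path_image c2 \<union> path_image g \<union> inside (path_image c2 \<union> path_image g)"
  have cl: "closed (path_image p \<union> path_image g \<union> inside (path_image p \<union> path_image g))"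
    if "arc p" for p :: "real \<Rightarrow> complex"
  proof -
    have "closed (path_image p \<union> path_image g)"
      using that assms(7) by (simp add: closed_Un closed_arc_image)
    then show ?thesis by (simp add: closed_Compl open_outside union_with_inside)
  qed
  have "closed A1" "closed A2"
    unfolding A1_def A2_def using cl assms(1,4) by auto
  moreover have "B \<subseteq> A1 \<union> A2"
    using B(3) un by (auto simp: A1_def A2_def \<Gamma>_def)
  moreover have "A1 \<inter> A2 \<inter> B = {}"
  proof -
    have "inside (path_image c1 \<union> path_image g) \<inter> path_image c2 = {}"
      "inside (path_image c2 \<union> path_image g) \<inter> path_image c1 = {}"
      using un inside_no_overlap[of \<Gamma>] unfolding \<Gamma>_def by blast+
    moreover have "{a, b} \<subseteq> path_image g"
      using pathstart_in_path_image[of g] pathfinish_in_path_image[of g] assms(8,9) by simp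
    ultimately have "A1 \<inter> A2 \<subseteq> path_image g"
      using dis assms(11) unfolding A1_def A2_def by (auto 4 2)
    then show ?thesis using B(2) by blast
  qed
  moreover have "A1 \<inter> B \<noteq> {}" "A2 \<inter> B \<noteq> {}"
    using B(4,5) by (auto simp: A1_def A2_def)
  ultimately show False
    using B(1) unfolding connected_closed by blast
qed

lemma subset_Un_if_Int: "A \<subseteq> D \<Longrightarrow> A \<inter> S = R \<Longrightarrow> D \<subseteq> S \<union> I \<Longrightarrow> A \<subseteq> R \<union> I"
  by blast

lemma two_le_length: "xs \<noteq> [] \<Longrightarrow> hd xs \<noteq> last xs \<Longrightarrow> 2 \<le> length xs"
  by (cases xs; cases "tl xs") auto

lemma finite_edges: "fin_simple_graph G \<Longrightarrow> finite (edges G)"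
  by (rule finite_subset[of _ "Pow (verts G)"]) (auto simp: fin_simple_graph_def)

lemma pos_in_edges_image:
  assumes "plane_drawing G pos crv" "A \<subseteq> edges G"
  shows "pos ` \<Union>A \<subseteq> edges_image crv A"
proof
  fix z
  assume "z \<in> pos ` \<Union>A"
  then obtain e where "e \<in> A" "z \<in> pos ` e" by blast
  moreover have "e \<in> edges G"
    using assms(2) \<open>e \<in> A\<close> by auto
  then have "path_image (crv e) \<inter> pos ` verts G = pos ` e"
    using assms(1) unfolding plane_drawing_def by auto
  ultimately show "z \<in> edges_image crv A" by blast
qed

lemma compact_drawn_set:
  assumes "plane_drawing G pos crv" "fin_simple_graph G"
  shows "compact (drawn_set G pos crv)"
proof -
  have "compact (path_image (crv e))" if "e \<in> edges G" for e
    using assms(1) that unfolding plane_drawing_def by (simp add: compact_arc_image)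
  then have "compact (\<Union>e\<in>edges G. path_image (crv e))"
    using finite_edges[OF assms(2)] by (intro compact_UN) auto
  moreover have "finite (pos ` verts G)"
    using assms(2) unfolding fin_simple_graph_def by simp
  ultimately show ?thesis
    unfolding drawn_set_def by (simp add: compact_Un finite_imp_compact)
qed

text \<open>Planarity enters the proof only here. The outer cycle is drawn as a Jordan curve with the rest of
  the drawing inside it, so two vertex-disjoint tree paths cannot join two interlacing pairs of
  leaves. The path \<open>r\<close> is the chord, and \<open>s\<close> is the connected set.\<close>
lemma tree_paths_do_not_cross:
  assumes G: "fin_simple_graph (graph_union T C)" "plane_drawing (graph_union T C) pos crv"
    and fr: "frontier (outside (drawn_set (graph_union T C) pos crv)) = drawn_set C pos crv"
    and C: "C = cycle_graph q" "q = a # P @ b # Q" "distinct q"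
    and TC: "edges T \<inter> edges C = {}"
    and r: "distinct r" "hd r = a" "last r = b" "walk_edges r \<subseteq> edges T" "set r \<inter> set q = {a, b}"
    and s: "s \<noteq> []" "distinct s" "hd s \<in> set P" "last s \<in> set Q" "walk_edges s \<subseteq> edges T" 
    and rs: "set r \<inter> set s = {}"
  shows False
proof -
  let ?G = "graph_union T C"
  have PQ: "P \<noteq> []" "Q \<noteq> []" using s(3,4) by auto
  define p1 where "p1 = a # P @ [b]"
  define p2 where "p2 = a # rev Q @ [b]"
  have p2_rev: "p2 = rev (b # Q @ [a])" by (simp add: p2_def)
  have eC: "edges C = walk_edges p1 \<union> walk_edges p2"
    using walk_edges_append[of "a # P" b "Q @ [a]"] unfolding p2_rev walk_edges_rev
    by (simp add: C(1,2) cycle_graph_def p1_def)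
  have ab: "a \<noteq> b" using C by auto
  have len: "2 \<le> length r" "2 \<le> length s"
  proof -
    have "hd s \<noteq> last s"
      using s(3,4) C(2,3) by auto
    moreover have "r \<noteq> []"
      using r(5) by auto
    ultimately show "2 \<le> length r" "2 \<le> length s"
      using two_le_length[of r] two_le_length[of s] r(2,3) s(1) ab by simp_all
  qed
  have sub: "walk_edges p1 \<subseteq> edges ?G" "walk_edges p2 \<subseteq> edges ?G"
    "walk_edges r \<subseteq> edges ?G" "walk_edges s \<subseteq> edges ?G"
    using eC r s by (auto simp: graph_union_def)
  have dist: "distinct p1" "distinct p2" and sets: "set p1 = {a, b} \<union> set P" "set p2 = {a, b} \<union> set Q"
    using C(2,3) by (auto simp: p1_def p2_def)
  have U: "\<Union>(walk_edges p1) = set p1" "\<Union>(walk_edges p2) = set p2"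
      "\<Union>(walk_edges r) = set r" "\<Union>(walk_edges s) = set s"
    using len by (simp_all add: Union_walk_edges_eq p1_def p2_def)
  obtain c1 where c1: "arc c1" "pathstart c1 = pos a" "pathfinish c1 = pos b"
      "path_image c1 = edges_image crv (walk_edges p1)"
    using arc_of_walk[OF G(2,1) dist(1) _ sub(1)] by (auto simp: p1_def)
  obtain c2 where c2: "arc c2" "pathstart c2 = pos a" "pathfinish c2 = pos b"
      "path_image c2 = edges_image crv (walk_edges p2)"
    using arc_of_walk[OF G(2,1) dist(2) _ sub(2)] by (auto simp: p2_def)
  obtain g where g: "arc g" "pathstart g = pos a" "pathfinish g = pos b"
      "path_image g = edges_image crv (walk_edges r)"
    using arc_of_walk[OF G(2,1) r(1) len(1) sub(3)] r by auto
  obtain B where B: "arc B" "path_image B = edges_image crv (walk_edges s)"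
    using arc_of_walk[OF G(2,1) s(2) len(2) sub(4)] by auto
  have ends: "{pos a, pos b} \<subseteq> path_image h" if "pathstart h = pos a" "pathfinish h = pos b" for h
    using that pathstart_in_path_image[of h] pathfinish_in_path_image[of h] by simp
  have p12: "set p1 \<inter> set p2 = {a, b}"
    using sets C(2,3) by auto
  have "walk_edges p1 \<inter> walk_edges p2 = {}"
  proof (rule ccontr)
    assume "walk_edges p1 \<inter> walk_edges p2 \<noteq> {}"
    then obtain e where e: "e \<in> walk_edges p1" "e \<in> walk_edges p2" by blast
    then have "e \<subseteq> set p1" "e \<subseteq> set p2"
      unfolding U[symmetric] by auto
    then have "e \<subseteq> {a, b}"
      using p12 by blast
    moreover have "card e = 2" 
      using e sub G(1) unfolding fin_simple_graph_def by blast
    ultimately have "e = {a, b}"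
      using card_subset_eq[of "{a, b}" e] ab by simp
    then show False
      using e(1) first_edge_not_last[of a P b] dist(1) PQ(1) unfolding p1_def by simp
  qed
  then have "path_image c1 \<inter> path_image c2 \<subseteq> pos ` (set p1 \<inter> set p2)"
    using edges_image_Int_subset[OF G(2) sub(1,2)] U c1 c2 by simp
  then have c12: "path_image c1 \<inter> path_image c2 = {pos a, pos b}"
    using p12 ends[OF c1(2,3)] ends[OF c2(2,3)] by auto
  have "walk_edges p1 \<inter> walk_edges r = {}" "walk_edges p2 \<inter> walk_edges r = {}"
    using TC r(4) eC by blast+
  then have "path_image c1 \<inter> path_image g \<subseteq> pos ` (set p1 \<inter> set r)"
      "path_image c2 \<inter> path_image g \<subseteq> pos ` (set p2 \<inter> set r)"
    using edges_image_Int_subset[OF G(2) sub(1,3)] edges_image_Int_subset[OF G(2) sub(2,3)]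
      U c1 c2 g by simp_all
  moreover have "set p1 \<inter> set r = {a, b}" "set p2 \<inter> set r = {a, b}"
    using sets r(5) C(2) by auto
  ultimately have c1g: "path_image c1 \<inter> path_image g = {pos a, pos b}"
      and c2g: "path_image c2 \<inter> path_image g = {pos a, pos b}"
    using ends[OF c1(2,3)] ends[OF c2(2,3)] ends[OF g(2,3)] by auto
  have "pos a \<noteq> pos b"
    using c1(1-3) arc_distinct_ends by metis
  have \<Gamma>: "drawn_set C pos crv = path_image c1 \<union> path_image c2"
  proof -
    have "set q = \<Union>(walk_edges p1) \<union> \<Union>(walk_edges p2)"
      using U sets C(2) by auto
    moreover have "pos ` set p1 \<subseteq> path_image c1" "pos ` set p2 \<subseteq> path_image c2"
      using pos_in_edges_image[OF G(2) sub(1)] pos_in_edges_image[OF G(2) sub(2)]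
      unfolding U c1(4) c2(4) .
    ultimately have "pos ` set q \<subseteq> path_image c1 \<union> path_image c2"
      unfolding U by blast
    moreover have "edges_image crv (edges C) = path_image c1 \<union> path_image c2"
      unfolding c1(4) c2(4) eC by (rule UN_Un)
    moreover have "verts C = set q"
      by (simp add: C(1) cycle_graph_def)
    ultimately show ?thesis
      unfolding drawn_set_def by (simp add: Un_absorb1)
  qed
  let ?D = "drawn_set ?G pos crv"
  let ?\<Gamma> = "path_image c1 \<union> path_image c2"
  have D: "?D \<subseteq> ?\<Gamma> \<union> inside ?\<Gamma>"
  proof (rule subset_outer_boundary_Un_inside)
    show "compact ?D" using compact_drawn_set[OF G(2,1)] .
    show "compact ?\<Gamma>" using c1(1) c2(1) by (simp add: compact_Un compact_arc_image)
    show "?\<Gamma> \<subseteq> ?D" 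
      unfolding \<Gamma>[symmetric] drawn_set_def
      by (intro Un_mono image_mono UN_mono) (auto simp: graph_union_def)
    show "frontier (outside ?D) = ?\<Gamma>" using fr \<Gamma> by simp
  qed
  have img: "edges_image crv A \<subseteq> ?D" if "A \<subseteq> edges ?G" for A
    using that unfolding drawn_set_def by (intro le_supI2 UN_mono) auto
  show False
  proof (rule no_crossing_chords[OF c1(1-3) c2(1-3) g(1-3) \<open>pos a \<noteq> pos b\<close> c12 c1g c2g])
    have "path_image g \<subseteq> ?D" unfolding g(4) by (rule img[OF sub(3)])
    moreover have "path_image g \<inter> ?\<Gamma> = {pos a, pos b}"
      using c1g c2g by (metis Int_Un_distrib2 Int_commute sup.idem)
    ultimately show "path_image g \<subseteq> {pos a, pos b} \<union> inside ?\<Gamma>"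
      using D by (rule subset_Un_if_Int)
    show "connected (path_image B)"
      using B(1) by (simp add: arc_imp_path connected_path_image)
    have "walk_edges s \<inter> walk_edges r = {}"
    proof (rule ccontr)
      assume "walk_edges s \<inter> walk_edges r \<noteq> {}"
      then obtain e where e: "e \<in> walk_edges s" "e \<in> walk_edges r" by blast
      then have "e \<subseteq> set s" "e \<subseteq> set r"
        unfolding U[symmetric] by auto
      then have "e = {}" using rs by blast
      moreover have "card e = 2"
        using e(1) sub(4) G(1) unfolding fin_simple_graph_def by blast
      ultimately show False by simp
    qed
    then have "path_image B \<inter> path_image g \<subseteq> pos ` (set s \<inter> set r)"
      using edges_image_Int_subset[OF G(2) sub(4,3)] 
      unfolding U B(2) g(4) by simp
    moreover have "set s \<inter> set r = {}"
      using rs by blast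
    ultimately show "path_image B \<inter> path_image g = {}"
      by simp
    show "path_image B \<subseteq> path_image c1 \<union> path_image c2 \<union> inside ?\<Gamma>"
      using img[OF sub(4)] D unfolding B(2) by (rule subset_trans)
    have "pos ` set p1 \<subseteq> path_image c1" "pos ` set p2 \<subseteq> path_image c2"
        "pos ` set s \<subseteq> path_image B"
      using pos_in_edges_image[OF G(2) sub(1)] pos_in_edges_image[OF G(2) sub(2)]
        pos_in_edges_image[OF G(2) sub(4)] unfolding U c1(4) c2(4) B(2) .
    moreover have "hd s \<in> set s \<inter> set p1" "last s \<in> set s \<inter> set p2"
      using s(1,3,4) sets by auto
    ultimately have "pos (hd s) \<in> path_image B \<inter> path_image c1"
        "pos (last s) \<in> path_image B \<inter> path_image c2"
      by blast+
    then show "path_image B \<inter> path_image c1 \<noteq> {}" "path_image B \<inter> path_image c2 \<noteq> {}"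
      by (metis emptyE)+
  qed
qed

section \<open>Star edge colorings as a condition on walks\<close>

text \<open>Properness is required at the vertices of \<open>V\<close>, and a walk of four edges counts only if its three
  interior vertices lie in \<open>V\<close>. With this convention the walks that are new in \<open>V \<union> W\<close> all use an edge
  between \<open>V\<close> and \<open>W\<close> as one of their two middle edges, which makes the condition local. A walk
  without turning back may close up: with \<open>p0 = p4\<close> it is a cycle of length four.\<close>
definition star_on :: "nat \<Rightarrow> 'a set set \<Rightarrow> ('a set \<Rightarrow> nat) \<Rightarrow> 'a set \<Rightarrow> bool" where
  "star_on k E c V \<longleftrightarrow>
     (\<forall>x\<in>V. \<forall>y. {x, y} \<in> E \<longrightarrow> c {x, y} \<in> {1..k}) \<and>
     (\<forall>x\<in>V. \<forall>y z. {x, y} \<in> E \<longrightarrow> {x, z} \<in> E \<longrightarrow> y \<noteq> z \<longrightarrow> c {x, y} \<noteq> c {x, z}) \<and>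
     (\<forall>p0. \<forall>p1\<in>V. \<forall>p2\<in>V. \<forall>p3\<in>V. \<forall>p4.
        {p0, p1} \<in> E \<longrightarrow> {p1, p2} \<in> E \<longrightarrow> {p2, p3} \<in> E \<longrightarrow> {p3, p4} \<in> E \<longrightarrow>
        p0 \<noteq> p2 \<longrightarrow> p1 \<noteq> p3 \<longrightarrow> p2 \<noteq> p4 \<longrightarrow>
        \<not> (c {p0, p1} = c {p2, p3} \<and> c {p1, p2} = c {p3, p4}))"

lemma star_on_color: "star_on k E c V \<Longrightarrow> x \<in> V \<Longrightarrow> {x, y} \<in> E \<Longrightarrow> c {x, y} \<in> {1..k}"
  unfolding star_on_def by metis

lemma star_on_proper:
  "star_on k E c V \<Longrightarrow> x \<in> V \<Longrightarrow> {x, y} \<in> E \<Longrightarrow> {x, z} \<in> E \<Longrightarrow> y \<noteq> z \<Longrightarrow> c {x, y} \<noteq> c {x, z}"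
  unfolding star_on_def by metis

lemma star_on_walk:
  "star_on k E c V \<Longrightarrow> p1 \<in> V \<Longrightarrow> p2 \<in> V \<Longrightarrow> p3 \<in> V \<Longrightarrow>
    {p0, p1} \<in> E \<Longrightarrow> {p1, p2} \<in> E \<Longrightarrow> {p2, p3} \<in> E \<Longrightarrow> {p3, p4} \<in> E \<Longrightarrow>
    p0 \<noteq> p2 \<Longrightarrow> p1 \<noteq> p3 \<Longrightarrow> p2 \<noteq> p4 \<Longrightarrow> c {p0, p1} = c {p2, p3} \<Longrightarrow> c {p1, p2} \<noteq> c {p3, p4}"
  unfolding star_on_def by metis

lemma star_on_mono: "star_on k E c V \<Longrightarrow> k \<le> k' \<Longrightarrow> star_on k' E c V"
  unfolding star_on_def by (meson atLeastAtMost_iff order_trans)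

lemma alternating_if_two_colors:
  assumes "card {a, b, x, y} = 2" "a \<noteq> b" "b \<noteq> x" "x \<noteq> y"
  shows "x = a \<and> y = b"
proof -
  have "{a, b} = {a, b, x, y}"
    using assms(1,2) by (intro card_subset_eq) auto
  then have "x \<in> {a, b}" "y \<in> {a, b}" by blast+
  then show ?thesis using assms(2-) by auto
qed

lemma finite_walk_edges: "finite (walk_edges p)"
proof (induction p)
  case (Cons x p)
  then show ?case by (cases p) auto
qed simp

lemma card_walk_edges: "distinct p \<Longrightarrow> card (walk_edges p) = length p - 1"
proof (induction p)
  case (Cons x p)
  show ?case
  proof (cases p)
    case (Cons y r)
    have "{x, y} \<notin> walk_edges (y # r)"
      using Union_walk_edges[of "y # r"] Cons.prems by (auto simp: Cons)
    moreover have "finite (walk_edges (y # r))"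
      by (rule finite_walk_edges)
    ultimately show ?thesis using Cons.IH Cons.prems by (simp add: Cons)
  qed simp
qed simp

lemma card_edges_cycle_graph:
  assumes "distinct p" "3 \<le> length p"
  shows "card (edges (cycle_graph p)) = length p"
proof -
  obtain x P b where p: "p = x # P @ [b]" "P \<noteq> []"
  proof -
    obtain x y z r where "p = x # y # z # r"
      using assms(2) by (auto simp: numeral_3_eq_3 Suc_le_length_iff)
    then show ?thesis
      using that[of x "butlast (y # z # r)" "last (y # z # r)"] by (metis append_butlast_last_id butlast.simps(2) list.distinct(1))
  qed
  have "walk_edges (p @ [hd p]) = insert {x, b} (walk_edges p)"
    using walk_edges_append[of "x # P" b "[x]"] by (simp add: p(1) insert_commute)
  moreover have "{x, b} \<notin> walk_edges p"
    using first_edge_not_last assms(1) p by metis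
  moreover have "finite (walk_edges p)"
    by (rule finite_walk_edges)
  ultimately show ?thesis
    using card_walk_edges[OF assms(1)] assms(2) by (simp add: cycle_graph_def)
qed

text \<open>In a proper coloring, a path or cycle with four edges has two colors iff the colors alternate.
  Conversely, the ends of an alternating walk can only coincide with each other: \<open>p0 = p3\<close> or
  \<open>p1 = p4\<close> would give two edges of the same color at one vertex.\<close>
lemma star_edge_coloring_iff_star_on:
  assumes G: "fin_simple_graph G"
  shows "star_edge_coloring G k c \<longleftrightarrow> star_on k (edges G) c (verts G)"
proof
  assume L: "star_edge_coloring G k c"
  then have col: "c ` edges G \<subseteq> {1..k}"
    and distinct_col: "\<And>e f. e \<in> edges G \<Longrightarrow> f \<in> edges G \<Longrightarrow> e \<noteq> f \<Longrightarrow> e \<inter> f \<noteq> {} \<Longrightarrow> c e \<noteq> c f"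
    unfolding star_edge_coloring_def proper_edge_coloring_def by blast+
  have proper: "c {x, y} \<noteq> c {x, z}" if "{x, y} \<in> edges G" "{x, z} \<in> edges G" "y \<noteq> z" for x y z
    using distinct_col[of "{x, y}" "{x, z}"] that by (auto simp: doubleton_eq_iff)
  have no_loop: "x \<noteq> y" if "{x, y} \<in> edges G" for x y
    using G that unfolding fin_simple_graph_def by fastforce
  have "\<not> (c {p0, p1} = c {p2, p3} \<and> c {p1, p2} = c {p3, p4})"
    if E: "{p0, p1} \<in> edges G" "{p1, p2} \<in> edges G" "{p2, p3} \<in> edges G" "{p3, p4} \<in> edges G"
      and ne: "p0 \<noteq> p2" "p1 \<noteq> p3" "p2 \<noteq> p4" for p0 p1 p2 p3 p4
  proof
    assume alt: "c {p0, p1} = c {p2, p3} \<and> c {p1, p2} = c {p3, p4}"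
    have ne': "p0 \<noteq> p1" "p1 \<noteq> p2" "p2 \<noteq> p3" "p3 \<noteq> p4"
      using E no_loop by blast+
    have "p0 \<noteq> p3"
      using proper[of p0 p1 p2] E alt ne' by (auto simp: insert_commute)
    have "p1 \<noteq> p4"
      using proper[of p1 p2 p3] E alt ne' by (auto simp: insert_commute)
    have two: "card {c {p0, p1}, c {p1, p2}} = 2"
      using proper[of p1 p0 p2] E ne by (simp add: insert_commute)
    have V: "{p0, p1, p2, p3, p4} \<subseteq> verts G"
    proof -
      have "{p0, p1} \<subseteq> verts G" "{p1, p2} \<subseteq> verts G" "{p2, p3} \<subseteq> verts G" "{p3, p4} \<subseteq> verts G"
        using G E unfolding fin_simple_graph_def by metis+
      then show ?thesis by blast
    qed
    define H where "H = (if p0 = p4 then cycle_graph [p0, p1, p2, p3] else path_graph [p0, p1, p2, p3, p4])"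
    have H: "edges H = {{p0, p1}, {p1, p2}, {p2, p3}, {p3, p4}}"
      unfolding H_def cycle_graph_def path_graph_def by (auto simp: insert_commute)
    have "subgraph H G"
      using V E unfolding subgraph_def H by (auto simp: H_def cycle_graph_def path_graph_def)
    moreover have "is_path H \<or> is_cycle H"
    proof (cases "p0 = p4")
      case True
      then have "distinct [p0, p1, p2, p3]"
        using ne ne' \<open>p0 \<noteq> p3\<close> by auto
      then show ?thesis
        using True unfolding is_cycle_def H_def by (intro disjI2 exI[of _ "[p0, p1, p2, p3]"]) simp
    next
      case False
      then have "distinct [p0, p1, p2, p3, p4]"
        using ne ne' \<open>p0 \<noteq> p3\<close> \<open>p1 \<noteq> p4\<close> by auto
      then show ?thesis
        using False unfolding is_path_def H_def
        by (intro disjI1 exI[of _ "[p0, p1, p2, p3, p4]"]) simp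
    qed
    moreover have "card (edges H) = 4"
      unfolding H using ne ne' \<open>p0 \<noteq> p3\<close> \<open>p1 \<noteq> p4\<close> by (auto simp: doubleton_eq_iff card_insert_if)
    moreover have "bicolored c H"
      unfolding bicolored_def H using alt two by (simp add: insert_commute)
    ultimately show False
      using L unfolding star_edge_coloring_def by blast
  qed
  then show "star_on k (edges G) c (verts G)"
    using col proper unfolding star_on_def by blast
next
  assume R: "star_on k (edges G) c (verts G)"
  have edge: "\<exists>x\<in>verts G. \<exists>y\<in>verts G. x \<noteq> y \<and> e = {x, y}" if "e \<in> edges G" for e
    using G that unfolding fin_simple_graph_def by (metis card_2_iff insert_subset)
  have col: "c e \<in> {1..k}" if "e \<in> edges G" for e
    using edge[OF that] star_on_color[OF R] that by blast
  have distinct_col: "c e \<noteq> c f" if ef: "e \<in> edges G" "f \<in> edges G" "e \<noteq> f" "e \<inter> f \<noteq> {}" for e f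
  proof -
    obtain x where "x \<in> e" "x \<in> f" using ef(4) by blast
    have other_end: "\<exists>y. g = {x, y}" if g: "g \<in> edges G" "x \<in> g" for g
      using edge[OF g(1)] g(2) by (auto simp: doubleton_eq_iff)
    obtain y where "e = {x, y}" using other_end[OF ef(1) \<open>x \<in> e\<close>] ..
    moreover obtain z where "f = {x, z}" using other_end[OF ef(2) \<open>x \<in> f\<close>] ..
    moreover have "x \<in> verts G"
      using edge[OF ef(1)] \<open>x \<in> e\<close> by auto
    ultimately show ?thesis
      using star_on_proper[OF R, of x y z] ef by auto
  qed
  have "\<not> bicolored c H"
    if H: "subgraph H G" "is_path H \<or> is_cycle H" "card (edges H) = 4" for H
  proof
    assume bi: "bicolored c H"
    obtain p0 p1 p2 p3 p4 where edges_H: "edges H = {{p0, p1}, {p1, p2}, {p2, p3}, {p3, p4}}"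
      and ne: "p0 \<noteq> p2" "p1 \<noteq> p3" "p2 \<noteq> p4"
    proof (cases "is_path H")
      case True
      then obtain p where p: "distinct p" "H = path_graph p"
        unfolding is_path_def by blast
      then have "length p - 1 = 4"
        using H(3) card_walk_edges[of p] by (simp add: path_graph_def)
      then have "length p = Suc (Suc (Suc (Suc (Suc 0))))" by simp
      then obtain a b d e f where "p = [a, b, d, e, f]"
        by (auto simp: length_Suc_conv)
      then show ?thesis using that[of a b d e f] p by (simp add: path_graph_def)
    next
      case False
      then obtain p where p: "distinct p" "3 \<le> length p" "H = cycle_graph p"
        using H(2) unfolding is_cycle_def by blast
      then have "length p = 4"
        using H(3) card_edges_cycle_graph[of p] by simp
      then have "length p = Suc (Suc (Suc (Suc 0)))" by simp
      then obtain a b d e where "p = [a, b, d, e]"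
        by (auto simp: length_Suc_conv)
      then show ?thesis using that[of a b d e a] p by (auto simp: cycle_graph_def)
    qed
    have E: "{p0, p1} \<in> edges G" "{p1, p2} \<in> edges G" "{p2, p3} \<in> edges G" "{p3, p4} \<in> edges G"
      using H(1) edges_H unfolding subgraph_def by auto
    have V: "p1 \<in> verts G" "p2 \<in> verts G" "p3 \<in> verts G"
    proof -
      have "{p1, p2} \<subseteq> verts G" "{p2, p3} \<subseteq> verts G"
        using G E unfolding fin_simple_graph_def by metis+
      then show "p1 \<in> verts G" "p2 \<in> verts G" "p3 \<in> verts G" by blast+
    qed
    have "c {p0, p1} \<noteq> c {p1, p2}" "c {p1, p2} \<noteq> c {p2, p3}" "c {p2, p3} \<noteq> c {p3, p4}"
      using star_on_proper[OF R V(1), of p0 p2] star_on_proper[OF R V(2), of p1 p3]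
        star_on_proper[OF R V(3), of p2 p4] E ne by (simp_all add: insert_commute)
    moreover have "card {c {p0, p1}, c {p1, p2}, c {p2, p3}, c {p3, p4}} = 2"
      using bi edges_H unfolding bicolored_def by simp
    ultimately have "c {p2, p3} = c {p0, p1} \<and> c {p3, p4} = c {p1, p2}"
      by (intro alternating_if_two_colors) auto
    then show False
      using star_on_walk[OF R V E ne] by simp
  qed
  then show "star_edge_coloring G k c"
    using col distinct_col unfolding star_edge_coloring_def proper_edge_coloring_def by blast
qed

section \<open>Four colors do not suffice around a triangle\<close>

text \<open>Three neighbors are expressed by avoiding any two given vertices, which is the form in which they
  are needed.\<close>
definition min_degree_3 :: "'a set set \<Rightarrow> 'a set \<Rightarrow> bool" where
  "min_degree_3 E V \<longleftrightarrow> (\<forall>x\<in>V. \<forall>y z. \<exists>w\<in>V. {x, w} \<in> E \<and> w \<noteq> y \<and> w \<noteq> z)"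

lemma two_more_neighbors:
  assumes "min_degree_3 E V" "x \<in> V"
  obtains w w' where "w \<in> V" "w' \<in> V" "{x, w} \<in> E" "{x, w'} \<in> E" "w \<noteq> y" "w' \<noteq> y" "w \<noteq> w'"
  using assms unfolding min_degree_3_def by metis

lemma not_three_colors_missing:
  assumes S: "star_on 4 E c V" and deg: "min_degree_3 E V" and x: "x \<in> V"
    and cols: "{p, q, r} \<subseteq> {1..4}" "p \<noteq> q" "p \<noteq> r" "q \<noteq> r"
    and miss: "\<And>w. {x, w} \<in> E \<Longrightarrow> w \<noteq> y \<Longrightarrow> c {x, w} \<notin> {p, q, r}"
  shows False
proof -
  obtain w w' where ww: "{x, w} \<in> E" "{x, w'} \<in> E" "w \<noteq> y" "w' \<noteq> y" "w \<noteq> w'"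
    using two_more_neighbors[OF deg x] by metis
  have "card ({1..4} - {p, q, r}) = card {1..4::nat} - card {p, q, r}"
    using cols(1) by (intro card_Diff_subset) auto
  then have "card ({1..4} - {p, q, r}) \<le> Suc 0"
    using cols(2-) by simp
  moreover have "c {x, w} \<in> {1..4} - {p, q, r}" "c {x, w'} \<in> {1..4} - {p, q, r}"
    using miss[OF ww(1,3)] miss[OF ww(2,4)] star_on_color[OF S x ww(1)] star_on_color[OF S x ww(2)]
    by blast+
  ultimately have "c {x, w} = c {x, w'}"
    by (meson card_le_Suc0_iff_eq finite_Diff finite_atLeastAtMost)
  then show False
    using star_on_proper[OF S x ww(1,2,5)] by simp
qed

text \<open>If the pendant edge at the corner \<open>a\<close> repeats the color of \<open>bd\<close>, then at its outer end \<open>a'\<close> the colors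
  of \<open>ab\<close> and \<open>ad\<close> are forbidden too, as they would start alternating walks \<open>w a' a b d\<close> and
  \<open>w a' a d b\<close>. One color is left for two edges.\<close>
lemma pendant_color_not_opposite:
  assumes S: "star_on 4 E c V" and deg: "min_degree_3 E V"
    and tri: "{a, b} \<in> E" "{b, d} \<in> E" "{a, d} \<in> E" "a \<noteq> b" "b \<noteq> d" "a \<noteq> d"
    and V: "a \<in> V" "b \<in> V" "d \<in> V" "a' \<in> V"
    and a': "{a, a'} \<in> E" "a' \<noteq> b" "a' \<noteq> d"
  shows "c {a, a'} \<noteq> c {b, d}"
proof
  assume eq: "c {a, a'} = c {b, d}"
  show False
  proof (rule not_three_colors_missing[OF S deg V(4)])
    show "c {a, b} \<noteq> c {a, d}" "c {a, a'} \<noteq> c {a, b}" "c {a, a'} \<noteq> c {a, d}"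
      using star_on_proper[OF S V(1), of b d] star_on_proper[OF S V(1), of a' b]
        star_on_proper[OF S V(1), of a' d] tri a' by simp_all
    show "{c {a, a'}, c {a, b}, c {a, d}} \<subseteq> {1..4}"
      using star_on_color[OF S V(1)] tri a' by blast
    fix w
    assume w: "{a', w} \<in> E" "w \<noteq> a"
    have "c {a', w} \<noteq> c {a, a'}"
      using star_on_proper[OF S V(4), of w a] w a' by (simp add: insert_commute)
    moreover have "c {a', w} \<noteq> c {a, b}"
      using star_on_walk[OF S V(4,1,2), of w d] w a' tri eq by (auto simp: insert_commute)
    moreover have "c {a', w} \<noteq> c {a, d}"
      using star_on_walk[OF S V(4,1,3), of w b] w a' tri eq by (auto simp: insert_commute)
    ultimately show "c {a', w} \<notin> {c {a, a'}, c {a, b}, c {a, d}}" by simp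
  qed
qed

text \<open>No pendant edge repeats the color of the opposite side of the triangle, so all three pendant edges
  carry the color that is missing on the triangle. Now \<open>a'\<close> cannot use the colors of \<open>ab\<close> and \<open>ad\<close>
  because of the walks \<open>w a' a b b'\<close> and \<open>w a' a d d'\<close>, and again one color is left for two edges.\<close>
lemma no_star_4_edge_coloring_triangle:
  assumes S: "star_on 4 E c V" and deg: "min_degree_3 E V"
    and tri: "{a, b} \<in> E" "{b, d} \<in> E" "{a, d} \<in> E" "a \<noteq> b" "b \<noteq> d" "a \<noteq> d"
    and V: "a \<in> V" "b \<in> V" "d \<in> V"
  shows False
proof -
  obtain a' where a': "a' \<in> V" "{a, a'} \<in> E" "a' \<noteq> b" "a' \<noteq> d"
    using deg V(1) unfolding min_degree_3_def by metis
  obtain b' where b': "b' \<in> V" "{b, b'} \<in> E" "b' \<noteq> a" "b' \<noteq> d"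
    using deg V(2) unfolding min_degree_3_def by metis
  obtain d' where d': "d' \<in> V" "{d, d'} \<in> E" "d' \<noteq> a" "d' \<noteq> b"
    using deg V(3) unfolding min_degree_3_def by metis
  have tri': "{b, a} \<in> E" "{d, a} \<in> E" "{d, b} \<in> E"
    using tri by (simp_all add: insert_commute)
  have flip: "c {b, a} = c {a, b}" "c {d, a} = c {a, d}" "c {d, b} = c {b, d}"
    by (simp_all add: insert_commute)
  let ?T = "{c {a, b}, c {a, d}, c {b, d}}"
  have cols: "?T \<subseteq> {1..4}" "c {a, a'} \<in> {1..4}" "c {b, b'} \<in> {1..4}" "c {d, d'} \<in> {1..4}"
    using star_on_color[OF S V(1)] star_on_color[OF S V(2)] star_on_color[OF S V(3)] tri a' b' d'
    by blast+
  have T: "c {a, b} \<noteq> c {a, d}" "c {a, b} \<noteq> c {b, d}" "c {a, d} \<noteq> c {b, d}"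
    using star_on_proper[OF S V(1) tri(1,3)] star_on_proper[OF S V(2) tri'(1) tri(2)]
      star_on_proper[OF S V(3) tri'(2,3)] tri flip by simp_all
  have A: "c {a, a'} \<notin> ?T"
    using pendant_color_not_opposite[OF S deg tri V a'] star_on_proper[OF S V(1) a'(2) tri(1)]
      star_on_proper[OF S V(1) a'(2) tri(3)] a' by simp
  have B: "c {b, b'} \<notin> ?T"
    using pendant_color_not_opposite[OF S deg tri'(1) tri(3,2) _ _ _ V(2,1,3) b']
      star_on_proper[OF S V(2) b'(2) tri'(1)] star_on_proper[OF S V(2) b'(2) tri(2)] tri b' flip by simp
  have D: "c {d, d'} \<notin> ?T"
    using pendant_color_not_opposite[OF S deg tri'(2) tri(1) tri'(3) _ _ _ V(3,1,2) d']
      star_on_proper[OF S V(3) d'(2) tri'(2)] star_on_proper[OF S V(3) d'(2) tri'(3)] tri d' flip by simp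
  have "card ({1..4} - ?T) = card {1..4::nat} - card ?T"
    using cols(1) by (intro card_Diff_subset) auto
  then have "card ({1..4} - ?T) \<le> Suc 0"
    using T by simp
  then have same: "c {b, b'} = c {a, a'}" "c {d, d'} = c {a, a'}"
    using A B D cols by (meson DiffI card_le_Suc0_iff_eq finite_Diff finite_atLeastAtMost)+
  show False
  proof (rule not_three_colors_missing[OF S deg a'(1)])
    show "{c {a, a'}, c {a, b}, c {a, d}} \<subseteq> {1..4}"
      using cols by simp
    show "c {a, b} \<noteq> c {a, d}" "c {a, a'} \<noteq> c {a, b}" "c {a, a'} \<noteq> c {a, d}"
      using A T by auto
    fix w
    assume w: "{a', w} \<in> E" "w \<noteq> a"
    have w': "{w, a'} \<in> E" "{a', a} \<in> E" "c {w, a'} = c {a', w}" "c {a', a} = c {a, a'}"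
      using w a' by (simp_all add: insert_commute)
    have "c {a', w} \<noteq> c {a, a'}"
      using star_on_proper[OF S a'(1) w(1) w'(2)] w w' by simp
    moreover have "c {a', w} \<noteq> c {a, b}"
      using star_on_walk[OF S a'(1) V(1,2) w'(1,2) tri(1) b'(2)] w w' a' b' same by auto
    moreover have "c {a', w} \<noteq> c {a, d}"
      using star_on_walk[OF S a'(1) V(1,3) w'(1,2) tri(3) d'(2)] w w' a' d' same by auto
    ultimately show "c {a', w} \<notin> {c {a, a'}, c {a, b}, c {a, d}}" by simp
  qed
qed

section \<open>Gluing colored pieces along port edges\<close>

text \<open>A partially colored graph with colored vertex set \<open>V\<close> is continued along port edges \<open>xy\<close> with \<open>x \<in> V\<close>
  and \<open>y \<notin> V\<close>. For the continuation it suffices to know a triple \<open>(a, B, F)\<close>: the color \<open>a\<close> of the port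
  edge, a set \<open>B\<close> containing the colors of the other edges at \<open>x\<close>, and a set \<open>F\<close> containing those among
  them after which a walk can go on with color \<open>a\<close>. The sets are upper bounds, which allows to
  identify states by forgetting information.\<close>
type_synonym port = "nat \<times> nat set \<times> nat set"

definition has_port :: "'a set set \<Rightarrow> ('a set \<Rightarrow> nat) \<Rightarrow> 'a set \<Rightarrow> 'a \<Rightarrow> 'a \<Rightarrow> port \<Rightarrow> bool" where
  "has_port E c V x y P \<longleftrightarrow> x \<in> V \<and> y \<notin> V \<and> {x, y} \<in> E \<and> (\<forall>z. {x, z} \<in> E \<longrightarrow> z \<noteq> y \<longrightarrow> z \<in> V) \<and>
     (case P of (a, B, F) \<Rightarrow> c {x, y} = a \<and>
       (\<forall>z. {x, z} \<in> E \<longrightarrow> z \<noteq> y \<longrightarrow> c {x, z} \<in> B) \<and>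
       (\<forall>z w. {x, z} \<in> E \<longrightarrow> z \<noteq> y \<longrightarrow> {z, w} \<in> E \<longrightarrow> w \<noteq> x \<longrightarrow> c {z, w} = a \<longrightarrow> c {x, z} \<in> F))"

lemma has_portD:
  assumes "has_port E c V x y (a, B, F)"
  shows "x \<in> V" "y \<notin> V" "{x, y} \<in> E" "c {x, y} = a"
    "\<And>z. {x, z} \<in> E \<Longrightarrow> z \<noteq> y \<Longrightarrow> z \<in> V"
    "\<And>z. {x, z} \<in> E \<Longrightarrow> z \<noteq> y \<Longrightarrow> c {x, z} \<in> B"
    "\<And>z w. {x, z} \<in> E \<Longrightarrow> z \<noteq> y \<Longrightarrow> {z, w} \<in> E \<Longrightarrow> w \<noteq> x \<Longrightarrow> c {z, w} = a \<Longrightarrow> c {x, z} \<in> F"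
  using assms unfolding has_port_def by simp_all

fun port_le :: "port \<Rightarrow> port \<Rightarrow> bool" where
  "port_le (a, B, F) (a', B', F') \<longleftrightarrow> a = a' \<and> B \<subseteq> B' \<and> F \<subseteq> F'"

lemma has_port_weaken: "has_port E c V x y P \<Longrightarrow> port_le P P' \<Longrightarrow> has_port E c V x y P'"
  by (cases P; cases P') (auto simp: has_port_def)

lemma star_on_cong:
  assumes "star_on k E c V" "\<And>x y. x \<in> V \<Longrightarrow> {x, y} \<in> E \<Longrightarrow> c' {x, y} = c {x, y}"
  shows "star_on k E c' V"
proof -
  have eq: "c' {x, y} = c {x, y}" if "x \<in> V \<or> y \<in> V" "{x, y} \<in> E" for x y
    using assms(2)[of x y] assms(2)[of y x] that by (auto simp: insert_commute)
  show ?thesis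
    using assms(1) unfolding star_on_def by (simp add: eq)
qed

lemma has_port_cong:
  assumes "has_port E c V x y P" "\<And>x y. x \<in> V \<Longrightarrow> {x, y} \<in> E \<Longrightarrow> c' {x, y} = c {x, y}"
  shows "has_port E c' V x y P"
proof -
  obtain a B F where P: "P = (a, B, F)" by (cases P)
  note p = has_portD[OF assms(1)[unfolded P]]
  have c1: "c' {x, z} = c {x, z}" if "{x, z} \<in> E" for z
    using assms(2) p(1) that .
  have c2: "c' {z, w} = c {z, w}" if "{x, z} \<in> E" "z \<noteq> y" "{z, w} \<in> E" for z w
    using assms(2) p(5)[OF that(1,2)] that(3) .
  have "c' {x, z} \<in> B" if "{x, z} \<in> E" "z \<noteq> y" for z
    using p(6)[OF that] c1[OF that(1)] by simp
  moreover have "c' {x, z} \<in> F"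
    if "{x, z} \<in> E" "z \<noteq> y" "{z, w} \<in> E" "w \<noteq> x" "c' {z, w} = a" for z w
    using p(7)[OF that(1-4)] c1[OF that(1)] c2[OF that(1-3)] that(5) by simp
  ultimately show ?thesis
    unfolding P has_port_def prod.case using p(1-5) c1[OF p(3)] by blast
qed

lemma has_port_mono:
  assumes "has_port E c V x y P" "V \<subseteq> V'" "y \<notin> V'"
  shows "has_port E c V' x y P"
  using assms unfolding has_port_def by blast

text \<open>Let the middle edge \<open>xy\<close> of an alternating walk cross from \<open>V\<close> to \<open>W\<close> and let \<open>b\<close> be the other color.
  Then \<open>b\<close> occurs at both ends of \<open>xy\<close>, and the walk goes on with color \<open>a\<close> behind one of the two
  \<open>b\<close>-edges. So it is enough to demand that a color \<open>b \<in> B\<close> used at \<open>y\<close> is followed by \<open>a\<close> on neither side.\<close>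
lemma star_on_Un:
  assumes V: "star_on k E c V" and W: "star_on k E c W"
    and port: "\<And>x y. x \<in> V \<Longrightarrow> y \<in> W \<Longrightarrow> {x, y} \<in> E \<Longrightarrow> \<exists>a B F. has_port E c V x y (a, B, F) \<and>
      (\<forall>z. {y, z} \<in> E \<longrightarrow> z \<noteq> x \<longrightarrow> c {y, z} \<in> B \<longrightarrow> c {y, z} \<notin> F \<and>
        (z \<in> V \<union> W \<longrightarrow> (\<forall>w. {z, w} \<in> E \<longrightarrow> w \<noteq> y \<longrightarrow> c {z, w} \<noteq> a)))"
  shows "star_on k E c (V \<union> W)"
proof -
  have no_alt: False
    if xy: "x \<in> V" "y \<in> W" and E: "{w, z} \<in> E" "{z, x} \<in> E" "{x, y} \<in> E" "{y, z'} \<in> E"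
      and ne: "w \<noteq> x" "z \<noteq> y" "x \<noteq> z'" and alt: "c {w, z} = c {x, y}" "c {z, x} = c {y, z'}"
    for w z x y z'
  proof -
    obtain a B F where p: "has_port E c V x y (a, B, F)"
      and q: "\<And>z. {y, z} \<in> E \<Longrightarrow> z \<noteq> x \<Longrightarrow> c {y, z} \<in> B \<Longrightarrow> c {y, z} \<notin> F"
      using port[OF xy E(3)] by blast
    have "{x, z} \<in> E" "{z, w} \<in> E" "c {x, z} = c {y, z'}" "c {z, w} = a"
      using E alt has_portD(4)[OF p] by (simp_all add: insert_commute)
    then show False
      using has_portD(6,7)[OF p] q[OF E(4)] ne by metis
  qed
  have no_alt': False
    if xy: "x \<in> V" "y \<in> W" "z' \<in> V \<union> W"
      and E: "{z, x} \<in> E" "{x, y} \<in> E" "{y, z'} \<in> E" "{z', w} \<in> E"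
      and ne: "z \<noteq> y" "x \<noteq> z'" "w \<noteq> y" and alt: "c {z, x} = c {y, z'}" "c {x, y} = c {z', w}"
    for w z x y z'
  proof -
    obtain a B F where p: "has_port E c V x y (a, B, F)"
      and q: "\<And>z w. {y, z} \<in> E \<Longrightarrow> z \<noteq> x \<Longrightarrow> c {y, z} \<in> B \<Longrightarrow> z \<in> V \<union> W \<Longrightarrow>
        {z, w} \<in> E \<Longrightarrow> w \<noteq> y \<Longrightarrow> c {z, w} \<noteq> a"
      using port[OF xy(1,2) E(2)] by blast
    have "{x, z} \<in> E" "c {x, z} = c {y, z'}"
      using E alt by (simp_all add: insert_commute)
    then show False
      using has_portD(4,6)[OF p] q[OF E(3) _ _ xy(3) E(4)] ne alt by metis
  qed
  have "\<not> (c {p0, p1} = c {p2, p3} \<and> c {p1, p2} = c {p3, p4})"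
    if p: "p1 \<in> V \<union> W" "p2 \<in> V \<union> W" "p3 \<in> V \<union> W"
      and E: "{p0, p1} \<in> E" "{p1, p2} \<in> E" "{p2, p3} \<in> E" "{p3, p4} \<in> E"
      and ne: "p0 \<noteq> p2" "p1 \<noteq> p3" "p2 \<noteq> p4" for p0 p1 p2 p3 p4
  proof
    assume alt: "c {p0, p1} = c {p2, p3} \<and> c {p1, p2} = c {p3, p4}"
    have E': "{p1, p0} \<in> E" "{p2, p1} \<in> E" "{p3, p2} \<in> E" "{p4, p3} \<in> E"
      and alt': "c {p1, p0} = c {p3, p2}" "c {p2, p1} = c {p4, p3}"
        "c {p0, p1} = c {p3, p2}" "c {p3, p4} = c {p2, p1}"
        "c {p1, p2} = c {p4, p3}" "c {p2, p3} = c {p1, p0}"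
      using E alt by (simp_all add: insert_commute)
    consider "p1 \<in> V" "p2 \<in> V" "p3 \<in> V" | "p1 \<in> W" "p2 \<in> W" "p3 \<in> W"
      | "p1 \<in> V" "p2 \<in> W" | "p2 \<in> V" "p1 \<in> W" | "p2 \<in> V" "p3 \<in> W" | "p3 \<in> V" "p2 \<in> W"
      using p by blast
    then show False
    proof cases
      case 1
      then show False using star_on_walk[OF V _ _ _ E ne] alt by blast
    next
      case 2
      then show False using star_on_walk[OF W _ _ _ E ne] alt by blast
    next
      case 3
      then show False using no_alt'[of p1 p2 p3 p0 p4] p E ne alt by metis
    next
      case 4
      then show False using no_alt[of p2 p1 p4 p3 p0] E' ne alt' by metis
    next
      case 5
      then show False using no_alt[of p2 p3 p0 p1 p4] E ne alt by metis
    next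
      case 6
      then show False using no_alt'[of p3 p2 p1 p4 p0] p E' ne alt' by metis
    qed
  qed
  moreover have "c {x, y} \<in> {1..k}" if "x \<in> V \<union> W" "{x, y} \<in> E" for x y
    using that star_on_color[OF V] star_on_color[OF W] by blast
  moreover have "c {x, y} \<noteq> c {x, z}"
    if "x \<in> V \<union> W" "{x, y} \<in> E" "{x, z} \<in> E" "y \<noteq> z" for x y z
    using that star_on_proper[OF V] star_on_proper[OF W] by blast
  ultimately show ?thesis
    unfolding star_on_def by simp
qed

section \<open>States of a partial coloring and their transitions\<close>

text \<open>Two ports with colors \<open>a\<close> and \<open>b\<close> end in adjacent new vertices \<open>y\<close> and \<open>w\<close>. The edge \<open>yw\<close> gets the
  color \<open>e\<close>, and \<open>y\<close> and \<open>w\<close> get new port edges of colors \<open>a'\<close> and \<open>b'\<close>. The predicate collects the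
  conditions at \<open>y\<close>.\<close>
fun attach_ok :: "port \<Rightarrow> nat \<Rightarrow> nat \<Rightarrow> nat \<Rightarrow> nat \<Rightarrow> bool" where
  "attach_ok (a, B, F) b e a' b' \<longleftrightarrow> e \<noteq> a \<and> a' \<noteq> a \<and> a' \<noteq> e \<and> a' \<in> {1..5} \<and> e \<in> {1..5} \<and>
     (e \<in> B \<longrightarrow> e \<notin> F \<and> a \<noteq> b \<and> a \<noteq> b') \<and> (a' \<in> B \<longrightarrow> a' \<notin> F)"

text \<open>The new port at \<open>y\<close>: behind the old port edge, \<open>a'\<close> can occur only if \<open>a' \<in> B\<close>; behind the edge \<open>yw\<close>
  it occurs if it is one of the colors \<open>b\<close> and \<open>b'\<close> at \<open>w\<close>.\<close>
fun next_port :: "port \<Rightarrow> nat \<Rightarrow> nat \<Rightarrow> nat \<Rightarrow> nat \<Rightarrow> port" where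
  "next_port (a, B, F) b e a' b' =
     (a', {a, e}, (if a' \<in> B then {a} else {}) \<union> (if a' \<in> {b, b'} then {e} else {}))"

text \<open>Three ports end in a triangle. At the corner of the port with color \<open>a\<close>, the triangle edges \<open>e1\<close> and
  \<open>e2\<close> lead to the corners of the ports with colors \<open>a1\<close> and \<open>a2\<close>, and \<open>e3\<close> is the opposite edge. The
  last two conditions exclude the alternating walks that enter at this corner, pass all three
  corners and leave through another port.\<close>
fun cap_ok :: "port \<Rightarrow> nat \<Rightarrow> nat \<Rightarrow> nat \<Rightarrow> nat \<Rightarrow> nat \<Rightarrow> bool" where
  "cap_ok (a, B, F) e1 a1 e2 a2 e3 \<longleftrightarrow> e1 \<noteq> a \<and> e2 \<noteq> a \<and> e1 \<noteq> e2 \<and> e1 \<in> {1..5} \<and> e2 \<in> {1..5} \<and>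
     (e1 \<in> B \<longrightarrow> e1 \<notin> F \<and> a \<noteq> a1 \<and> a \<noteq> e3) \<and> (e2 \<in> B \<longrightarrow> e2 \<notin> F \<and> a \<noteq> a2 \<and> a \<noteq> e3) \<and>
     \<not> (a = e3 \<and> e1 = a2) \<and> \<not> (a = e3 \<and> e2 = a1)"

abbreviation step_ok :: "port \<Rightarrow> port \<Rightarrow> nat \<Rightarrow> nat \<Rightarrow> nat \<Rightarrow> bool" where
  "step_ok L S e l s \<equiv> attach_ok L (fst S) e l s \<and> attach_ok S (fst L) e s l"

abbreviation close_ok :: "port \<Rightarrow> port \<Rightarrow> port \<Rightarrow> nat \<Rightarrow> nat \<Rightarrow> nat \<Rightarrow> bool" where
  "close_ok L S R e1 e2 e3 \<equiv> cap_ok L e1 (fst S) e3 (fst R) e2 \<and>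
     cap_ok S e1 (fst L) e2 (fst R) e3 \<and> cap_ok R e3 (fst L) e2 (fst S) e1"

definition five_colors :: "nat \<Rightarrow> nat \<Rightarrow> nat \<Rightarrow> nat \<Rightarrow> nat \<Rightarrow> bool" where
  "five_colors p q r t u \<longleftrightarrow> distinct [p, q, r, t, u] \<and> {p, q, r, t, u} \<subseteq> {1..5}"

text \<open>Both orientations of every inequality are listed for the benefit of rewriting.\<close>
lemma five_colors_iff:
  "five_colors p q r t u \<longleftrightarrow>
    p \<noteq> q \<and> p \<noteq> r \<and> p \<noteq> t \<and> p \<noteq> u \<and> q \<noteq> p \<and> q \<noteq> r \<and> q \<noteq> t \<and> q \<noteq> u \<and>
    r \<noteq> p \<and> r \<noteq> q \<and> r \<noteq> t \<and> r \<noteq> u \<and> t \<noteq> p \<and> t \<noteq> q \<and> t \<noteq> r \<and> t \<noteq> u \<and>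
    u \<noteq> p \<and> u \<noteq> q \<and> u \<noteq> r \<and> u \<noteq> t \<and>
    p \<in> {1..5} \<and> q \<in> {1..5} \<and> r \<in> {1..5} \<and> t \<in> {1..5} \<and> u \<in> {1..5}"
  unfolding five_colors_def by auto

text \<open>The states of the three ports in which the coloring can be continued whatever comes next, provided
  that the next leaf subdivides the port \<open>L\<close>. The middle port \<open>S\<close> is the spine edge. Up to
  permutations of the colors there are seven such states in this list. They form a small subfamily,
  found by a computer search, that contains a state of a triangle (\<open>row5\<close>) and has the closure
  properties of the next three lemmas. The choice of the colors may depend on what follows, hence
  three lemmas: the following leaf lies on the same side, it lies on the other side (so that \<open>L\<close>
  and \<open>R\<close> change roles), or the final triangle follows.\<close>
inductive ready :: "port \<Rightarrow> port \<Rightarrow> port \<Rightarrow> bool" where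
  row1: "five_colors p q r t u \<Longrightarrow>
    ready (p, {q, r}, {}) (q, {p, t}, {}) (r, {p, t}, {})"
| row2: "five_colors p q r t u \<Longrightarrow>
    ready (p, {q, r}, {}) (t, {q, u}, {}) (p, {r, u}, {})"
| row3: "five_colors p q r t u \<Longrightarrow>
    ready (p, {q, r}, {}) (t, {p, q}, {p}) (u, {p, t}, {})"
| row4: "five_colors p q r t u \<Longrightarrow>
    ready (p, {q, r}, {r}) (r, {q, t}, {q, t}) (u, {q, r}, {})"
| row5: "five_colors p q r t u \<Longrightarrow>
    ready (p, {q, r}, {q, r}) (p, {q, t}, {q, t}) (u, {r, t}, {})"
| row6: "five_colors p q r t u \<Longrightarrow>
    ready (p, {q, r}, {}) (t, {q, r, u}, {}) (q, {p, t}, {})"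
| row7: "five_colors p q r t u \<Longrightarrow>
    ready (p, {q, r}, {q, r}) (q, {r, t, u}, {r}) (r, {p, t}, {})"

lemma ready_same_side:
  assumes "ready L S R"
  obtains e l s L' S' R' where "step_ok L S e l s" "ready L' S' R'"
    "port_le (next_port L (fst S) e l s) L'" "port_le (next_port S (fst L) e s l) S'" "port_le R R'"
  using assms
proof cases
  case (row1 p q r t u)
  show ?thesis
    using ready.row4[of u t p q r]
    by (intro that[of t u p "(u, {t, p}, {p})" "(p, {t, q}, {t, q})" "(r, {t, p}, {})"])
      (simp_all add: five_colors_def row1(1-3) row1(4)[unfolded five_colors_iff] del: atLeastAtMost_iff One_nat_def)
next
  case (row2 p q r t u)
  show ?thesis
    using ready.row6[of u p q r t]
    by (intro that[of q u r "(u, {p, q}, {})" "(r, {p, q, t}, {})" "(p, {u, r}, {})"])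
      (simp_all add: five_colors_def row2(1-3) row2(4)[unfolded five_colors_iff] del: atLeastAtMost_iff One_nat_def)
next
  case (row3 p q r t u)
  show ?thesis
    using ready.row5[of r q p t u]
    by (intro that[of q r r "(r, {q, p}, {q, p})" "(r, {q, t}, {q, t})" "(u, {p, t}, {})"])
      (simp_all add: five_colors_def row3(1-3) row3(4)[unfolded five_colors_iff] del: atLeastAtMost_iff One_nat_def)
next
  case (row4 p q r t u)
  show ?thesis
    using ready.row7[of q p u r t]
    by (intro that[of u q p "(q, {p, u}, {p, u})" "(p, {u, r, t}, {u})" "(u, {q, r}, {})"])
      (simp_all add: five_colors_def row4(1-3) row4(4)[unfolded five_colors_iff] del: atLeastAtMost_iff One_nat_def)
next
  case (row5 p q r t u)
  show ?thesis
    using ready.row6[of t u p r q]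
    by (intro that[of u t r "(t, {u, p}, {})" "(r, {u, p, q}, {})" "(u, {t, r}, {})"])
      (simp_all add: five_colors_def row5(1-3) row5(4)[unfolded five_colors_iff] del: atLeastAtMost_iff One_nat_def)
next
  case (row6 p q r t u)
  show ?thesis
    using ready.row5[of u r p t q]
    by (intro that[of r u u "(u, {r, p}, {r, p})" "(u, {r, t}, {r, t})" "(q, {p, t}, {})"])
      (simp_all add: five_colors_def row6(1-3) row6(4)[unfolded five_colors_iff] del: atLeastAtMost_iff One_nat_def)
next
  case (row7 p q r t u)
  show ?thesis
    using ready.row4[of u t p q r]
    by (intro that[of t u p "(u, {t, p}, {p})" "(p, {t, q}, {t, q})" "(r, {t, p}, {})"])
      (simp_all add: five_colors_def row7(1-3) row7(4)[unfolded five_colors_iff] del: atLeastAtMost_iff One_nat_def)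
qed

lemma ready_other_side:
  assumes "ready L S R"
  obtains e l s R' S' L' where "step_ok L S e l s" "ready R' S' L'"
    "port_le (next_port L (fst S) e l s) L'" "port_le (next_port S (fst L) e s l) S'" "port_le R R'"
  using assms
proof cases
  case (row1 p q r t u)
  show ?thesis
    using ready.row4[of r t p q u]
    by (intro that[of t u p "(r, {t, p}, {p})" "(p, {t, q}, {t, q})" "(u, {t, p}, {})"])
      (simp_all add: five_colors_def row1(1-3) row1(4)[unfolded five_colors_iff] del: atLeastAtMost_iff One_nat_def)
next
  case (row2 p q r t u)
  show ?thesis
    using ready.row7[of p r u q t]
    by (intro that[of q u r "(p, {r, u}, {r, u})" "(r, {u, q, t}, {u})" "(u, {p, q}, {})"])
      (simp_all add: five_colors_def row2(1-3) row2(4)[unfolded five_colors_iff] del: atLeastAtMost_iff One_nat_def)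
next
  case (row3 p q r t u)
  show ?thesis
    using ready.row2[of u t p r q]
    by (intro that[of q u r "(u, {t, p}, {})" "(r, {t, q}, {})" "(u, {p, q}, {})"])
      (simp_all add: five_colors_def row3(1-3) row3(4)[unfolded five_colors_iff] del: atLeastAtMost_iff One_nat_def)
next
  case (row4 p q r t u)
  show ?thesis
    using ready.row3[of u r q p t]
    by (intro that[of u t p "(u, {r, q}, {})" "(p, {u, r}, {u})" "(t, {u, p}, {})"])
      (simp_all add: five_colors_def row4(1-3) row4(4)[unfolded five_colors_iff] del: atLeastAtMost_iff One_nat_def)
next
  case (row5 p q r t u)
  show ?thesis
    using ready.row1[of u r t p q]
    by (intro that[of u t r "(u, {r, t}, {})" "(r, {u, p}, {})" "(t, {u, p}, {})"])
      (simp_all add: five_colors_def row5(1-3) row5(4)[unfolded five_colors_iff] del: atLeastAtMost_iff One_nat_def)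
next
  case (row6 p q r t u)
  show ?thesis
    using ready.row5[of q t p r u]
    by (intro that[of r u q "(q, {t, p}, {t, p})" "(q, {t, r}, {t, r})" "(u, {p, r}, {})"])
      (simp_all add: five_colors_def row6(1-3) row6(4)[unfolded five_colors_iff] del: atLeastAtMost_iff One_nat_def)
next
  case (row7 p q r t u)
  show ?thesis
    using ready.row4[of r t p q u]
    by (intro that[of t u p "(r, {t, p}, {p})" "(p, {t, q}, {t, q})" "(u, {t, p}, {})"])
      (simp_all add: five_colors_def row7(1-3) row7(4)[unfolded five_colors_iff] del: atLeastAtMost_iff One_nat_def)
qed

lemma ready_close:
  assumes "ready L S R"
  obtains e l s e1 e3 e2 where "step_ok L S e l s"
    "close_ok (next_port L (fst S) e l s) (next_port S (fst L) e s l) R e1 e2 e3"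
  using assms
proof cases
  case (row1 p q r t u)
  show ?thesis
    by (intro that[of r q t u t p]) (simp_all add: five_colors_def row1(1-3) row1(4)[unfolded five_colors_iff] del: atLeastAtMost_iff One_nat_def)
next
  case (row2 p q r t u)
  show ?thesis
    by (intro that[of q u r p t q]) (simp_all add: five_colors_def row2(1-3) row2(4)[unfolded five_colors_iff] del: atLeastAtMost_iff One_nat_def)
next
  case (row3 p q r t u)
  show ?thesis
    by (intro that[of u q q r t p]) (simp_all add: five_colors_def row3(1-3) row3(4)[unfolded five_colors_iff] del: atLeastAtMost_iff One_nat_def)
next
  case (row4 p q r t u)
  show ?thesis
    by (intro that[of u q p r t q]) (simp_all add: five_colors_def row4(1-3) row4(4)[unfolded five_colors_iff] del: atLeastAtMost_iff One_nat_def)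
next
  case (row5 p q r t u)
  show ?thesis
    by (intro that[of u t r u q p]) (simp_all add: five_colors_def row5(1-3) row5(4)[unfolded five_colors_iff] del: atLeastAtMost_iff One_nat_def)
next
  case (row6 p q r t u)
  show ?thesis
    by (intro that[of q r r u t p]) (simp_all add: five_colors_def row6(1-3) row6(4)[unfolded five_colors_iff] del: atLeastAtMost_iff One_nat_def)
next
  case (row7 p q r t u)
  show ?thesis
    by (intro that[of u t p r u q]) (simp_all add: five_colors_def row7(1-3) row7(4)[unfolded five_colors_iff] del: atLeastAtMost_iff One_nat_def)
qed

section \<open>Coloring triangles and new vertices\<close>

lemma color_at:
  assumes "\<And>z. {x, z} \<in> E \<longleftrightarrow> z \<in> {a, b, d}" "{c {x, a}, c {x, b}, c {x, d}} \<subseteq> K" "{x, y} \<in> E"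
  shows "c {x, y} \<in> K"
proof -
  have "y = a \<or> y = b \<or> y = d" using assms(1)[of y] assms(3) by simp
  then show ?thesis using assms(2) by auto
qed

lemma proper_at:
  assumes "\<And>z. {x, z} \<in> E \<longleftrightarrow> z \<in> {a, b, d}" "distinct [c {x, a}, c {x, b}, c {x, d}]"
    and "{x, y} \<in> E" "{x, z} \<in> E" "y \<noteq> z"
  shows "c {x, y} \<noteq> c {x, z}"
proof -
  have "y = a \<or> y = b \<or> y = d" "z = a \<or> z = b \<or> z = d"
    using assms(1)[of y] assms(1)[of z] assms(3,4) by simp_all
  then show ?thesis using assms(2,5) by auto
qed

text \<open>The conditions at one of two adjacent new vertices, stated so that it can be applied to the new
  outer vertex and to the new spine vertex alike.\<close>
lemma attach_one_side:
  assumes P: "has_port E c V x y (a, B, F)"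
    and N: "\<And>z. {y, z} \<in> E \<longleftrightarrow> z \<in> {x, w, y'}"
    and out: "y' \<notin> V" "y' \<noteq> y" "y' \<noteq> w"
    and w: "\<And>z. {w, z} \<in> E \<Longrightarrow> z \<noteq> y \<Longrightarrow> c {w, z} \<in> {b, b'}"
    and ok: "attach_ok (a, B, F) b (c {y, w}) (c {y, y'}) b'"
  shows "{y, z} \<in> E \<Longrightarrow> z \<noteq> x \<Longrightarrow> c {y, z} \<in> B \<Longrightarrow> c {y, z} \<notin> F \<and>
      (z \<in> V \<union> {y, w} \<longrightarrow> (\<forall>t. {z, t} \<in> E \<longrightarrow> t \<noteq> y \<longrightarrow> c {z, t} \<noteq> a))"
    and "has_port E c (V \<union> {y, w}) y y' (next_port (a, B, F) b (c {y, w}) (c {y, y'}) b')"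
proof -
  note p = has_portD[OF P]
  have yx: "c {y, x} = a" using p(4) by (simp add: insert_commute)
  note ok' = ok[simplified]
  {
    assume z: "{y, z} \<in> E" "z \<noteq> x" "c {y, z} \<in> B"
    have "z = w \<or> z = y'" using N[of z] z(1,2) by simp
    then show "c {y, z} \<notin> F \<and>
      (z \<in> V \<union> {y, w} \<longrightarrow> (\<forall>t. {z, t} \<in> E \<longrightarrow> t \<noteq> y \<longrightarrow> c {z, t} \<noteq> a))"
    proof
      assume zw: "z = w"
      then have B: "c {y, w} \<in> B" using z(3) by simp
      then have "a \<notin> {b, b'}" using ok' by simp
      then have "c {w, t} \<noteq> a" if "{w, t} \<in> E" "t \<noteq> y" for t
        using w[OF that] by auto
      then show ?thesis using B ok' unfolding zw by simp
    next
      assume "z = y'"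
      then show ?thesis using z(3) ok' out by simp
    qed
  }
  show "has_port E c (V \<union> {y, w}) y y' (next_port (a, B, F) b (c {y, w}) (c {y, y'}) b')"
    unfolding has_port_def next_port.simps prod.case
  proof (intro conjI allI impI)
    fix z t
    assume z: "{y, z} \<in> E" "z \<noteq> y'" and t: "{z, t} \<in> E" "t \<noteq> y" "c {z, t} = c {y, y'}"
    have "z = x \<or> z = w" using N[of z] z by simp
    then show "c {y, z} \<in> (if c {y, y'} \<in> B then {a} else {}) \<union>
        (if c {y, y'} \<in> {b, b'} then {c {y, w}} else {})"
    proof
      assume "z = x"
      then have "c {y, y'} \<in> B" using p(6)[of t] t by simp
      then show ?thesis using yx \<open>z = x\<close> by simp
    next
      assume "z = w"
      then have "c {y, y'} \<in> {b, b'}" using w[of t] t by simp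
      then show ?thesis using \<open>z = w\<close> by simp
    qed
  next
    fix z
    assume z: "{y, z} \<in> E" "z \<noteq> y'"
    then have "z = x \<or> z = w" using N[of z] by simp
    then show "z \<in> V \<union> {y, w}" "c {y, z} \<in> {a, c {y, w}}"
      using p(1) yx by auto
  next
    show "{y, y'} \<in> E" using N[of y'] by simp
  qed (use out in simp_all)
qed

lemma attach_star_on:
  assumes V: "star_on 5 E c V"
    and L: "has_port E c V xL u L" and S: "has_port E c V xS v S"
    and N: "\<And>z. {u, z} \<in> E \<longleftrightarrow> z \<in> {xL, v, u'}" "\<And>z. {v, z} \<in> E \<longleftrightarrow> z \<in> {xS, u, v'}"
    and out: "u' \<notin> V" "v' \<notin> V" "u' \<noteq> u" "v' \<noteq> v" "u' \<noteq> v" "v' \<noteq> u" "u \<noteq> v"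
    and ok: "step_ok L S (c {v, u}) (c {u, u'}) (c {v, v'})"
  shows "star_on 5 E c (V \<union> {v, u})"
    and "has_port E c (V \<union> {v, u}) u u' (next_port L (fst S) (c {v, u}) (c {u, u'}) (c {v, v'}))"
    and "has_port E c (V \<union> {v, u}) v v' (next_port S (fst L) (c {v, u}) (c {v, v'}) (c {u, u'}))"
proof -
  obtain a B F where L_eq: "L = (a, B, F)" by (cases L)
  obtain b B' F' where S_eq: "S = (b, B', F')" by (cases S)
  note pL = has_portD[OF L[unfolded L_eq]] and pS = has_portD[OF S[unfolded S_eq]]
  have flip: "c {u, v} = c {v, u}" "c {u, xL} = a" "c {v, xS} = b"
    using pL(4) pS(4) by (simp_all add: insert_commute)
  have colors: "a \<in> {1..5}" "b \<in> {1..5}"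
    using star_on_color[OF V pL(1,3)] star_on_color[OF V pS(1,3)] pL(4) pS(4) by simp_all
  have okL: "attach_ok (a, B, F) b (c {u, v}) (c {u, u'}) (c {v, v'})"
    and okS: "attach_ok (b, B', F') a (c {v, u}) (c {v, v'}) (c {u, u'})"
    using ok L_eq S_eq flip by simp_all
  note ok' = okL[simplified] okS[simplified]
  have ne: "xL \<noteq> u" "xL \<noteq> v" "xS \<noteq> v" "xS \<noteq> u"
    using pL(1,2) pS(1,2) by blast+
  have at_u: "c {u, z} \<in> {a, c {u, u'}}" if "{u, z} \<in> E" "z \<noteq> v" for z
  proof -
    have "z = xL \<or> z = u'" using N(1)[of z] that by simp
    then show ?thesis using flip by auto
  qed
  have at_v: "c {v, z} \<in> {b, c {v, v'}}" if "{v, z} \<in> E" "z \<noteq> u" for z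
  proof -
    have "z = xS \<or> z = v'" using N(2)[of z] that by simp
    then show ?thesis using flip by auto
  qed
  have uv: "{u, v} = {v, u}" by blast
  note sideL = attach_one_side[OF L[unfolded L_eq] N(1) out(1,3,5) at_v okL]
  note sideS = attach_one_side[OF S[unfolded S_eq] N(2) out(2,4,6) at_u okS]
  have W: "star_on 5 E c {v, u}"
    unfolding star_on_def
  proof (intro conjI ballI allI impI)
    fix x y
    assume "x \<in> {v, u}" and E: "{x, y} \<in> E"
    then consider "x = u" | "x = v" by blast
    then show "c {x, y} \<in> {1..5}"
    proof cases
      case 1
      show ?thesis
        by (rule color_at[OF N(1) _ E[unfolded 1], folded 1]) (use 1 ok' colors flip in simp)
    next
      case 2
      show ?thesis
        by (rule color_at[OF N(2) _ E[unfolded 2], folded 2]) (use 2 ok' colors flip in simp)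
    qed
  next
    fix x y z
    assume "x \<in> {v, u}" and E: "{x, y} \<in> E" "{x, z} \<in> E" "y \<noteq> z"
    then consider "x = u" | "x = v" by blast
    then show "c {x, y} \<noteq> c {x, z}"
    proof cases
      case 1
      show ?thesis
        by (rule proper_at[OF N(1) _ E[unfolded 1], folded 1]) (use 1 ok' flip in auto)
    next
      case 2
      show ?thesis
        by (rule proper_at[OF N(2) _ E[unfolded 2], folded 2]) (use 2 ok' flip in auto)
    qed
  next
    fix p0 p1 p2 p3 p4
    assume p: "p1 \<in> {v, u}" "p2 \<in> {v, u}" "p3 \<in> {v, u}" and E: "{p1, p2} \<in> E" "{p2, p3} \<in> E"
      and "p1 \<noteq> p3"
    have "{v, v} \<notin> E" "{u, u} \<notin> E"
      using N(1)[of u] N(2)[of v] ne out by simp_all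
    then show "\<not> (c {p0, p1} = c {p2, p3} \<and> c {p1, p2} = c {p3, p4})"
      using p E \<open>p1 \<noteq> p3\<close> by auto
  qed
  show "star_on 5 E c (V \<union> {v, u})"
  proof (rule star_on_Un[OF V W])
    fix x y
    assume xy: "x \<in> V" "y \<in> {v, u}" "{x, y} \<in> E"
    then consider "y = v" "x = xS" | "y = u" "x = xL"
      using N(1)[of x] N(2)[of x] out pL(2) pS(2) by (auto simp: insert_commute)
    then show "\<exists>a B F. has_port E c V x y (a, B, F) \<and>
      (\<forall>z. {y, z} \<in> E \<longrightarrow> z \<noteq> x \<longrightarrow> c {y, z} \<in> B \<longrightarrow> c {y, z} \<notin> F \<and>
        (z \<in> V \<union> {v, u} \<longrightarrow> (\<forall>w. {z, w} \<in> E \<longrightarrow> w \<noteq> y \<longrightarrow> c {z, w} \<noteq> a)))"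
    proof cases
      case 1
      show ?thesis unfolding 1
        using S[unfolded S_eq] sideS(1) by blast
    next
      case 2
      show ?thesis unfolding 2
        using L[unfolded L_eq] sideL(1) unfolding uv by blast
    qed
  qed
  show "has_port E c (V \<union> {v, u}) u u' (next_port L (fst S) (c {v, u}) (c {u, u'}) (c {v, v'}))"
    using sideL(2) unfolding uv L_eq S_eq by simp
  show "has_port E c (V \<union> {v, u}) v v' (next_port S (fst L) (c {v, u}) (c {v, v'}) (c {u, u'}))"
    using sideS(2) unfolding L_eq S_eq by simp
qed

text \<open>The edges that get a color are not incident with \<open>V\<close>, so recoloring them keeps everything that is
  known about \<open>V\<close>.\<close>
lemma attach:
  assumes V: "star_on 5 E c V"
    and L: "has_port E c V xL u L" and S: "has_port E c V xS v S" and R: "has_port E c V xR yR R"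
    and N: "\<And>z. {u, z} \<in> E \<longleftrightarrow> z \<in> {xL, v, u'}" "\<And>z. {v, z} \<in> E \<longleftrightarrow> z \<in> {xS, u, v'}"
    and out: "u' \<notin> V" "v' \<notin> V" "u' \<noteq> u" "v' \<noteq> v" "u' \<noteq> v" "v' \<noteq> u" "u \<noteq> v" "yR \<noteq> u" "yR \<noteq> v"
    and ok: "step_ok L S e l s"
  obtains c' where "star_on 5 E c' (V \<union> {v, u})"
    "has_port E c' (V \<union> {v, u}) u u' (next_port L (fst S) e l s)"
    "has_port E c' (V \<union> {v, u}) v v' (next_port S (fst L) e s l)"
    "has_port E c' (V \<union> {v, u}) xR yR R"
proof -
  define c' where "c' = c({v, u} := e, {u, u'} := l, {v, v'} := s)"
  have notin: "u \<notin> V" "v \<notin> V" "yR \<notin> V"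
    using L S R unfolding has_port_def by blast+
  have new: "c' {v, u} = e" "c' {u, u'} = l" "c' {v, v'} = s"
    using out by (auto simp: c'_def doubleton_eq_iff)
  have old: "c' {x, y} = c {x, y}" if "x \<in> V" for x y
    using that notin out by (auto simp: c'_def doubleton_eq_iff)
  have V': "star_on 5 E c' V"
    by (rule star_on_cong[OF V]) (use old in simp)
  have L': "has_port E c' V xL u L" and S': "has_port E c' V xS v S" and R': "has_port E c' V xR yR R"
    using L S R by (auto intro: has_port_cong simp: old)
  have ok': "step_ok L S (c' {v, u}) (c' {u, u'}) (c' {v, v'})"
    using ok new by simp
  have "has_port E c' (V \<union> {v, u}) xR yR R"
    by (rule has_port_mono[OF R']) (use notin out in auto)
  then show ?thesis
    using that attach_star_on[OF V' L' S' N out(1-7) ok'] new by simp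
qed

text \<open>A walk through all corners of a triangle that does not enter or leave by the pendant edges would
  return to a corner, and properness at that corner prevents the alternation.\<close>
lemma triangle_walk:
  assumes N: "\<And>z. {x, z} \<in> E \<Longrightarrow> z = x' \<or> z = y \<or> z = w" "\<And>z. {w, z} \<in> E \<Longrightarrow> z = w' \<or> z = x \<or> z = y"
    and E: "{p, x} \<in> E" "p \<noteq> y" "{w, q} \<in> E" "q \<noteq> y"
    and c: "c {x, w} \<noteq> c {y, w}" "c {x, w} \<noteq> c {x, y}" "\<not> (c {x, x'} = c {y, w} \<and> c {x, y} = c {w, w'})"
  shows "\<not> (c {p, x} = c {y, w} \<and> c {x, y} = c {w, q})"
proof -
  have "p = x' \<or> p = w"
    using N(1)[of p] E(1,2) by (simp add: insert_commute)
  moreover have "q = w' \<or> q = x"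
    using N(2)[of q] E(3,4) by simp
  ultimately show ?thesis
    using c by (metis insert_commute)
qed

lemma star_on_triangle:
  assumes N: "\<And>z. {x, z} \<in> E \<longleftrightarrow> z \<in> {x', y, w}" "\<And>z. {y, z} \<in> E \<longleftrightarrow> z \<in> {y', x, w}"
      "\<And>z. {w, z} \<in> E \<longleftrightarrow> z \<in> {w', x, y}"
    and ne: "x \<noteq> y" "x \<noteq> w" "y \<noteq> w" "{x', y', w'} \<inter> {x, y, w} = {}"
    and c: "c {x, x'} = a" "c {y, y'} = b" "c {w, w'} = d" "c {x, y} = p" "c {y, w} = q" "c {x, w} = r"
    and cols: "{a, b, d, p, q, r} \<subseteq> {1..k}" "distinct [a, p, r]" "distinct [b, p, q]" "distinct [d, q, r]"
    and alt: "\<not> (a = q \<and> p = d)" "\<not> (b = r \<and> p = d)" "\<not> (a = q \<and> r = b)"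
  shows "star_on k E c {x, y, w}"
proof -
  have c': "c {x', x} = a" "c {y', y} = b" "c {w', w} = d" "c {y, x} = p" "c {w, y} = q" "c {w, x} = r"
    using c by (simp_all add: insert_commute)
  have ne': "y \<noteq> x" "w \<noteq> x" "w \<noteq> y" "x' \<noteq> x" "x' \<noteq> y" "x' \<noteq> w" "y' \<noteq> x" "y' \<noteq> y" "y' \<noteq> w"
    "w' \<noteq> x" "w' \<noteq> y" "w' \<noteq> w"
    using ne by auto
  have Nx: "z = x' \<or> z = y \<or> z = w" "z = x' \<or> z = w \<or> z = y" if "{x, z} \<in> E" for z
    using N(1)[of z] that by auto
  have Ny: "z = y' \<or> z = x \<or> z = w" "z = y' \<or> z = w \<or> z = x" if "{y, z} \<in> E" for z
    using N(2)[of z] that by auto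
  have Nw: "z = w' \<or> z = x \<or> z = y" "z = w' \<or> z = y \<or> z = x" if "{w, z} \<in> E" for z
    using N(3)[of z] that by auto
  have walk_xyw: "\<not> (c {s, x} = c {y, w} \<and> c {x, y} = c {w, t})"
    if "{s, x} \<in> E" "s \<noteq> y" "{w, t} \<in> E" "t \<noteq> y" for s t
    by (rule triangle_walk[OF Nx(1) Nw(1) that]) (simp_all only: c c', use cols(2-) alt in auto)
  have walk_xwy: "\<not> (c {s, x} = c {w, y} \<and> c {x, w} = c {y, t})"
    if "{s, x} \<in> E" "s \<noteq> w" "{y, t} \<in> E" "t \<noteq> w" for s t
    by (rule triangle_walk[OF Nx(2) Ny(1) that]) (simp_all only: c c', use cols(2-) alt in auto)
  have walk_yxw: "\<not> (c {s, y} = c {x, w} \<and> c {y, x} = c {w, t})"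
    if "{s, y} \<in> E" "s \<noteq> x" "{w, t} \<in> E" "t \<noteq> x" for s t
    by (rule triangle_walk[OF Ny(1) Nw(2) that]) (simp_all only: c c', use cols(2-) alt in auto)
  have walk_ywx: "\<not> (c {s, y} = c {w, x} \<and> c {y, w} = c {x, t})"
    if "{s, y} \<in> E" "s \<noteq> w" "{x, t} \<in> E" "t \<noteq> w" for s t
    by (rule triangle_walk[OF Ny(2) Nx(1) that]) (simp_all only: c c', use cols(2-) alt in auto)
  have walk_wxy: "\<not> (c {s, w} = c {x, y} \<and> c {w, x} = c {y, t})"
    if "{s, w} \<in> E" "s \<noteq> x" "{y, t} \<in> E" "t \<noteq> x" for s t
    by (rule triangle_walk[OF Nw(1) Ny(2) that]) (simp_all only: c c', use cols(2-) alt in auto)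
  have walk_wyx: "\<not> (c {s, w} = c {y, x} \<and> c {w, y} = c {x, t})"
    if "{s, w} \<in> E" "s \<noteq> y" "{x, t} \<in> E" "t \<noteq> y" for s t
    by (rule triangle_walk[OF Nw(2) Nx(2) that]) (simp_all only: c c', use cols(2-) alt in auto)
  show ?thesis
    unfolding star_on_def
  proof (intro conjI ballI allI impI)
    fix s t
    assume s: "s \<in> {x, y, w}" and t: "{s, t} \<in> E"
    have "c {x, t} \<in> {1..k}" if "{x, t} \<in> E"
      by (rule color_at[OF N(1) _ that]) (use cols(1) c in simp)
    moreover have "c {y, t} \<in> {1..k}" if "{y, t} \<in> E"
      by (rule color_at[OF N(2) _ that]) (use cols(1) c c' in simp)
    moreover have "c {w, t} \<in> {1..k}" if "{w, t} \<in> E"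
      by (rule color_at[OF N(3) _ that]) (use cols(1) c c' in simp)
    ultimately show "c {s, t} \<in> {1..k}" using s t by blast
  next
    fix s t u
    assume s: "s \<in> {x, y, w}" and t: "{s, t} \<in> E" "{s, u} \<in> E" "t \<noteq> u"
    have "c {x, t} \<noteq> c {x, u}" if "{x, t} \<in> E" "{x, u} \<in> E"
      by (rule proper_at[OF N(1) _ that t(3)]) (use cols(2) c in auto)
    moreover have "c {y, t} \<noteq> c {y, u}" if "{y, t} \<in> E" "{y, u} \<in> E"
      by (rule proper_at[OF N(2) _ that t(3)]) (use cols(3) c c' in auto)
    moreover have "c {w, t} \<noteq> c {w, u}" if "{w, t} \<in> E" "{w, u} \<in> E"
      by (rule proper_at[OF N(3) _ that t(3)]) (use cols(4) c c' in auto)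
    ultimately show "c {s, t} \<noteq> c {s, u}" using s t by blast
  next
    fix p0 p1 p2 p3 p4
    assume P: "p1 \<in> {x, y, w}" "p2 \<in> {x, y, w}" "p3 \<in> {x, y, w}"
      and E: "{p0, p1} \<in> E" "{p1, p2} \<in> E" "{p2, p3} \<in> E" "{p3, p4} \<in> E"
      and d: "p0 \<noteq> p2" "p1 \<noteq> p3" "p2 \<noteq> p4"
    have no_loop: "{x, x} \<notin> E" "{y, y} \<notin> E" "{w, w} \<notin> E"
      using N(1)[of x] N(2)[of y] N(3)[of w] ne' by simp_all
    consider "p1 = x" "p2 = y" "p3 = w" | "p1 = x" "p2 = w" "p3 = y" | "p1 = y" "p2 = x" "p3 = w"
      | "p1 = y" "p2 = w" "p3 = x" | "p1 = w" "p2 = x" "p3 = y" | "p1 = w" "p2 = y" "p3 = x"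
      using P d(2) no_loop E(2,3) by blast
    then show "\<not> (c {p0, p1} = c {p2, p3} \<and> c {p1, p2} = c {p3, p4})"
    proof cases
      case 1
      show ?thesis
        using walk_xyw[of p0 p4] E d unfolding 1 by blast
    next
      case 2
      show ?thesis
        using walk_xwy[of p0 p4] E d unfolding 2 by blast
    next
      case 3
      show ?thesis
        using walk_yxw[of p0 p4] E d unfolding 3 by blast
    next
      case 4
      show ?thesis
        using walk_ywx[of p0 p4] E d unfolding 4 by blast
    next
      case 5
      show ?thesis
        using walk_wxy[of p0 p4] E d unfolding 5 by blast
    next
      case 6
      show ?thesis
        using walk_wyx[of p0 p4] E d unfolding 6 by blast
    qed
  qed
qed

text \<open>The condition of the gluing lemma at one corner of the final triangle.\<close>
lemma cap_one_corner:
  assumes P: "has_port E c V x y (a, B, F)"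
    and N: "\<And>z. {y, z} \<in> E \<longleftrightarrow> z \<in> {x, w, t}"
      "\<And>z. {w, z} \<in> E \<longleftrightarrow> z \<in> {x1, y, t}" "\<And>z. {t, z} \<in> E \<longleftrightarrow> z \<in> {x2, y, w}"
    and c: "c {w, x1} = a1" "c {t, x2} = a2" "c {y, w} = e1" "c {y, t} = e2" "c {w, t} = e3"
    and ok: "cap_ok (a, B, F) e1 a1 e2 a2 e3"
    and z: "{y, z} \<in> E" "z \<noteq> x" "c {y, z} \<in> B"
  shows "c {y, z} \<notin> F \<and> (z \<in> S \<longrightarrow> (\<forall>s. {z, s} \<in> E \<longrightarrow> s \<noteq> y \<longrightarrow> c {z, s} \<noteq> a))"
proof -
  note ok' = ok[simplified]
  have tw: "c {t, w} = e3" using c(5) by (simp add: insert_commute)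
  have "z = w \<or> z = t" using N(1)[of z] z(1,2) by simp
  then show ?thesis
  proof
    assume zw: "z = w"
    have "c {w, s} \<noteq> a" if "{w, s} \<in> E" "s \<noteq> y" for s
    proof -
      have "s = x1 \<or> s = t" using N(2)[of s] that by simp
      then show ?thesis using ok' z(3) c unfolding zw by auto
    qed
    then show ?thesis using ok' z(3) c(3) unfolding zw by simp
  next
    assume zt: "z = t"
    have "c {t, s} \<noteq> a" if "{t, s} \<in> E" "s \<noteq> y" for s
    proof -
      have "s = x2 \<or> s = w" using N(3)[of s] that by simp
      then show ?thesis using ok' z(3) c tw unfolding zt by auto
    qed
    then show ?thesis using ok' z(3) c(4) unfolding zt by simp
  qed
qed

lemma close_up:
  assumes V: "star_on 5 E c V"
    and L: "has_port E c V xL l L" and S: "has_port E c V xS s S" and R: "has_port E c V xR r R"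
    and N: "\<And>z. {l, z} \<in> E \<longleftrightarrow> z \<in> {xL, s, r}" "\<And>z. {s, z} \<in> E \<longleftrightarrow> z \<in> {xS, l, r}"
      "\<And>z. {r, z} \<in> E \<longleftrightarrow> z \<in> {xR, l, s}"
    and ne: "l \<noteq> s" "l \<noteq> r" "s \<noteq> r"
    and ok: "close_ok L S R e1 e2 e3"
  obtains c' where "star_on 5 E c' (V \<union> {l, s, r})"
proof -
  define c' where "c' = c({l, s} := e1, {s, r} := e2, {l, r} := e3)"
  have notin: "l \<notin> V" "s \<notin> V" "r \<notin> V"
    using L S R unfolding has_port_def by blast+
  have new: "c' {l, s} = e1" "c' {s, r} = e2" "c' {l, r} = e3"
    using ne by (auto simp: c'_def doubleton_eq_iff)
  have new': "c' {s, l} = e1" "c' {r, s} = e2" "c' {r, l} = e3"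
    using new by (simp_all add: insert_commute)
  have old: "c' {x, y} = c {x, y}" if "x \<in> V" for x y
    using that notin by (auto simp: c'_def doubleton_eq_iff)
  have V': "star_on 5 E c' V"
    by (rule star_on_cong[OF V]) (use old in simp)
  have L': "has_port E c' V xL l L" and S': "has_port E c' V xS s S" and R': "has_port E c' V xR r R"
    using L S R by (auto intro: has_port_cong simp: old)
  obtain a B F where L_eq: "L = (a, B, F)" by (cases L)
  obtain b B' F' where S_eq: "S = (b, B', F')" by (cases S)
  obtain d B'' F'' where R_eq: "R = (d, B'', F'')" by (cases R)
  note pL = has_portD[OF L'[unfolded L_eq]] and pS = has_portD[OF S'[unfolded S_eq]]
    and pR = has_portD[OF R'[unfolded R_eq]]
  have ports: "c' {l, xL} = a" "c' {s, xS} = b" "c' {r, xR} = d"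
    using pL(4) pS(4) pR(4) by (simp_all add: insert_commute)
  have cols: "a \<in> {1..5}" "b \<in> {1..5}" "d \<in> {1..5}"
    using star_on_color[OF V' pL(1,3)] star_on_color[OF V' pS(1,3)] star_on_color[OF V' pR(1,3)]
      pL(4) pS(4) pR(4) by simp_all
  have okL: "cap_ok (a, B, F) e1 b e3 d e2" and okS: "cap_ok (b, B', F') e1 a e2 d e3"
    and okR: "cap_ok (d, B'', F'') e3 a e2 b e1"
    using ok L_eq S_eq R_eq by auto
  note ok' = okL[simplified] okS[simplified] okR[simplified]
  have N3: "\<And>z. {r, z} \<in> E \<longleftrightarrow> z \<in> {xR, l, s}" "\<And>z. {l, z} \<in> E \<longleftrightarrow> z \<in> {xL, r, s}"
    "\<And>z. {s, z} \<in> E \<longleftrightarrow> z \<in> {xS, r, l}" "\<And>z. {r, z} \<in> E \<longleftrightarrow> z \<in> {xR, s, l}"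
    using N by auto
  have W: "star_on 5 E c' {l, s, r}"
  proof (rule star_on_triangle[OF N _ _ _ _ ports new(1,2,3)])
    show "{xL, xS, xR} \<inter> {l, s, r} = {}"
      using pL(1) pS(1) pR(1) notin by auto
    show "{a, b, d, e1, e2, e3} \<subseteq> {1..5}" using cols ok' by simp
  qed (use ne ok' in auto)
  have "star_on 5 E c' (V \<union> {l, s, r})"
  proof (rule star_on_Un[OF V' W])
    fix x y
    assume xy: "x \<in> V" "y \<in> {l, s, r}" "{x, y} \<in> E"
    then consider "y = l" "x = xL" | "y = s" "x = xS" | "y = r" "x = xR"
      using N(1)[of x] N(2)[of x] N(3)[of x] notin by (auto simp: insert_commute)
    then show "\<exists>a B F. has_port E c' V x y (a, B, F) \<and>
      (\<forall>z. {y, z} \<in> E \<longrightarrow> z \<noteq> x \<longrightarrow> c' {y, z} \<in> B \<longrightarrow> c' {y, z} \<notin> F \<and>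
        (z \<in> V \<union> {l, s, r} \<longrightarrow> (\<forall>w. {z, w} \<in> E \<longrightarrow> w \<noteq> y \<longrightarrow> c' {z, w} \<noteq> a)))"
    proof cases
      case 1
      show ?thesis unfolding 1
        by (rule exI, rule exI, rule exI, rule conjI, rule L'[unfolded L_eq], intro allI impI,
          rule cap_one_corner[OF L'[unfolded L_eq] N ports(2,3) new(1,3,2) okL]) assumption+
    next
      case 2
      show ?thesis unfolding 2
        by (rule exI, rule exI, rule exI, rule conjI, rule S'[unfolded S_eq], intro allI impI,
          rule cap_one_corner[OF S'[unfolded S_eq] N(2,1) N3(4) ports(1,3) new'(1) new(2,3) okS]) assumption+
    next
      case 3
      show ?thesis unfolding 3
        by (rule exI, rule exI, rule exI, rule conjI, rule R'[unfolded R_eq], intro allI impI,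
          rule cap_one_corner[OF R'[unfolded R_eq] N3(1-3) ports(1,2) new'(3,2) new(1) okR]) assumption+
    qed
  qed
  then show ?thesis using that by blast
qed

text \<open>The two pendant edges at \<open>l\<close> and \<open>s\<close> share a color, which realizes the state \<open>row5\<close> with the colors
  numbered in order.\<close>
lemma start_triangle:
  assumes N: "\<And>z. {l, z} \<in> E \<longleftrightarrow> z \<in> {yL, s, r}" "\<And>z. {s, z} \<in> E \<longleftrightarrow> z \<in> {yS, l, r}"
      "\<And>z. {r, z} \<in> E \<longleftrightarrow> z \<in> {yR, l, s}"
    and ne: "l \<noteq> s" "l \<noteq> r" "s \<noteq> r" "{yL, yS, yR} \<inter> {l, s, r} = {}"
  obtains c L S R where "star_on 5 E c {l, s, r}" "ready L S R"
    "has_port E c {l, s, r} l yL L" "has_port E c {l, s, r} s yS S" "has_port E c {l, s, r} r yR R"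
proof -
  define c :: "'a set \<Rightarrow> nat" where
    "c = (\<lambda>_. 1)({r, yR} := 5, {l, s} := 2, {l, r} := 3, {s, r} := 4)"
  have ne': "yL \<noteq> l" "yL \<noteq> s" "yL \<noteq> r" "yS \<noteq> l" "yS \<noteq> s" "yS \<noteq> r" "yR \<noteq> l" "yR \<noteq> s" "yR \<noteq> r"
    "s \<noteq> l" "r \<noteq> l" "r \<noteq> s"
    using ne by auto
  have c: "c {l, yL} = 1" "c {s, yS} = 1" "c {r, yR} = 5" "c {l, s} = 2" "c {s, r} = 4" "c {l, r} = 3"
    using ne ne' by (auto simp: c_def doubleton_eq_iff)
  have c': "c {yL, l} = 1" "c {yS, s} = 1" "c {yR, r} = 5" "c {s, l} = 2" "c {r, s} = 4" "c {r, l} = 3"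
    using c by (simp_all add: insert_commute)
  have star: "star_on 5 E c {l, s, r}"
    by (rule star_on_triangle[OF N ne c]) auto
  have nl: "z = yL \<or> z = s \<or> z = r" if "{l, z} \<in> E" for z using N(1)[of z] that by simp
  have ns: "z = yS \<or> z = l \<or> z = r" if "{s, z} \<in> E" for z using N(2)[of z] that by simp
  have nr: "z = yR \<or> z = l \<or> z = s" if "{r, z} \<in> E" for z using N(3)[of z] that by simp
  have E: "{l, yL} \<in> E" "{s, yS} \<in> E" "{r, yR} \<in> E"
    using N(1)[of yL] N(2)[of yS] N(3)[of yR] by simp_all
  have "has_port E c {l, s, r} l yL (1, {2, 3}, {2, 3})"
    unfolding has_port_def prod.case
    by (intro conjI allI impI) (use E c c' ne' in \<open>auto dest!: nl\<close>)
  moreover have "has_port E c {l, s, r} s yS (1, {2, 4}, {2, 4})"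
    unfolding has_port_def prod.case
    by (intro conjI allI impI) (use E c c' ne' in \<open>auto dest!: ns\<close>)
  moreover have "has_port E c {l, s, r} r yR (5, {3, 4}, {})"
    unfolding has_port_def prod.case
  proof (intro conjI allI impI)
    fix z w
    assume z: "{r, z} \<in> E" "z \<noteq> yR" and w: "{z, w} \<in> E" "w \<noteq> r" "c {z, w} = 5"
    have "z = l \<or> z = s" using nr[OF z(1)] z(2) by simp
    then show "c {r, z} \<in> {}"
      using w nl[of w] ns[of w] c c' by auto
  qed (use E c c' ne' in \<open>auto dest!: nr\<close>)
  moreover have "ready (1, {2, 3}, {2, 3}) (1, {2, 4}, {2, 4}) (5, {3, 4}, {})"
    by (rule ready.row5) (simp add: five_colors_def)
  ultimately show ?thesis using that star by blast
qed

section \<open>Arcs of a cycle\<close>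

lemma rotate_to_head:
  assumes "x \<in> set q"
  obtains k r where "rotate k q = x # r"
proof -
  obtain A B where "q = A @ x # B" using split_list[OF assms] by blast
  then have "rotate (length A) q = x # (B @ A)" by (simp add: rotate_append)
  then show ?thesis using that by blast
qed

lemma cycle_neighbors:
  assumes C: "C = cycle_graph q" "distinct q" "3 \<le> length q" and x: "x \<in> set q"
  obtains y w where "y \<noteq> w" "y \<noteq> x" "w \<noteq> x" "\<forall>z. {x, z} \<in> edges C \<longleftrightarrow> z = y \<or> z = w"
proof -
  obtain k r where r: "rotate k q = x # r" using rotate_to_head[OF x] .
  then have "distinct (x # r)" "length (x # r) = length q" and C_r: "C = cycle_graph (x # r)"
    using C by (metis distinct_rotate, metis length_rotate, metis cycle_graph_rotate)
  then have len: "2 \<le> length r" using C(3) by simp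
  then obtain y s where s: "r = y # s" by (cases r) auto
  then have "s \<noteq> []" using len by auto
  then obtain P w where "s = P @ [w]" by (cases s rule: rev_cases) auto
  then have P: "r = y # P @ [w]" using s by simp
  have "edges C = insert {x, y} (walk_edges (y # P @ [w]) \<union> walk_edges [w, x])"
    using walk_edges_append[of "y # P" w "[x]"] by (simp add: C_r P cycle_graph_def)
  moreover have "{x, z} \<notin> walk_edges (y # P @ [w])" for z
    using Union_walk_edges[of "y # P @ [w]"] \<open>distinct (x # r)\<close> P by auto
  ultimately have "{x, z} \<in> edges C \<longleftrightarrow> z = y \<or> z = w" for z
    by (auto simp: doubleton_eq_iff)
  moreover have "y \<noteq> w" "y \<noteq> x" "w \<noteq> x"
    using \<open>distinct (x # r)\<close> P by auto
  ultimately show ?thesis using that by blast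
qed

lemma boundary_rotation:
  assumes "x \<in> set q" "x \<in> X" "y \<in> set q" "y \<notin> X"
  obtains k q' where "rotate k q = q'" "q' \<noteq> []" "hd q' \<in> X" "last q' \<notin> X"
proof -
  obtain k r where r: "rotate k q = y # r" using rotate_to_head[OF assms(3)] .
  define s where "s = takeWhile (\<lambda>z. z \<notin> X) (y # r)"
  define t where "t = dropWhile (\<lambda>z. z \<notin> X) (y # r)"
  have st: "y # r = s @ t" by (simp add: s_def t_def)
  have "x \<in> set (y # r)" using assms(1) r by (metis set_rotate)
  then have "t \<noteq> []" using assms(2) unfolding t_def by (metis dropWhile_eq_Nil_conv)
  then have "hd t \<in> X" unfolding t_def using hd_dropWhile by blast
  have "s \<noteq> []" using assms(4) by (simp add: s_def)
  then have "last s \<notin> X" unfolding s_def by (metis last_in_set set_takeWhileD)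
  have "rotate (length s + k) q = t @ s"
    using r st by (metis rotate_append rotate_rotate)
  then show ?thesis
    using that[of "length s + k" "t @ s"] \<open>t \<noteq> []\<close> \<open>s \<noteq> []\<close> \<open>hd t \<in> X\<close> \<open>last s \<notin> X\<close> by simp
qed

definition interlaced :: "'a sgraph \<Rightarrow> 'a \<Rightarrow> 'a \<Rightarrow> 'a \<Rightarrow> 'a \<Rightarrow> bool" where
  "interlaced C a b x y \<longleftrightarrow> (\<exists>P Q. C = cycle_graph (a # P @ b # Q) \<and> distinct (a # P @ b # Q) \<and>
     x \<in> set P \<and> y \<in> set Q)"

text \<open>Rotate the cycle so that it starts in \<open>X\<close> and ends outside of \<open>X\<close>. A vertex of \<open>X\<close> behind the first vertex
  outside of \<open>X\<close> would give an interlacing quadruple with the first and the last vertex.\<close>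
lemma arc_if_not_interlaced:
  assumes C: "C = cycle_graph q" "distinct q"
    and X: "x \<in> set q" "x \<in> X" "y \<in> set q" "y \<notin> X"
    and nc: "\<And>a b x y. interlaced C a b x y \<Longrightarrow> a \<in> X \<Longrightarrow> b \<in> X \<Longrightarrow> x \<notin> X \<Longrightarrow> y \<notin> X \<Longrightarrow> False"
  obtains P Q where "C = cycle_graph (P @ Q)" "distinct (P @ Q)" "set P = set q \<inter> X" "set Q = set q - X"
proof -
  obtain k q' where q': "rotate k q = q'" "q' \<noteq> []" "hd q' \<in> X" "last q' \<notin> X"
    using boundary_rotation[OF X] .
  have C': "C = cycle_graph q'" "distinct q'" "set q' = set q"
    using C q'(1) by (metis cycle_graph_rotate, metis distinct_rotate, metis set_rotate)
  define P where "P = takeWhile (\<lambda>z. z \<in> X) q'"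
  define Q where "Q = dropWhile (\<lambda>z. z \<in> X) q'"
  have PQ: "q' = P @ Q" by (simp add: P_def Q_def)
  have PX: "set P \<subseteq> X" unfolding P_def by (auto dest: set_takeWhileD)
  have QX: "set Q \<inter> X = {}"
  proof (rule ccontr)
    assume "set Q \<inter> X \<noteq> {}"
    then obtain b where b: "b \<in> set Q" "b \<in> X" by blast
    have "P \<noteq> []" using q'(2,3) unfolding P_def by (cases q') auto
    then obtain P' where P': "P = hd P # P'" by (metis list.collapse)
    have "Q \<noteq> []" using b by auto
    then have "hd Q \<notin> X" unfolding Q_def using hd_dropWhile by blast
    then have "b \<noteq> hd Q" using b by blast
    then obtain Q1 Q2 where Q: "Q = hd Q # Q1 @ b # Q2"
      using split_list[OF b(1)] \<open>Q \<noteq> []\<close> by (metis append_eq_Cons_conv list.sel(1) list.collapse)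
    have "last q' = last (b # Q2)" using PQ Q by (metis last_append last_ConsR append_is_Nil_conv list.distinct(1))
    then have "Q2 \<noteq> []" "last Q2 \<notin> X" using q'(4) b(2) by (auto split: if_splits)
    have "q' = hd P # (P' @ hd Q # Q1) @ b # Q2"
      using PQ P' Q by (metis append.assoc append_Cons)
    then have "interlaced C (hd P) b (hd Q) (last Q2)"
      unfolding interlaced_def using C' \<open>Q2 \<noteq> []\<close>
      by (intro exI[of _ "P' @ hd Q # Q1"] exI[of _ Q2]) auto
    moreover have "hd P \<in> X" using PX \<open>P \<noteq> []\<close> by auto
    ultimately show False using nc b(2) \<open>hd Q \<notin> X\<close> \<open>last Q2 \<notin> X\<close> by blast
  qed
  have "set P = set q \<inter> X" "set Q = set q - X"
    using PX QX C'(3) PQ by auto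
  then show ?thesis using that C' PQ by blast
qed

lemma cut_of_arc:
  assumes C: "C = cycle_graph (P @ Q)" "distinct (P @ Q)" and ne: "P \<noteq> []" "Q \<noteq> []"
    and xy: "x \<in> set P" "y \<in> set Q"
  shows "{x, y} \<in> edges C \<longleftrightarrow> x = last P \<and> y = hd Q \<or> x = hd P \<and> y = last Q"
proof -
  obtain A u where P: "P = A @ [u]" using ne(1) by (cases P rule: rev_cases) auto
  obtain B w where Q: "Q = B @ [w]" using ne(2) by (cases Q rule: rev_cases) auto
  have "edges C = walk_edges (A @ u # Q @ [hd P])"
    by (simp add: C cycle_graph_def P) (metis hd_append append_Nil list.sel(1))
  also have "\<dots> = walk_edges P \<union> walk_edges (u # Q @ [hd P])"
    unfolding P by (rule walk_edges_append)
  also have "walk_edges (u # Q @ [hd P]) = walk_edges (u # Q) \<union> {{w, hd P}}"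
    using walk_edges_append[of "u # B" w "[hd P]"] by (simp add: Q)
  also have "walk_edges (u # Q) = insert {u, hd Q} (walk_edges Q)"
    using ne(2) by (cases Q) auto
  finally have E: "edges C = walk_edges P \<union> (insert {last P, hd Q} (walk_edges Q) \<union> {{last Q, hd P}})"
    by (simp add: P Q)
  have "{x, y} \<notin> walk_edges P" "{x, y} \<notin> walk_edges Q"
    using Union_walk_edges[of P] Union_walk_edges[of Q] C(2) xy by auto
  moreover have "x \<noteq> hd Q" "x \<noteq> last Q" "y \<noteq> hd P" "y \<noteq> last P"
    using C(2) xy hd_in_set[OF ne(1)] last_in_set[OF ne(1)] hd_in_set[OF ne(2)] last_in_set[OF ne(2)]
    by auto
  ultimately show ?thesis
    unfolding E by (auto simp: doubleton_eq_iff)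
qed

section \<open>Cubic Halin graphs of caterpillars\<close>

lemma card_neighbors:
  assumes "fin_simple_graph G"
  shows "card {z. {v, z} \<in> edges G} = vdegree G v"
proof -
  have "{e \<in> edges G. v \<in> e} = (\<lambda>z. {v, z}) ` {z. {v, z} \<in> edges G}"
  proof (intro equalityI subsetI)
    fix e
    assume e: "e \<in> {e \<in> edges G. v \<in> e}"
    then have "card e = 2" using assms unfolding fin_simple_graph_def by blast
    then obtain a b where "e = {a, b}" by (metis card_2_iff)
    then show "e \<in> (\<lambda>z. {v, z}) ` {z. {v, z} \<in> edges G}"
      using e by (auto simp: insert_commute)
  qed auto
  moreover have "inj_on (\<lambda>z. {v, z}) {z. {v, z} \<in> edges G}"
    by (auto simp: inj_on_def doubleton_eq_iff)
  ultimately show ?thesis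
    unfolding vdegree_def by (simp add: card_image)
qed

lemma neighbors_in_walk_edges:
  assumes "distinct p" "i < length p"
  shows "{p ! i, z} \<in> walk_edges p \<longleftrightarrow> (Suc i < length p \<and> z = p ! Suc i) \<or> (0 < i \<and> z = p ! (i - 1))"
proof
  assume "{p ! i, z} \<in> walk_edges p"
  then obtain j where j: "Suc j < length p" "{p ! i, z} = {p ! j, p ! Suc j}"
    unfolding walk_edges_def by blast
  then consider "p ! i = p ! j" "z = p ! Suc j" | "p ! i = p ! Suc j" "z = p ! j"
    by (auto simp: doubleton_eq_iff)
  then show "(Suc i < length p \<and> z = p ! Suc i) \<or> (0 < i \<and> z = p ! (i - 1))"
    by cases (use assms j(1) nth_eq_iff_index_eq[OF assms(1)] in fastforce)+
next
  assume "(Suc i < length p \<and> z = p ! Suc i) \<or> (0 < i \<and> z = p ! (i - 1))"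
  then show "{p ! i, z} \<in> walk_edges p"
  proof
    assume "0 < i \<and> z = p ! (i - 1)"
    then have "{p ! i, z} = {p ! (i - 1), p ! Suc (i - 1)}" "Suc (i - 1) < length p"
      using assms(2) by auto
    then show ?thesis unfolding walk_edges_def by blast
  qed (auto simp: walk_edges_def)
qed

lemma walk_edges_segment: "walk_edges (drop i (take j p)) \<subseteq> walk_edges p"
proof
  fix e
  assume "e \<in> walk_edges (drop i (take j p))"
  then obtain k where k: "Suc k < length (drop i (take j p))"
    "e = {drop i (take j p) ! k, drop i (take j p) ! Suc k}"
    unfolding walk_edges_def by blast
  then have len: "i \<le> length (take j p)" "Suc (i + k) < j" "Suc (i + k) < length p"
    by auto
  then have "e = {p ! (i + k), p ! Suc (i + k)}"
    using k(2) by (simp add: nth_drop)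
  then show "e \<in> walk_edges p" using len(3) unfolding walk_edges_def by blast
qed

locale cubic_caterpillar =
  fixes T C :: "'a sgraph" and p :: "'a list"
  assumes halin: "cubic_halin T C"
    and spine: "p \<noteq> []" "distinct p" "remove_verts T (leaves T) = path_graph p"
begin

abbreviation n :: nat where "n \<equiv> length p"
abbreviation E :: "'a set set" where "E \<equiv> edges (graph_union T C)"

lemma tree: "is_tree T"
  using halin unfolding cubic_halin_def halin_def by blast

lemma fin_simple_T: "fin_simple_graph T"
  using tree unfolding is_tree_def by blast

lemma T_edge: "{x, y} \<in> edges T \<Longrightarrow> x \<noteq> y \<and> x \<in> verts T \<and> y \<in> verts T"
  using fin_simple_T unfolding fin_simple_graph_def by fastforce

lemma cycle: "is_cycle C" "verts C = leaves T"
  using halin unfolding cubic_halin_def halin_def by blast+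

lemma set_spine: "set p = verts T - leaves T"
  using spine(3) by (simp add: remove_verts_def path_graph_def)

lemma spine_edge_iff: "{x, y} \<in> walk_edges p \<longleftrightarrow> {x, y} \<in> edges T \<and> x \<notin> leaves T \<and> y \<notin> leaves T"
proof -
  have "walk_edges p = {e \<in> edges T. e \<inter> leaves T = {}}"
    using spine(3) by (simp add: remove_verts_def path_graph_def)
  then show ?thesis by auto
qed

lemma leaf_neighbor:
  assumes "x \<in> leaves T"
  obtains y where "\<forall>z. {x, z} \<in> edges T \<longleftrightarrow> z = y"
proof -
  have "card {z. {x, z} \<in> edges T} = 1"
    using assms card_neighbors[OF fin_simple_T] by (simp add: leaves_def)
  then obtain y where "{z. {x, z} \<in> edges T} = {y}"
    by (rule card_1_singletonE)
  then show ?thesis using that by blast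
qed

text \<open>Two adjacent leaves would form a component of their own, but a tree path leads from them to the
  spine.\<close>
lemma no_edge_between_leaves:
  assumes xy: "{x, y} \<in> edges T" and x: "x \<in> leaves T"
  shows "y \<notin> leaves T"
proof
  assume y: "y \<in> leaves T"
  have x': "z = y" if "{x, z} \<in> edges T" for z
    using leaf_neighbor[OF x] that xy by metis
  have y': "z = x" if "{y, z} \<in> edges T" for z
    using leaf_neighbor[OF y] that xy by (metis insert_commute)
  define s where "s = hd p"
  have s: "s \<in> verts T" "s \<notin> leaves T"
    using spine(1) set_spine unfolding s_def by (metis Diff_iff list.set_sel(1))+
  have "x \<in> verts T" using x by (simp add: leaves_def)
  then obtain r where r: "r \<noteq> []" "distinct r" "hd r = x" "last r = s" "subgraph (path_graph r) T"
    using tree s(1) unfolding is_tree_def connected_graph_def by blast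
  have E: "walk_edges r \<subseteq> edges T"
    using r(5) by (simp add: subgraph_def path_graph_def)
  obtain r1 where r1: "r = x # r1" using r(1,3) by (metis list.collapse)
  have "r1 \<noteq> []" using r1 r(4) x s(2) by auto
  then obtain b r2 where r2: "r1 = b # r2" by (meson list.exhaust)
  then have "b = y" using x' E r1 by simp
  have "r2 \<noteq> []" using r1 r2 r(4) y s(2) \<open>b = y\<close> by auto
  then obtain d r3 where r3: "r2 = d # r3" by (meson list.exhaust)
  then have "d = x" using y' E r1 r2 \<open>b = y\<close> by simp
  then show False using r(2) r1 r2 r3 by simp
qed

definition attached :: "nat \<Rightarrow> 'a set" where
  "attached i = {x \<in> leaves T. {p ! i, x} \<in> edges T}"

lemma leaf_tree_neighbor:
  assumes "x \<in> attached i"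
  shows "{x, z} \<in> edges T \<longleftrightarrow> z = p ! i"
proof -
  have x: "x \<in> leaves T" "{x, p ! i} \<in> edges T"
    using assms by (auto simp: attached_def insert_commute)
  obtain y where y: "\<forall>z. {x, z} \<in> edges T \<longleftrightarrow> z = y" using leaf_neighbor[OF x(1)] .
  then have "y = p ! i" using x(2) by simp
  then show ?thesis using y by simp
qed

lemma attached_unique:
  assumes "x \<in> attached i" "x \<in> attached j" "i < n" "j < n"
  shows "i = j"
proof -
  have "p ! i = p ! j"
    using leaf_tree_neighbor[OF assms(1), of "p ! i"] leaf_tree_neighbor[OF assms(2), of "p ! i"] by simp
  then show ?thesis using assms(3,4) spine(2) by (simp add: nth_eq_iff_index_eq)
qed

lemma leaf_attached:
  assumes "x \<in> leaves T"
  obtains i where "i < n" "x \<in> attached i"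
proof -
  obtain y where y: "\<forall>z. {x, z} \<in> edges T \<longleftrightarrow> z = y" using leaf_neighbor[OF assms] .
  then have "{x, y} \<in> edges T" by blast
  then have "y \<in> set p"
    using T_edge no_edge_between_leaves[OF _ assms] by (simp add: set_spine)
  then obtain i where "i < n" "y = p ! i" by (metis in_set_conv_nth)
  then show ?thesis
    using that[of i] assms \<open>{x, y} \<in> edges T\<close> by (simp add: attached_def insert_commute)
qed

lemma spine_vertex: "i < n \<Longrightarrow> p ! i \<in> verts T \<and> p ! i \<notin> leaves T"
  using set_spine nth_mem by blast

lemma spine_neighbors:
  assumes "i < n"
  shows "{p ! i, z} \<in> edges T \<longleftrightarrow>
    z \<in> attached i \<or> (Suc i < n \<and> z = p ! Suc i) \<or> (0 < i \<and> z = p ! (i - 1))"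
proof -
  have "{p ! i, z} \<in> edges T \<longleftrightarrow> z \<in> attached i \<or> {p ! i, z} \<in> walk_edges p"
    using spine_vertex[OF assms] unfolding spine_edge_iff attached_def by blast
  then show ?thesis
    using neighbors_in_walk_edges[OF spine(2) assms] by simp
qed

lemma finite_leaves: "finite (leaves T)"
  using fin_simple_T unfolding fin_simple_graph_def leaves_def by simp

lemma finite_attached: "finite (attached i)"
  using finite_leaves unfolding attached_def by simp

lemma card_attached:
  assumes "i < n"
  shows "card (attached i) + ((if Suc i < n then 1 else 0) + (if 0 < i then 1 else 0)) = 3"
proof -
  define S where "S = (if Suc i < n then {p ! Suc i} else {}) \<union> (if 0 < i then {p ! (i - 1)} else {})"
  have S: "card S = (if Suc i < n then 1 else 0) + (if 0 < i then 1 else 0)" "finite S"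
    using assms spine(2) unfolding S_def by (auto simp: nth_eq_iff_index_eq card_insert_if)
  have "attached i \<inter> S = {}"
    using assms spine_vertex unfolding S_def attached_def by auto
  then have "card (attached i \<union> S) = card (attached i) + card S"
    using finite_attached S(2) by (simp add: card_Un_disjoint)
  moreover have "{z. {p ! i, z} \<in> edges T} = attached i \<union> S"
    using spine_neighbors[OF assms] unfolding S_def by auto
  then have "card (attached i \<union> S) = vdegree T (p ! i)"
    using card_neighbors[OF fin_simple_T, of "p ! i"] by simp
  moreover have "vdegree T (p ! i) = 3"
    using halin spine_vertex[OF assms] unfolding cubic_halin_def by blast
  ultimately show ?thesis using S by simp
qed

lemma cycle_edge: "{x, y} \<in> edges C \<Longrightarrow> x \<in> leaves T \<and> y \<in> leaves T"
proof -
  assume xy: "{x, y} \<in> edges C"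
  obtain q where q: "3 \<le> length q" "C = cycle_graph q" using cycle(1) unfolding is_cycle_def by blast
  then have "\<Union>(edges C) = set q"
    using Union_walk_edges_eq[of "q @ [hd q]"] by (cases q) (auto simp: cycle_graph_def)
  moreover have "set q = leaves T" using cycle(2) q by (simp add: cycle_graph_def)
  ultimately show ?thesis using xy by blast
qed

lemma tree_cycle_disjoint: "edges T \<inter> edges C = {}"
proof (rule ccontr)
  assume "edges T \<inter> edges C \<noteq> {}"
  then obtain e where e: "e \<in> edges T" "e \<in> edges C" by blast
  then have "card e = 2" using fin_simple_T unfolding fin_simple_graph_def by blast
  then obtain a b where "e = {a, b}" by (metis card_2_iff)
  then show False using e cycle_edge[of a b] no_edge_between_leaves[of a b] by blast
qed

lemma outer_neighbors:
  assumes "x \<in> leaves T"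
  obtains y w where "y \<noteq> w" "y \<noteq> x" "w \<noteq> x" "\<forall>z. {x, z} \<in> edges C \<longleftrightarrow> z = y \<or> z = w"
    "y \<in> leaves T" "w \<in> leaves T"
proof -
  obtain q where q: "3 \<le> length q" "distinct q" "C = cycle_graph q"
    using cycle(1) unfolding is_cycle_def by blast
  have "x \<in> set q" using assms cycle(2) q by (simp add: cycle_graph_def)
  then obtain y w where yw: "y \<noteq> w" "y \<noteq> x" "w \<noteq> x" "\<forall>z. {x, z} \<in> edges C \<longleftrightarrow> z = y \<or> z = w"
    using cycle_neighbors[OF q(3,2,1)] by metis
  then have "y \<in> leaves T" "w \<in> leaves T" using cycle_edge by blast+
  then show ?thesis using that yw by blast
qed

lemma verts_union: "verts (graph_union T C) = set p \<union> leaves T"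
  using cycle(2) set_spine by (auto simp: graph_union_def leaves_def)

lemma fin_simple_union: "fin_simple_graph (graph_union T C)"
proof -
  have "card e = 2 \<and> e \<subseteq> leaves T" if e: "e \<in> edges C" for e
  proof -
    obtain q where q: "3 \<le> length q" "distinct q" "C = cycle_graph q"
      using cycle(1) unfolding is_cycle_def by blast
    obtain i where i: "Suc i < length (q @ [hd q])" "e = {(q @ [hd q]) ! i, (q @ [hd q]) ! Suc i}"
      using e q(3) unfolding cycle_graph_def walk_edges_def by auto
    then have "(q @ [hd q]) ! i \<in> leaves T" using cycle_edge e by metis
    then obtain z w where zw: "z \<noteq> w" "z \<noteq> (q @ [hd q]) ! i" "w \<noteq> (q @ [hd q]) ! i"
      "\<forall>t. {(q @ [hd q]) ! i, t} \<in> edges C \<longleftrightarrow> t = z \<or> t = w" by (rule outer_neighbors)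
    have "(q @ [hd q]) ! i \<noteq> (q @ [hd q]) ! Suc i"
      using zw(2,3) spec[OF zw(4), of "(q @ [hd q]) ! Suc i"] e i(2) by auto
    then show ?thesis using i(2) cycle_edge e by auto
  qed
  then show ?thesis
    using fin_simple_T cycle(2) finite_leaves unfolding fin_simple_graph_def graph_union_def by auto
qed

lemma E_leaf:
  assumes "x \<in> attached i" "\<forall>z. {x, z} \<in> edges C \<longleftrightarrow> z = y \<or> z = w"
  shows "{x, z} \<in> E \<longleftrightarrow> z = p ! i \<or> z = y \<or> z = w"
  using leaf_tree_neighbor[OF assms(1)] assms(2) by (auto simp: graph_union_def)

lemma E_spine:
  assumes "i < n"
  shows "{p ! i, z} \<in> E \<longleftrightarrow>
    z \<in> attached i \<or> (Suc i < n \<and> z = p ! Suc i) \<or> (0 < i \<and> z = p ! (i - 1))"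
  using spine_neighbors[OF assms] cycle_edge[of "p ! i" z] spine_vertex[OF assms]
  by (auto simp: graph_union_def)

text \<open>Run along the spine; the path stays between the two spine vertices that carry the leaves.\<close>
lemma tree_path_between_leaves:
  assumes "a \<in> attached i" "b \<in> attached j" "i < n" "j < n" "a \<noteq> b"
  shows "\<exists>r. distinct r \<and> r \<noteq> [] \<and> hd r = a \<and> last r = b \<and> walk_edges r \<subseteq> edges T \<and>
    set r \<subseteq> {a, b} \<union> (!) p ` {min i j..max i j} \<and> {a, b} \<subseteq> set r"
proof -
  have main: "\<exists>r. distinct r \<and> r \<noteq> [] \<and> hd r = a \<and> last r = b \<and> walk_edges r \<subseteq> edges T \<and>
    set r \<subseteq> {a, b} \<union> (!) p ` {i..j} \<and> {a, b} \<subseteq> set r"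
    if ab: "a \<in> attached i" "b \<in> attached j" "i \<le> j" "j < n" "a \<noteq> b" for a b i j
  proof -
    define s where "s = drop i (take (Suc j) p)"
    have len: "length s = Suc j - i" using ab by (simp add: s_def)
    have nth: "s ! k = p ! (i + k)" if "k < length s" for k
      using that ab len by (simp add: s_def)
    have "s \<noteq> []" using len ab by auto
    then have hd_last: "hd s = p ! i" "last s = p ! j"
      using nth len ab by (simp_all add: hd_conv_nth last_conv_nth)
    have set_s: "set s \<subseteq> (!) p ` {i..j}"
      using nth len by (fastforce simp: in_set_conv_nth)
    have leaf: "a \<in> leaves T" "b \<in> leaves T" using ab by (auto simp: attached_def)
    have "set s \<inter> leaves T = {}"
      using set_s ab spine_vertex by auto
    then have "distinct (a # s @ [b])"
      using ab(5) leaf spine(2) by (auto simp: s_def)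
    moreover have "walk_edges (a # s @ [b]) \<subseteq> edges T"
    proof -
      have s1: "s = p ! i # tl s" "s = butlast s @ [p ! j]"
        using hd_last \<open>s \<noteq> []\<close> by (metis list.collapse, metis append_butlast_last_id)
      have "walk_edges (a # s @ [b]) = insert {a, p ! i} (walk_edges (s @ [b]))"
        using s1(1) by (metis append_Cons walk_edges_Cons)
      also have "walk_edges (s @ [b]) = walk_edges s \<union> {{p ! j, b}}"
        using walk_edges_append[of "butlast s" "p ! j" "[b]"] s1(2)
        by (metis append.assoc append_Cons append_Nil walk_edges_Cons walk_edges_single)
      finally have "walk_edges (a # s @ [b]) = insert {a, p ! i} (walk_edges s \<union> {{p ! j, b}})" .
      moreover have "walk_edges s \<subseteq> edges T"
      proof
        fix e assume "e \<in> walk_edges s"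
        then have "e \<in> walk_edges p" using walk_edges_segment unfolding s_def by blast
        then show "e \<in> edges T"
          unfolding walk_edges_def using spine_edge_iff walk_edges_def by blast
      qed
      ultimately show ?thesis
        using ab(1,2) by (auto simp: attached_def insert_commute)
    qed
    ultimately show ?thesis
      using set_s by (intro exI[of _ "a # s @ [b]"]) auto
  qed
  show ?thesis
  proof (cases "i \<le> j")
    case True
    then show ?thesis using main[OF assms(1,2) True assms(4,5)] by (simp add: min_def max_def)
  next
    case False
    then obtain r where r: "distinct r" "r \<noteq> []" "hd r = b" "last r = a" "walk_edges r \<subseteq> edges T"
      "set r \<subseteq> {b, a} \<union> (!) p ` {j..i}" "{b, a} \<subseteq> set r"
      using main[OF assms(2,1) _ assms(3) assms(5)[symmetric]] by auto
    then show ?thesis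
      using False by (intro exI[of _ "rev r"]) (auto simp: min_def max_def hd_rev last_rev)
  qed
qed

definition early :: "nat \<Rightarrow> 'a set" where
  "early i = (\<Union>j\<le>i. attached j)"

lemma early_subset: "early i \<subseteq> leaves T"
  by (auto simp: early_def attached_def)

lemma late_leaf:
  assumes "x \<in> leaves T" "x \<notin> early i"
  obtains j where "i < j" "j < n" "x \<in> attached j"
  using leaf_attached[OF assms(1)] assms(2) unfolding early_def by (metis UN_I atMost_iff not_le)

text \<open>The tree paths between two early leaves and between two late leaves use disjoint parts of the
  spine, so planarity forbids that they interlace on the outer cycle.\<close>
lemma not_interlaced:
  assumes i: "i < n" and il: "interlaced C a b x y"
    and X: "a \<in> early i" "b \<in> early i" "x \<notin> early i" "y \<notin> early i"
  shows False
proof -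
  obtain P Q where C: "C = cycle_graph (a # P @ b # Q)" "distinct (a # P @ b # Q)" "x \<in> set P" "y \<in> set Q"
    using il unfolding interlaced_def by blast
  then have q: "set (a # P @ b # Q) = leaves T"
    using cycle(2) by (simp add: cycle_graph_def)
  then have lv: "a \<in> leaves T" "b \<in> leaves T" "x \<in> leaves T" "y \<in> leaves T"
    using C(3,4) by auto
  obtain ja jb where j: "ja \<le> i" "a \<in> attached ja" "jb \<le> i" "b \<in> attached jb"
    using X(1,2) unfolding early_def by blast
  obtain jx where jx: "i < jx" "jx < n" "x \<in> attached jx" using late_leaf[OF lv(3) X(3)] .
  obtain jy where jy: "i < jy" "jy < n" "y \<in> attached jy" using late_leaf[OF lv(4) X(4)] .
  have "a \<noteq> b" "x \<noteq> y" using C(2-) by auto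
  obtain r where r: "distinct r" "r \<noteq> []" "hd r = a" "last r = b" "walk_edges r \<subseteq> edges T"
    "set r \<subseteq> {a, b} \<union> (!) p ` {min ja jb..max ja jb}" "{a, b} \<subseteq> set r"
    using tree_path_between_leaves[OF j(2,4) _ _ \<open>a \<noteq> b\<close>] j i by auto
  obtain s where s: "distinct s" "s \<noteq> []" "hd s = x" "last s = y" "walk_edges s \<subseteq> edges T"
    "set s \<subseteq> {x, y} \<union> (!) p ` {min jx jy..max jx jy}"
    using tree_path_between_leaves[OF jx(3) jy(3) jx(2) jy(2) \<open>x \<noteq> y\<close>] by auto
  define I where "I = (!) p ` {..i}"
  define J where "J = (!) p ` {i<..<n}"
  have r': "set r \<subseteq> {a, b} \<union> I"
    using r(6) j(1,3) unfolding I_def by fastforce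
  have s': "set s \<subseteq> {x, y} \<union> J"
    using s(6) jx(1,2) jy(1,2) unfolding J_def by fastforce
  have "I \<inter> leaves T = {}" "J \<inter> leaves T = {}"
    using spine_vertex i unfolding I_def J_def by auto
  then have sp: "{a, b} \<inter> J = {}" "{x, y} \<inter> I = {}" "I \<inter> leaves T = {}"
    using lv by blast+
  have "I \<inter> J = {}"
    using spine(2) i unfolding I_def J_def by (auto simp: nth_eq_iff_index_eq)
  moreover have "{a, b} \<inter> {x, y} = {}" using X by auto
  ultimately have "({a, b} \<union> I) \<inter> ({x, y} \<union> J) = {}"
    using sp(1,2) by (simp add: Int_Un_distrib Int_Un_distrib2 Int_commute)
  then have disj: "set r \<inter> set s = {}"
    using r' s' by (meson disjoint_iff subsetD)
  have rq: "set r \<inter> set (a # P @ b # Q) = {a, b}"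
    unfolding q
  proof
    show "set r \<inter> leaves T \<subseteq> {a, b}" using r' sp(3) by blast
    show "{a, b} \<subseteq> set r \<inter> leaves T" using r(7) lv by blast
  qed
  obtain pos crv where D: "plane_drawing (graph_union T C) pos crv"
    "frontier (outside (drawn_set (graph_union T C) pos crv)) = drawn_set C pos crv"
    using halin unfolding cubic_halin_def halin_def by blast
  show False
    by (rule tree_paths_do_not_cross[OF fin_simple_union D C(1) refl C(2) tree_cycle_disjoint
      r(1,3,4,5) rq s(2,1) _ _ s(5) disj]) (use s C in simp_all)
qed

end

context cubic_caterpillar
begin

section \<open>Cutting the outer cycle along the spine\<close>

text \<open>The leaves of the first \<open>i + 1\<close> spine vertices are separated from the others on the outer cycle by the
  two disjoint edges \<open>x1 y1\<close> and \<open>x2 y2\<close>.\<close>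
definition cut :: "nat \<Rightarrow> 'a \<Rightarrow> 'a \<Rightarrow> 'a \<Rightarrow> 'a \<Rightarrow> bool" where
  "cut i x1 y1 x2 y2 \<longleftrightarrow> x1 \<noteq> x2 \<and> y1 \<noteq> y2 \<and> {x1, x2} \<subseteq> early i \<and> {y1, y2} \<subseteq> leaves T - early i \<and>
    (\<forall>x y. x \<in> early i \<longrightarrow> y \<in> leaves T - early i \<longrightarrow>
      ({x, y} \<in> edges C \<longleftrightarrow> x = x1 \<and> y = y1 \<or> x = x2 \<and> y = y2))"

lemma cutD:
  assumes "cut i x1 y1 x2 y2"
  shows "x1 \<noteq> x2" "y1 \<noteq> y2" "x1 \<in> early i" "x2 \<in> early i" "y1 \<in> leaves T" "y2 \<in> leaves T"
    "y1 \<notin> early i" "y2 \<notin> early i" "{x1, y1} \<in> edges C" "{x2, y2} \<in> edges C"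
    "\<And>x y. x \<in> early i \<Longrightarrow> y \<in> leaves T \<Longrightarrow> y \<notin> early i \<Longrightarrow> {x, y} \<in> edges C \<Longrightarrow>
      x = x1 \<and> y = y1 \<or> x = x2 \<and> y = y2"
  using assms unfolding cut_def by auto

lemma cut_swap: "cut i x1 y1 x2 y2 \<Longrightarrow> cut i x2 y2 x1 y1"
  unfolding cut_def by auto

lemma hd_neq_last: "distinct xs \<Longrightarrow> 2 \<le> card (set xs) \<Longrightarrow> hd xs \<noteq> last xs"
  by (cases xs) (auto simp: card_insert_if)

lemma card_attached_ends:
  assumes "2 \<le> n"
  shows "card (attached 0) = 2" "card (attached (n - 1)) = 2"
proof -
  have "0 < n" "Suc 0 < n" "n - 1 < n" "\<not> Suc (n - 1) < n" "0 < n - 1" using assms by auto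
  then show "card (attached 0) = 2" "card (attached (n - 1)) = 2"
    using card_attached[of 0] card_attached[of "n - 1"] by simp_all
qed

lemma attached_inner:
  assumes "Suc (Suc i) < n"
  obtains u where "attached (Suc i) = {u}"
proof -
  have "card (attached (Suc i)) = 1"
    using card_attached[of "Suc i"] assms by simp
  then show ?thesis using that by (rule card_1_singletonE)
qed

lemma early_0: "early 0 = attached 0"
  by (simp add: early_def)

lemma early_Suc: "early (Suc i) = early i \<union> attached (Suc i)"
  unfolding early_def by (auto simp: le_Suc_eq)

lemma attached_leaf: "x \<in> attached i \<Longrightarrow> x \<in> leaves T"
  by (simp add: attached_def)

lemma not_early:
  assumes "x \<in> attached j" "i < j" "j < n"
  shows "x \<notin> early i"
proof
  assume "x \<in> early i"
  then obtain k where "k \<le> i" "x \<in> attached k" unfolding early_def by blast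
  then show False using attached_unique[of x k j] assms by simp
qed

lemma leaves_eq_early:
  assumes "n = Suc (Suc i)"
  shows "leaves T - early i = attached (Suc i)"
proof
  show "leaves T - early i \<subseteq> attached (Suc i)"
  proof
    fix x assume x: "x \<in> leaves T - early i"
    then obtain j where "i < j" "j < n" "x \<in> attached j" using late_leaf[of x i] by blast
    then show "x \<in> attached (Suc i)" using assms by (simp add: less_Suc_eq)
  qed
  show "attached (Suc i) \<subseteq> leaves T - early i"
    using not_early attached_leaf assms by auto
qed

text \<open>The early leaves form an arc of the outer cycle because no two early leaves interlace with two late
  ones. Both this arc and the complementary one have at least two leaves, those at the first and at the
  last spine vertex, so the two edges between the arcs are disjoint.\<close>
lemma cut_exists:
  assumes i: "Suc i < n"
  obtains x1 y1 x2 y2 where "cut i x1 y1 x2 y2"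
proof -
  obtain q where q: "3 \<le> length q" "distinct q" "C = cycle_graph q"
    using cycle(1) unfolding is_cycle_def by blast
  have set_q: "set q = leaves T" using cycle(2) q by (simp add: cycle_graph_def)
  have sub: "attached 0 \<subseteq> early i" "attached (n - 1) \<subseteq> leaves T - early i"
  proof -
    show "attached 0 \<subseteq> early i" unfolding early_def by blast
    show "attached (n - 1) \<subseteq> leaves T - early i"
      using not_early[of _ "n - 1" i] attached_leaf i by auto
  qed
  have fin: "finite (early i)" "finite (leaves T - early i)"
    using finite_leaves early_subset finite_subset by blast+
  have two: "2 \<le> card (early i)" "2 \<le> card (leaves T - early i)"
    using card_mono[OF fin(1) sub(1)] card_mono[OF fin(2) sub(2)] card_attached_ends i by simp_all
  then obtain x y where "x \<in> early i" "y \<in> leaves T - early i"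
    by (metis all_not_in_conv card.empty not_numeral_le_zero)
  then obtain P Q where PQ: "C = cycle_graph (P @ Q)" "distinct (P @ Q)"
    "set P = set q \<inter> early i" "set Q = set q - early i"
    using arc_if_not_interlaced[OF q(3,2), of x "early i" y] not_interlaced[of i] i early_subset
    by (smt (verit, best) Diff_iff Suc_lessD set_q subsetD)
  have sets: "set P = early i" "set Q = leaves T - early i"
    using PQ(3,4) set_q early_subset[of i] by auto
  have "set P \<noteq> {}" "set Q \<noteq> {}"
    using two sets by (metis card.empty not_numeral_le_zero)+
  then have ne: "P \<noteq> []" "Q \<noteq> []" by auto
  have "hd P \<noteq> last P" "hd Q \<noteq> last Q"
    using hd_neq_last[of P] hd_neq_last[of Q] PQ(2) two sets by auto
  moreover have "hd P \<in> early i" "last P \<in> early i" "hd Q \<in> leaves T - early i" "last Q \<in> leaves T - early i"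
    using hd_in_set[OF ne(1)] last_in_set[OF ne(1)] hd_in_set[OF ne(2)] last_in_set[OF ne(2)] sets by auto
  ultimately have "cut i (last P) (hd Q) (hd P) (last Q)"
    unfolding cut_def using cut_of_arc[OF PQ(1,2) ne] sets by auto
  then show ?thesis using that by blast
qed

text \<open>Otherwise both outer edges at \<open>u\<close> would belong to the next cut, but the edges of a cut are disjoint.\<close>
lemma next_leaf_on_cut:
  assumes cut: "cut i x1 y1 x2 y2" and i: "Suc (Suc i) < n" and u: "attached (Suc i) = {u}"
  shows "u = y1 \<or> u = y2"
proof (rule ccontr)
  assume nu: "\<not> (u = y1 \<or> u = y2)"
  have "u \<in> leaves T" "u \<notin> early i" using attached_leaf not_early[of u "Suc i" i] u i by auto
  then obtain y w where yw: "y \<noteq> w" "y \<noteq> u" "w \<noteq> u" "\<forall>z. {u, z} \<in> edges C \<longleftrightarrow> z = y \<or> z = w"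
    "y \<in> leaves T" "w \<in> leaves T" using outer_neighbors by metis
  have far: "z \<notin> early (Suc i)" if z: "z = y \<or> z = w" for z
  proof
    assume "z \<in> early (Suc i)"
    then have "z \<in> early i" using z yw(2,3) u by (auto simp: early_Suc)
    moreover have "{z, u} \<in> edges C" using z yw(4) by (metis insert_commute)
    ultimately show False using cutD(11)[OF cut] \<open>u \<in> leaves T\<close> \<open>u \<notin> early i\<close> nu by blast
  qed
  obtain a1 b1 a2 b2 where c: "cut (Suc i) a1 b1 a2 b2" using cut_exists[OF i] .
  have "u \<in> early (Suc i)" using u by (simp add: early_Suc)
  then have "u = a1 \<and> y = b1 \<or> u = a2 \<and> y = b2" "u = a1 \<and> w = b1 \<or> u = a2 \<and> w = b2"
    using cutD(11)[OF c] far yw by blast+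
  then show False using yw(1) cutD(1)[OF c] by blast
qed

text \<open>Passing the leaf \<open>u\<close> replaces the edge \<open>x1 u\<close> of the cut by the other outer edge at \<open>u\<close>.\<close>
lemma cut_step:
  assumes cut: "cut i x1 u x2 y2" and i: "Suc (Suc i) < n" and u: "attached (Suc i) = {u}"
  obtains u' where "cut (Suc i) u u' x2 y2" "\<forall>z. {u, z} \<in> edges C \<longleftrightarrow> z = x1 \<or> z = u'"
proof -
  note c = cutD[OF cut]
  obtain y w where yw: "y \<noteq> w" "y \<noteq> u" "w \<noteq> u" "\<forall>z. {u, z} \<in> edges C \<longleftrightarrow> z = y \<or> z = w"
    "y \<in> leaves T" "w \<in> leaves T" using outer_neighbors[OF c(5)] by metis
  have "{u, x1} \<in> edges C" using c(9) by (simp add: insert_commute)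
  then obtain u' where u': "u' \<noteq> x1" "u' \<noteq> u" "u' \<in> leaves T" "\<forall>z. {u, z} \<in> edges C \<longleftrightarrow> z = x1 \<or> z = u'"
    using yw by metis
  have "u' \<notin> early i"
  proof
    assume "u' \<in> early i"
    moreover have "{u', u} \<in> edges C" using u'(4) by (metis insert_commute)
    ultimately show False using c(11)[OF _ c(5,7)] u'(1) c(2) by blast
  qed
  then have far: "u' \<notin> early (Suc i)" using u u'(2) by (simp add: early_Suc)
  obtain a1 b1 a2 b2 where c': "cut (Suc i) a1 b1 a2 b2" using cut_exists[OF i] .
  have "u = a1 \<and> u' = b1 \<or> u = a2 \<and> u' = b2"
    using cutD(11)[OF c' _ u'(3) far] u u'(4) by (simp add: early_Suc)
  moreover have "x2 = a1 \<and> y2 = b1 \<or> x2 = a2 \<and> y2 = b2"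
    using cutD(11)[OF c' _ c(6) _ c(10)] u c(2,4,8) by (simp add: early_Suc)
  moreover have "u \<noteq> x2" using c(4,7) by blast
  ultimately have "cut (Suc i) u u' x2 y2"
    using c' cut_swap by blast
  then show ?thesis using that u'(4) by blast
qed

text \<open>The two leaves at the first spine vertex have one cut edge each, so their second outer edges join
  them: the first spine vertex lies in a triangle.\<close>
lemma cut_start:
  assumes "cut 0 x1 y1 x2 y2" "2 \<le> n"
  shows "attached 0 = {x1, x2}" "\<forall>z. {x1, z} \<in> edges C \<longleftrightarrow> z = y1 \<or> z = x2"
    "\<forall>z. {x2, z} \<in> edges C \<longleftrightarrow> z = y2 \<or> z = x1"
proof -
  have main: "attached 0 = {x1, x2} \<and> (\<forall>z. {x1, z} \<in> edges C \<longleftrightarrow> z = y1 \<or> z = x2)"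
    if cut: "cut 0 x1 y1 x2 y2" for x1 y1 x2 y2
  proof -
    note c = cutD[OF cut, unfolded early_0]
    have eq: "attached 0 = {x1, x2}"
      using card_seteq[OF finite_attached, of "{x1, x2}" 0] c(1,3,4) card_attached_ends(1)[OF assms(2)]
      by simp
    obtain y w where yw: "y \<noteq> w" "y \<noteq> x1" "w \<noteq> x1" "\<forall>z. {x1, z} \<in> edges C \<longleftrightarrow> z = y \<or> z = w"
      "y \<in> leaves T" "w \<in> leaves T" using outer_neighbors[OF attached_leaf[OF c(3)]] by metis
    have "z = y1 \<or> z = x2" if "z = y \<or> z = w" for z
      using c(11)[of x1 z] that yw eq c(1,3) by blast
    moreover have "y1 = y \<or> y1 = w" using c(9) yw(4) by blast
    ultimately show ?thesis using eq yw by metis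
  qed
  show "attached 0 = {x1, x2}" "\<forall>z. {x1, z} \<in> edges C \<longleftrightarrow> z = y1 \<or> z = x2"
    "\<forall>z. {x2, z} \<in> edges C \<longleftrightarrow> z = y2 \<or> z = x1"
    using main[OF assms(1)] main[OF cut_swap[OF assms(1)]] by blast+
qed

lemma cut_end:
  assumes "cut i x1 y1 x2 y2" "n = Suc (Suc i)"
  shows "attached (Suc i) = {y1, y2}" "\<forall>z. {y1, z} \<in> edges C \<longleftrightarrow> z = x1 \<or> z = y2"
    "\<forall>z. {y2, z} \<in> edges C \<longleftrightarrow> z = x2 \<or> z = y1"
proof -
  have main: "attached (Suc i) = {y1, y2} \<and> (\<forall>z. {y1, z} \<in> edges C \<longleftrightarrow> z = x1 \<or> z = y2)"
    if cut: "cut i x1 y1 x2 y2" for x1 y1 x2 y2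
  proof -
    note c = cutD[OF cut]
    have in_last: "z \<in> leaves T \<Longrightarrow> z \<notin> early i \<Longrightarrow> z \<in> attached (Suc i)" for z
      using leaves_eq_early[OF assms(2)] by blast
    have "card (attached (Suc i)) = 2"
      using card_attached_ends(2) assms(2) by simp
    then have eq: "attached (Suc i) = {y1, y2}"
      using card_seteq[OF finite_attached, of "{y1, y2}" "Suc i"] in_last[OF c(5,7)] in_last[OF c(6,8)] c(2)
      by simp
    obtain y w where yw: "y \<noteq> w" "y \<noteq> y1" "w \<noteq> y1" "\<forall>z. {y1, z} \<in> edges C \<longleftrightarrow> z = y \<or> z = w"
      "y \<in> leaves T" "w \<in> leaves T" using outer_neighbors[OF c(5)] by metis
    have "z = x1 \<or> z = y2" if z: "z = y \<or> z = w" for z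
    proof (cases "z \<in> early i")
      case True
      have "{z, y1} \<in> edges C" using z yw(4) by (metis insert_commute)
      then show ?thesis using c(11)[OF True c(5,7)] c(2) by blast
    next
      case False
      then show ?thesis using in_last[of z] eq z yw by blast
    qed
    moreover have "x1 = y \<or> x1 = w" using c(9) yw(4) by (metis insert_commute)
    ultimately show ?thesis using eq yw by metis
  qed
  show "attached (Suc i) = {y1, y2}" "\<forall>z. {y1, z} \<in> edges C \<longleftrightarrow> z = x1 \<or> z = y2"
    "\<forall>z. {y2, z} \<in> edges C \<longleftrightarrow> z = x2 \<or> z = y1"
    using main[OF assms(1)] main[OF cut_swap[OF assms(1)]] by blast+
qed

section \<open>Coloring along the spine\<close>

definition stage :: "nat \<Rightarrow> 'a set" where
  "stage i = (!) p ` {..i} \<union> early i"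

lemma stage_Suc: "stage (Suc i) = stage i \<union> ({p ! Suc i} \<union> attached (Suc i))"
  unfolding stage_def early_Suc atMost_Suc by auto

lemma leaf_notin_stage:
  assumes "x \<in> leaves T" "x \<notin> early i" "i < n"
  shows "x \<notin> stage i"
proof
  assume "x \<in> stage i"
  then obtain j where "j \<le> i" "x = p ! j" using assms(2) unfolding stage_def by blast
  then show False using spine_vertex[of j] assms by simp
qed

lemma spine_notin_stage:
  assumes "i < j" "j < n"
  shows "p ! j \<notin> stage i"
proof
  assume "p ! j \<in> stage i"
  moreover have "p ! j \<notin> early i" using spine_vertex[OF assms(2)] early_subset by blast
  ultimately obtain k where "k \<le> i" "p ! j = p ! k" unfolding stage_def by blast
  then show False using assms spine(2) by (simp add: nth_eq_iff_index_eq)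
qed

text \<open>The leaf \<open>u\<close> is the outer end of a cut edge and the next spine vertex is the outer end of the spine
  edge, so both are attached to the colored part by ports and adjacent to each other.\<close>
lemma extend_stage:
  assumes i: "Suc (Suc i) < n" and u: "attached (Suc i) = {u}" and cut: "cut i x1 u x2 y2"
    and star: "star_on 5 E c (stage i)"
    and L: "has_port E c (stage i) x1 u L" and S: "has_port E c (stage i) (p ! i) (p ! Suc i) S"
    and R: "has_port E c (stage i) x2 y2 R"
    and ok: "step_ok L S e l s"
  obtains c' u' where "cut (Suc i) u u' x2 y2" "star_on 5 E c' (stage (Suc i))"
    "has_port E c' (stage (Suc i)) u u' (next_port L (fst S) e l s)"
    "has_port E c' (stage (Suc i)) (p ! Suc i) (p ! Suc (Suc i)) (next_port S (fst L) e s l)"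
    "has_port E c' (stage (Suc i)) x2 y2 R"
proof -
  obtain u' where u': "cut (Suc i) u u' x2 y2" "\<forall>z. {u, z} \<in> edges C \<longleftrightarrow> z = x1 \<or> z = u'"
    using cut_step[OF cut i u] .
  note c = cutD[OF cut] and c' = cutD[OF u'(1)]
  have "u \<in> attached (Suc i)" using u by simp
  then have Nu: "{u, z} \<in> E \<longleftrightarrow> z \<in> {x1, p ! Suc i, u'}" for z
    using E_leaf[OF _ u'(2)] by auto
  have Nv: "{p ! Suc i, z} \<in> E \<longleftrightarrow> z \<in> {p ! i, u, p ! Suc (Suc i)}" for z
    using E_spine[of "Suc i" z] i u by auto
  have leaf: "u \<in> leaves T" "u' \<in> leaves T" "y2 \<in> leaves T" using c(5,6) c'(5) by simp_all
  have sp: "p ! Suc i \<notin> leaves T" "p ! Suc (Suc i) \<notin> leaves T" "p ! Suc (Suc i) \<noteq> p ! Suc i"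
    using spine_vertex i spine(2) by (auto simp: nth_eq_iff_index_eq)
  have "u' \<notin> early i" "u' \<noteq> u" using c'(7) u by (auto simp: early_Suc)
  then have out: "u' \<notin> stage i" "p ! Suc (Suc i) \<notin> stage i" "u' \<noteq> u" "p ! Suc (Suc i) \<noteq> p ! Suc i"
    "u' \<noteq> p ! Suc i" "p ! Suc (Suc i) \<noteq> u" "u \<noteq> p ! Suc i" "y2 \<noteq> u" "y2 \<noteq> p ! Suc i"
    using leaf_notin_stage[OF leaf(2)] spine_notin_stage[of i "Suc (Suc i)"] i sp leaf c(2) by auto
  have st: "stage (Suc i) = stage i \<union> {p ! Suc i, u}"
    using u by (simp add: stage_Suc insert_commute)
  show ?thesis
    using attach[OF star L S R Nu Nv out ok] that[OF u'(1)] unfolding st by metis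
qed

lemma stage_0:
  assumes n: "2 < n"
  obtains u c x1 x2 y2 L S R where "attached 1 = {u}" "cut 0 x1 u x2 y2" "ready L S R"
    "star_on 5 E c (stage 0)" "has_port E c (stage 0) x1 u L"
    "has_port E c (stage 0) (p ! 0) (p ! 1) S" "has_port E c (stage 0) x2 y2 R"
proof -
  obtain u where u: "attached (Suc 0) = {u}" using attached_inner[of 0] n by auto
  have "Suc 0 < n" using n by simp
  then obtain x1 y1 x2 y2 where "cut 0 x1 y1 x2 y2" using cut_exists by blast
  then obtain x1 x2 y2 where cut: "cut 0 x1 u x2 y2"
    using next_leaf_on_cut[of 0] cut_swap n u by (metis numeral_2_eq_2)
  note c = cutD[OF cut] and s = cut_start[OF cut less_imp_le[OF n]]
  have "0 < n" "Suc 0 < n" using n spine(1) by simp_all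
  have N1: "{x1, z} \<in> E \<longleftrightarrow> z \<in> {u, p ! 0, x2}" for z
    using E_leaf[OF _ s(2), of 0 z] s(1) by auto
  have N2: "{p ! 0, z} \<in> E \<longleftrightarrow> z \<in> {p ! 1, x1, x2}" for z
    using E_spine[OF \<open>0 < n\<close>, of z] s(1) \<open>Suc 0 < n\<close> by auto
  have N3: "{x2, z} \<in> E \<longleftrightarrow> z \<in> {y2, x1, p ! 0}" for z
    using E_leaf[OF _ s(3), of 0 z] s(1) by auto
  have lv: "x1 \<in> leaves T" "x2 \<in> leaves T" using c(3,4) early_subset by blast+
  have sp: "p ! 0 \<notin> leaves T" "p ! 1 \<notin> leaves T" "p ! 0 \<noteq> p ! 1"
    using spine_vertex[OF \<open>0 < n\<close>] spine_vertex[OF \<open>Suc 0 < n\<close>]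
      nth_eq_iff_index_eq[OF spine(2) \<open>0 < n\<close> \<open>Suc 0 < n\<close>] by simp_all
  have ne: "x1 \<noteq> p ! 0" "x1 \<noteq> x2" "p ! 0 \<noteq> x2" "{u, p ! 1, y2} \<inter> {x1, p ! 0, x2} = {}"
    using lv sp c by auto
  have st: "stage 0 = {x1, p ! 0, x2}"
    using s(1) by (auto simp: stage_def early_0)
  obtain c L S R where "star_on 5 E c (stage 0)" "ready L S R" "has_port E c (stage 0) x1 u L"
    "has_port E c (stage 0) (p ! 0) (p ! 1) S" "has_port E c (stage 0) x2 y2 R"
    using start_triangle[OF N1 N2 N3 ne] unfolding st by metis
  then show ?thesis using that cut u by (metis One_nat_def)
qed

text \<open>Between \<open>stage i\<close> and the rest there are only the spine edge and the two cut edges. The port that is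
  listed first is the cut edge to the next leaf.\<close>
lemma stage_ready:
  assumes "Suc (Suc i) < n"
  shows "\<exists>u c x1 x2 y2 L S R. attached (Suc i) = {u} \<and> cut i x1 u x2 y2 \<and> ready L S R \<and>
    star_on 5 E c (stage i) \<and> has_port E c (stage i) x1 u L \<and>
    has_port E c (stage i) (p ! i) (p ! Suc i) S \<and> has_port E c (stage i) x2 y2 R"
  using assms
proof (induction i)
  case 0
  then have "2 < n" by simp
  then show ?case using stage_0 by (metis One_nat_def)
next
  case (Suc i)
  then have i: "Suc (Suc i) < n" by simp
  obtain u c x1 x2 y2 L S R where st: "attached (Suc i) = {u}" "cut i x1 u x2 y2" "ready L S R"
    "star_on 5 E c (stage i)" "has_port E c (stage i) x1 u L"
    "has_port E c (stage i) (p ! i) (p ! Suc i) S" "has_port E c (stage i) x2 y2 R"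
    using Suc.IH[OF i] by blast
  obtain w where w: "attached (Suc (Suc i)) = {w}"
    using attached_inner[OF Suc.prems] .
  show ?case
  proof (cases "w = y2")
    case False
    obtain e l s L' S' R' where r: "step_ok L S e l s" "ready L' S' R'"
      "port_le (next_port L (fst S) e l s) L'" "port_le (next_port S (fst L) e s l) S'" "port_le R R'"
      using ready_same_side[OF st(3)] .
    obtain c' u' where e: "cut (Suc i) u u' x2 y2" "star_on 5 E c' (stage (Suc i))"
      "has_port E c' (stage (Suc i)) u u' (next_port L (fst S) e l s)"
      "has_port E c' (stage (Suc i)) (p ! Suc i) (p ! Suc (Suc i)) (next_port S (fst L) e s l)"
      "has_port E c' (stage (Suc i)) x2 y2 R"
      using extend_stage[OF i st(1,2,4-7) r(1)] .
    have "w = u'" using next_leaf_on_cut[OF e(1) Suc.prems w] False by blast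
    then show ?thesis
      using w e(1,2) r(2) has_port_weaken[OF e(3) r(3)] has_port_weaken[OF e(4) r(4)]
        has_port_weaken[OF e(5) r(5)] by blast
  next
    case True
    obtain e l s L' S' R' where r: "step_ok L S e l s" "ready R' S' L'"
      "port_le (next_port L (fst S) e l s) L'" "port_le (next_port S (fst L) e s l) S'" "port_le R R'"
      using ready_other_side[OF st(3)] .
    obtain c' u' where e: "cut (Suc i) u u' x2 y2" "star_on 5 E c' (stage (Suc i))"
      "has_port E c' (stage (Suc i)) u u' (next_port L (fst S) e l s)"
      "has_port E c' (stage (Suc i)) (p ! Suc i) (p ! Suc (Suc i)) (next_port S (fst L) e s l)"
      "has_port E c' (stage (Suc i)) x2 y2 R"
      using extend_stage[OF i st(1,2,4-7) r(1)] .
    show ?thesis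
      using w True cut_swap[OF e(1)] e(2) r(2) has_port_weaken[OF e(3) r(3)]
        has_port_weaken[OF e(4) r(4)] has_port_weaken[OF e(5) r(5)] by blast
  qed
qed

lemma star_5_coloring_long:
  assumes n: "3 \<le> n"
  obtains c where "star_on 5 E c (set p \<union> leaves T)"
proof -
  obtain i where i: "n = Suc (Suc (Suc i))"
    using n by (metis Suc_le_D numeral_3_eq_3 Suc_le_mono)
  then have i': "Suc (Suc i) < n" by simp
  obtain u c x1 x2 y2 L S R where st: "attached (Suc i) = {u}" "cut i x1 u x2 y2" "ready L S R"
    "star_on 5 E c (stage i)" "has_port E c (stage i) x1 u L"
    "has_port E c (stage i) (p ! i) (p ! Suc i) S" "has_port E c (stage i) x2 y2 R"
    using stage_ready[OF i'] by blast
  obtain e l s e1 e3 e2 where r: "step_ok L S e l s"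
    "close_ok (next_port L (fst S) e l s) (next_port S (fst L) e s l) R e1 e2 e3"
    using ready_close[OF st(3)] .
  obtain c' u' where e: "cut (Suc i) u u' x2 y2" "star_on 5 E c' (stage (Suc i))"
    "has_port E c' (stage (Suc i)) u u' (next_port L (fst S) e l s)"
    "has_port E c' (stage (Suc i)) (p ! Suc i) (p ! Suc (Suc i)) (next_port S (fst L) e s l)"
    "has_port E c' (stage (Suc i)) x2 y2 R"
    using extend_stage[OF i' st(1,2,4-7) r(1)] .
  note d = cut_end[OF e(1) i]
  have N: "{u', z} \<in> E \<longleftrightarrow> z \<in> {u, p ! Suc (Suc i), y2}"
    "{p ! Suc (Suc i), z} \<in> E \<longleftrightarrow> z \<in> {p ! Suc i, u', y2}"
    "{y2, z} \<in> E \<longleftrightarrow> z \<in> {x2, u', p ! Suc (Suc i)}" for z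
    using E_leaf[OF _ d(2), of "Suc (Suc i)" z] E_leaf[OF _ d(3), of "Suc (Suc i)" z]
      E_spine[of "Suc (Suc i)" z] d(1) i by auto
  note f = cutD[OF e(1)]
  have "p ! Suc (Suc i) \<notin> leaves T" using spine_vertex i by simp
  then have ne: "u' \<noteq> p ! Suc (Suc i)" "u' \<noteq> y2" "p ! Suc (Suc i) \<noteq> y2"
    using f(2,5,6) by auto
  obtain c'' where "star_on 5 E c'' (stage (Suc i) \<union> {u', p ! Suc (Suc i), y2})"
    using close_up[OF e(2-5) N ne r(2)] .
  moreover have "stage (Suc i) \<union> {u', p ! Suc (Suc i), y2} = set p \<union> leaves T"
  proof -
    have "stage (Suc i) \<union> {u', p ! Suc (Suc i), y2} = (!) p ` {..Suc (Suc i)} \<union> (early (Suc i) \<union> attached (Suc (Suc i)))"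
      unfolding stage_def atMost_Suc d(1) by auto
    also have "early (Suc i) \<union> attached (Suc (Suc i)) = leaves T"
      using leaves_eq_early[OF i] early_subset[of "Suc i"] by blast
    also have "(!) p ` {..Suc (Suc i)} = set p"
      using i by (auto simp: set_conv_nth image_iff less_Suc_eq_le)
    finally show ?thesis .
  qed
  ultimately show ?thesis using that by simp
qed

section \<open>Triangles and short spines\<close>

lemma min_degree_3: "min_degree_3 E (set p \<union> leaves T)"
  unfolding min_degree_3_def
proof (intro ballI allI)
  fix x y z :: 'a
  assume x: "x \<in> set p \<union> leaves T"
  have "3 \<le> card {w. {x, w} \<in> E}"
  proof (cases "x \<in> leaves T")
    case True
    obtain i where i: "i < n" "x \<in> attached i" using leaf_attached[OF True] .
    obtain y w where yw: "y \<noteq> w" "y \<noteq> x" "w \<noteq> x" "\<forall>z. {x, z} \<in> edges C \<longleftrightarrow> z = y \<or> z = w"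
      "y \<in> leaves T" "w \<in> leaves T" using outer_neighbors[OF True] .
    have "{w. {x, w} \<in> E} = {p ! i, y, w}"
      using E_leaf[OF i(2) yw(4)] by auto
    moreover have "p ! i \<noteq> y" "p ! i \<noteq> w"
      using yw(5,6) spine_vertex[OF i(1)] by blast+
    then have "card {p ! i, y, w} = 3"
      using yw(1) by simp
    ultimately show ?thesis by simp
  next
    case False
    then obtain i where i: "i < n" "x = p ! i" using x by (metis UnE in_set_conv_nth)
    have "{w. {x, w} \<in> E} = {w. {x, w} \<in> edges T}"
      using E_spine[OF i(1)] spine_neighbors[OF i(1)] i(2) by simp
    moreover have "vdegree T x = 3"
      using halin spine_vertex[OF i(1)] i(2) unfolding cubic_halin_def by blast
    ultimately show ?thesis
      using card_neighbors[OF fin_simple_T, of x] by simp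
  qed
  moreover have "card {y, z} \<le> 2" by (simp add: card_insert_if)
  ultimately have "\<not> {w. {x, w} \<in> E} \<subseteq> {y, z}"
    using card_mono[of "{y, z}" "{w. {x, w} \<in> E}"] by auto
  then obtain w where w: "{x, w} \<in> E" "w \<noteq> y" "w \<noteq> z" by blast
  moreover have "w \<in> set p \<union> leaves T"
  proof -
    have "{x, w} \<subseteq> verts (graph_union T C)"
      using fin_simple_union w(1) unfolding fin_simple_graph_def by metis
    then show ?thesis unfolding verts_union by simp
  qed
  ultimately show "\<exists>w\<in>set p \<union> leaves T. {x, w} \<in> E \<and> w \<noteq> y \<and> w \<noteq> z"
    by blast
qed

lemma single_spine_vertex:
  assumes "n = 1"
  obtains a b d where "leaves T = {a, b, d}" "a \<noteq> b" "b \<noteq> d" "a \<noteq> d" "set p = {p ! 0}"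
    "E = {{p ! 0, a}, {p ! 0, b}, {p ! 0, d}, {a, b}, {b, d}, {a, d}}"
proof -
  have att: "attached 0 = leaves T"
    using leaf_attached attached_leaf assms by (metis less_one subsetI subset_antisym)
  have "card (leaves T) = 3"
    using card_attached[of 0] assms att by simp
  then obtain a b d where abd: "leaves T = {a, b, d}" "a \<noteq> b" "b \<noteq> d" "a \<noteq> d"
    by (metis card_3_iff)
  have C: "{x, z} \<in> edges C" if x: "x \<in> leaves T" and z: "z \<in> leaves T" "x \<noteq> z" for x z
  proof -
    obtain y w where yw: "y \<noteq> w" "y \<noteq> x" "w \<noteq> x" "\<forall>z. {x, z} \<in> edges C \<longleftrightarrow> z = y \<or> z = w"
      "y \<in> leaves T" "w \<in> leaves T" using outer_neighbors[OF x] .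
    have "card {x, y, w} = 3" using yw(1-3) by auto
    moreover have "{x, y, w} \<subseteq> leaves T" using x yw(5,6) by simp
    ultimately have "{x, y, w} = leaves T"
      using card_subset_eq[OF finite_leaves] \<open>card (leaves T) = 3\<close> by simp
    then have "z = y \<or> z = w" using z by auto
    then show ?thesis using yw(4) by simp
  qed
  have p: "set p = {p ! 0}" using assms by (cases p) auto
  have "E = {{p ! 0, a}, {p ! 0, b}, {p ! 0, d}, {a, b}, {b, d}, {a, d}}" (is "_ = ?K")
  proof
    show "?K \<subseteq> E"
      using att abd C unfolding graph_union_def by (auto simp: attached_def)
    show "E \<subseteq> ?K"
    proof
      fix e assume e: "e \<in> E"
      then have "card e = 2" "e \<subseteq> set p \<union> leaves T"
        using fin_simple_union verts_union unfolding fin_simple_graph_def by auto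
      moreover obtain x y where xy: "e = {x, y}" "x \<noteq> y"
        using \<open>card e = 2\<close> by (metis card_2_iff)
      ultimately have "x \<in> {p ! 0, a, b, d}" "y \<in> {p ! 0, a, b, d}"
        using p abd(1) by auto
      then show "e \<in> ?K"
        using xy(2) unfolding xy(1) by (elim insertE emptyE) (simp_all add: insert_commute)
    qed
  qed
  then show ?thesis using that abd p by blast
qed

text \<open>In \<open>K\<^sub>4\<close> one color may be used twice, on a pair of disjoint edges, if the other four edges get the
  remaining colors: an alternating walk needs two repeated colors.\<close>
lemma star_5_coloring_single:
  assumes "n = 1"
  obtains c where "star_on 5 E c (set p \<union> leaves T)"
proof -
  obtain a b d where abd: "leaves T = {a, b, d}" "a \<noteq> b" "b \<noteq> d" "a \<noteq> d" and p: "set p = {p ! 0}"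
    and E: "E = {{p ! 0, a}, {p ! 0, b}, {p ! 0, d}, {a, b}, {b, d}, {a, d}}"
    using single_spine_vertex[OF assms] .
  define v where "v = p ! 0"
  have v: "v \<noteq> a" "v \<noteq> b" "v \<noteq> d"
    using spine_vertex[of 0] assms abd(1) unfolding v_def by auto
  \<comment> \<open>the color 1 stays on the disjoint edges \<open>va\<close> and \<open>bd\<close>\<close>
  define c :: "'a set \<Rightarrow> nat" where
    "c = (\<lambda>_. 1)({v, b} := 2, {v, d} := 3, {a, b} := 4, {a, d} := 5)"
  have c: "c {v, a} = 1" "c {v, b} = 2" "c {v, d} = 3" "c {a, b} = 4" "c {b, d} = 1" "c {a, d} = 5"
    using abd v by (auto simp: c_def doubleton_eq_iff)
  have E': "E = {{v, a}, {v, b}, {v, d}, {a, b}, {b, d}, {a, d}}" using E v_def by simp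
  have no_loop: "{x, x} \<notin> E" for x
    using abd v unfolding E' by (auto simp: doubleton_eq_iff)
  have twice: "e \<in> {{v, a}, {b, d}} \<and> f \<in> {{v, a}, {b, d}}"
    if "e \<in> E" "f \<in> E" "e \<noteq> f" "c e = c f" for e f
    using that(1,2) unfolding E' by (elim insertE emptyE) (use that(3,4) c in simp_all)
  have disjoint: "x \<notin> f" if "e \<in> {{v, a}, {b, d}}" "f \<in> {{v, a}, {b, d}}" "e \<noteq> f" "x \<in> e" for e f x
    using that abd v by auto
  have "star_on 5 E c UNIV"
    unfolding star_on_def
  proof (intro conjI ballI allI impI)
    fix x y
    assume "{x, y} \<in> E"
    then show "c {x, y} \<in> {1..5}" using c unfolding E' by auto
  next
    fix x y z
    assume xyz: "{x, y} \<in> E" "{x, z} \<in> E" "y \<noteq> z"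
    then have "{x, y} \<noteq> {x, z}" by (auto simp: doubleton_eq_iff)
    then show "c {x, y} \<noteq> c {x, z}"
      using twice[OF xyz(1,2)] disjoint[of "{x, y}" "{x, z}" x] by blast
  next
    fix p0 p1 p2 p3 p4
    assume e: "{p0, p1} \<in> E" "{p1, p2} \<in> E" "{p2, p3} \<in> E" "{p3, p4} \<in> E"
      and ne: "p0 \<noteq> p2" "p1 \<noteq> p3" "p2 \<noteq> p4"
    have "p1 \<noteq> p2" "p2 \<noteq> p3"
      using e(2,3) no_loop by blast+
    then have d: "{p0, p1} \<noteq> {p2, p3}" "{p1, p2} \<noteq> {p3, p4}" "{p0, p1} \<noteq> {p1, p2}"
      using ne by (auto simp: doubleton_eq_iff)
    show "\<not> (c {p0, p1} = c {p2, p3} \<and> c {p1, p2} = c {p3, p4})"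
    proof
      assume alt: "c {p0, p1} = c {p2, p3} \<and> c {p1, p2} = c {p3, p4}"
      have "{p0, p1} \<in> {{v, a}, {b, d}}"
        by (rule conjunct1[OF twice[OF e(1,3) d(1) conjunct1[OF alt]]])
      moreover have "{p1, p2} \<in> {{v, a}, {b, d}}"
        by (rule conjunct1[OF twice[OF e(2,4) d(2) conjunct2[OF alt]]])
      ultimately show False using disjoint[of "{p0, p1}" "{p1, p2}" p1] d(3) by simp
    qed
  qed
  then have "star_on 5 E c (set p \<union> leaves T)"
    unfolding star_on_def by blast
  then show ?thesis using that by blast
qed

lemma ex_triangle:
  obtains a b d where "{a, b} \<in> E" "{b, d} \<in> E" "{a, d} \<in> E" "a \<noteq> b" "b \<noteq> d" "a \<noteq> d"
    "{a, b, d} \<subseteq> set p \<union> leaves T"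
proof (cases "n = 1")
  case True
  then show ?thesis using single_spine_vertex that by (metis insertCI sup_ge2)
next
  case False
  then have n: "2 \<le> n" "Suc 0 < n" using spine(1) by (cases p; simp; cases "tl p"; simp)+
  obtain x1 y1 x2 y2 where cut: "cut 0 x1 y1 x2 y2" using cut_exists[OF n(2)] .
  note c = cutD[OF cut] and s = cut_start[OF cut n(1)]
  have "0 < n" using spine(1) by simp
  then have "p ! 0 \<notin> leaves T" "p ! 0 \<in> set p" using spine_vertex nth_mem by blast+
  moreover have "x1 \<in> leaves T" "x2 \<in> leaves T" using c(3,4) early_subset by blast+
  moreover have "{x1, x2} \<in> E" using s(2) by (simp add: graph_union_def)
  moreover have "{p ! 0, x1} \<in> E" "{p ! 0, x2} \<in> E"
    using s(1) E_spine[OF \<open>0 < n\<close>] by simp_all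
  ultimately show ?thesis
    using that[of "p ! 0" x1 x2] c(1) by auto
qed

lemma two_spine_vertices_prism:
  assumes n: "n = 2"
  shows "graph_iso (graph_union T C) (necklace 2)"
proof -
  have "Suc 0 < n" using n by simp
  then obtain x1 y1 x2 y2 where cut: "cut 0 x1 y1 x2 y2" using cut_exists by blast
  have n': "2 \<le> n" "n = Suc (Suc 0)" using n by simp_all
  note c = cutD[OF cut] and s = cut_start[OF cut n'(1)] and t = cut_end[OF cut n'(2)]
  define v where "v = p ! 0"
  define w where "w = p ! 1"
  have p: "set p = {v, w}"
    using n unfolding v_def w_def by (cases p; cases "tl p") auto
  have "v \<notin> leaves T" "w \<notin> leaves T" "v \<noteq> w"
    using spine_vertex n spine(2) unfolding v_def w_def by (auto simp: nth_eq_iff_index_eq)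
  moreover have lv: "leaves T = {x1, x2, y1, y2}"
    using s(1) t(1) leaves_eq_early[OF n'(2)] early_subset[of 0] unfolding early_0 by auto
  ultimately have dist: "distinct [v, w, x1, x2, y1, y2]"
    using c(1-8) by auto
  have V: "verts (graph_union T C) = {v, w, x1, x2, y1, y2}"
    unfolding verts_union p lv by auto
  have "0 < n" "1 < n" using n spine(1) by simp_all
  then have Nv: "{v, z} \<in> E \<longleftrightarrow> z \<in> {w, x1, x2}" and Nw: "{w, z} \<in> E \<longleftrightarrow> z \<in> {v, y1, y2}" for z
    using E_spine[OF \<open>0 < n\<close>, of z] E_spine[OF \<open>1 < n\<close>, of z] s(1) t(1) n
    unfolding v_def w_def by auto
  have Nx: "{x1, z} \<in> E \<longleftrightarrow> z \<in> {v, y1, x2}" "{x2, z} \<in> E \<longleftrightarrow> z \<in> {v, y2, x1}" for z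
    using E_leaf[OF _ s(2), of 0 z] E_leaf[OF _ s(3), of 0 z] s(1) unfolding v_def by simp_all
  have Ny: "{y1, z} \<in> E \<longleftrightarrow> z \<in> {w, x1, y2}" "{y2, z} \<in> E \<longleftrightarrow> z \<in> {w, x2, y1}" for z
    using E_leaf[OF _ t(2), of 1 z] E_leaf[OF _ t(3), of 1 z] t(1) unfolding w_def by simp_all
  have E_eq: "E = {{v, w}, {v, x1}, {v, x2}, {w, y1}, {w, y2}, {x1, x2}, {y1, y2}, {x1, y1}, {x2, y2}}"
    (is "_ = ?K")
  proof
    show "?K \<subseteq> E" using Nv Nw Nx Ny by simp
    show "E \<subseteq> ?K"
    proof
      fix e assume e: "e \<in> E"
      then have "card e = 2" "e \<subseteq> {v, w, x1, x2, y1, y2}"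
        using fin_simple_union V unfolding fin_simple_graph_def by auto
      moreover obtain a b where ab: "e = {a, b}"
        using \<open>card e = 2\<close> by (metis card_2_iff)
      ultimately have "a \<in> {v, w, x1, x2, y1, y2}" by auto
      then have b: "a = v \<and> b \<in> {w, x1, x2} \<or> a = w \<and> b \<in> {v, y1, y2} \<or>
          a = x1 \<and> b \<in> {v, y1, x2} \<or> a = x2 \<and> b \<in> {v, y2, x1} \<or>
          a = y1 \<and> b \<in> {w, x1, y2} \<or> a = y2 \<and> b \<in> {w, x2, y1}"
        using e Nv[of b] Nw[of b] Nx[of b] Ny[of b] unfolding ab by auto
      then show "e \<in> ?K"
        unfolding ab by (elim disjE conjE insertE emptyE) (simp_all add: insert_commute)
    qed
  qed
  \<comment> \<open>the outer cycle runs through \<open>x2, x1, y1, y2\<close> in this order\<close>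
  define f where "f = (\<lambda>_. OuterV 3)(v := SpineV 1, w := SpineV 2, x2 := OuterV 0, x1 := OuterV 1, y1 := OuterV 2)"
  have f: "f v = SpineV 1" "f w = SpineV 2" "f x2 = OuterV 0" "f x1 = OuterV 1" "f y1 = OuterV 2"
    "f y2 = OuterV 3"
    using dist by (auto simp: f_def)
  have "verts (necklace 2) = {SpineV 1, SpineV 2, OuterV 0, OuterV 1, OuterV 2, OuterV 3}"
    by (auto simp: necklace_def atLeastAtMost_def image_iff numeral_eq_Suc le_Suc_eq)
  then have "f ` {v, w, x1, x2, y1, y2} = verts (necklace 2)"
    using f by auto
  moreover have "inj_on f {v, w, x1, x2, y1, y2}"
    using f dist by (auto simp: inj_on_def)
  ultimately have "bij_betw f (verts (graph_union T C)) (verts (necklace 2))"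
    unfolding V by (simp add: bij_betw_def)
  moreover have "edges (necklace 2) = (\<lambda>e. f ` e) ` E"
  proof -
    have i1: "{{SpineV i, SpineV (i + 1)} | i. 1 \<le> i \<and> i < 2} = {{SpineV 1, SpineV 2}}"
    proof -
      have "1 \<le> i \<and> i < 2 \<longleftrightarrow> i = 1" for i :: nat by auto
      then show ?thesis by (simp add: numeral_2_eq_2)
    qed
    have i2: "{{SpineV i, OuterV i} | i. 1 \<le> i \<and> i \<le> 2} = {{SpineV 1, OuterV 1}, {SpineV 2, OuterV 2}}"
    proof -
      have "1 \<le> i \<and> i \<le> 2 \<longleftrightarrow> i = 1 \<or> i = 2" for i :: nat by auto
      then show ?thesis by auto
    qed
    have i3: "{{OuterV i, OuterV (i + 1)} | i. i \<le> 2} =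
        {{OuterV 0, OuterV 1}, {OuterV 1, OuterV 2}, {OuterV 2, OuterV 3}}"
    proof -
      have "i \<le> 2 \<longleftrightarrow> i = 0 \<or> i = 1 \<or> i = 2" for i :: nat by auto
      then have "{i. i \<le> 2} = {0, 1, 2::nat}" by blast
      then have "(\<lambda>i. {OuterV i, OuterV (i + 1)}) ` {i. i \<le> 2} =
          (\<lambda>i. {OuterV i, OuterV (i + 1)}) ` {0, 1, 2}" by simp
      then show ?thesis by (simp add: image_Collect numeral_2_eq_2 numeral_3_eq_3)
    qed
    have "edges (necklace 2) = {{SpineV 1, SpineV 2}, {SpineV 1, OuterV 1}, {SpineV 2, OuterV 2},
        {SpineV 1, OuterV 0}, {SpineV 2, OuterV 3}, {OuterV 0, OuterV 1}, {OuterV 1, OuterV 2},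
        {OuterV 2, OuterV 3}, {OuterV 3, OuterV 0}}"
      unfolding necklace_def snd_conv i1 i2 i3 by (simp add: insert_commute)
    then show ?thesis
      unfolding E_eq by (auto simp: f insert_commute)
  qed
  ultimately show ?thesis unfolding graph_iso_def by blast
qed

end

section \<open>The star chromatic index\<close>

theorem theorem4p1:
  fixes h :: nat and G T C :: "'a sgraph"
  assumes "h \<ge> 1"
    and "G = graph_union T C"
    and "caterpillar_halin h T C"
    and "\<not> graph_iso G (necklace 2)"
  shows "star_chromatic_index G = 5"
proof -
  obtain p where "p \<noteq> []" "distinct p" "remove_verts T (leaves T) = path_graph p"
    using assms(3) unfolding caterpillar_halin_def caterpillar_def is_path_def by blast
  then interpret cubic_caterpillar T C p
    using assms(3) unfolding caterpillar_halin_def by unfold_locales auto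
  have star_iff: "star_edge_coloring G k c \<longleftrightarrow> star_on k E c (set p \<union> leaves T)" for k c
    using star_edge_coloring_iff_star_on[OF fin_simple_union] verts_union assms(2) by simp
  have "n \<noteq> 2" using two_spine_vertices_prism assms(2,4) by blast
  moreover have "n \<noteq> 0" using spine(1) by simp
  ultimately consider "n = 1" | "3 \<le> n" by linarith
  then obtain c where "star_edge_coloring G 5 c"
    unfolding star_iff by cases (use star_5_coloring_single star_5_coloring_long in metis)+
  then have five: "1 \<le> (5::nat) \<and> (\<exists>c. star_edge_coloring G 5 c)" by auto
  have lower: "5 \<le> k" if k: "1 \<le> k \<and> (\<exists>c. star_edge_coloring G k c)" for k
  proof (rule ccontr)
    assume "\<not> 5 \<le> k"
    obtain c where "star_on k E c (set p \<union> leaves T)"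
      using k unfolding star_iff by blast
    then have "star_on 4 E c (set p \<union> leaves T)"
      by (rule star_on_mono) (use \<open>\<not> 5 \<le> k\<close> in simp)
    moreover obtain a b d where "{a, b} \<in> E" "{b, d} \<in> E" "{a, d} \<in> E" "a \<noteq> b" "b \<noteq> d" "a \<noteq> d"
      "{a, b, d} \<subseteq> set p \<union> leaves T" using ex_triangle .
    ultimately show False
      using no_star_4_edge_coloring_triangle[OF _ min_degree_3, of c a b d] by blast
  qed
  show ?thesis
    unfolding star_chromatic_index_def
  proof (rule Least_equality)
    show "1 \<le> (5::nat) \<and> (\<exists>c. star_edge_coloring G 5 c)" using five .
  qed (rule lower)
qed

end
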